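(* Let $S$ be the Cox ring of a smooth projective toric variety $X$, and let $M$ be a finitely generated $\operatorname{Pic}(X)$-graded $S$-module. If $M$ has a virtual resolution of length $\ell$, then $\operatorname{Ext}^i_S(M,N)^\sim=0=\operatorname{Tor}_i^S(M,N)^\sim$ for all finitely generated $\operatorname{Pic}(X)$-graded $S$-modules $N$ and all $i>\ell$.
   Context: $X$ is over an algebraically closed field; $S$ is a $\operatorname{Pic}(X)$-graded polynomial ring; $\widetilde M=M^\sim$ denotes the coherent sheaf on $X$ associated to a finitely generated graded module $M$. A virtual resolution of $M$ is a complex $F_\bullet=[F_0\leftarrow F_1\leftarrow\cdots]$ of finitely generated $\operatorname{Pic}(X)$-graded free $S$-modules such that the corresponding complex $\widetilde F_\bullet$ of vector bundles on $X$ is a locally free resolution of $\widetilde M$. *)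

theory Defs
  imports
    "HOL-Analysis.Analysis"
    "HOL-Computational_Algebra.Polynomial"
    "HOL-Algebra.Module"
    "HOL-Algebra.AbelCoset"
    "HOL-Algebra.Generated_Groups"
    "HOL-Algebra.Free_Abelian_Groups"
begin

section \<open>Fans and smooth projective toric varieties\<close>

text \<open>
  The ambient type \<open>'v\<close> is the real vector space spanned by the lattice of one-parameter
  subgroups. It is only required to be a real vector space, so dimension 0 is included.
\<close>

definition is_lattice_basis :: "'v::real_vector set \<Rightarrow> 'v set \<Rightarrow> bool" where
  "is_lattice_basis L B \<longleftrightarrow>
     finite B \<and> independent B \<and> span B = UNIV \<and>
     L = {(\<Sum>b\<in>B. of_int (c b) *\<^sub>R b) | c :: 'v \<Rightarrow> int. True}"

definition is_lattice :: "'v::real_vector set \<Rightarrow> bool" where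
  "is_lattice L \<longleftrightarrow> (\<exists>B. is_lattice_basis L B)"

definition dual_lattice :: "'v::real_vector set \<Rightarrow> ('v \<Rightarrow> real) set" where
  "dual_lattice L = {m. linear m \<and> (\<forall>u\<in>L. m u \<in> \<int>)}"

definition rational_cone :: "'v::real_vector set \<Rightarrow> 'v set \<Rightarrow> bool" where
  "rational_cone L \<sigma> \<longleftrightarrow> (\<exists>A. finite A \<and> A \<subseteq> L \<and> \<sigma> = convex_cone hull A)"

definition strongly_convex :: "'v::real_vector set \<Rightarrow> bool" where
  "strongly_convex \<sigma> \<longleftrightarrow> \<sigma> \<inter> uminus ` \<sigma> = {0}"

text \<open>In the library the empty set is a face of every set; it is not a cone and is excluded.\<close>

definition is_fan :: "'v::real_vector set \<Rightarrow> 'v set set \<Rightarrow> bool" where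
  "is_fan L \<Delta> \<longleftrightarrow>
     finite \<Delta> \<and> \<Delta> \<noteq> {} \<and>
     (\<forall>\<sigma>\<in>\<Delta>. rational_cone L \<sigma> \<and> strongly_convex \<sigma>) \<and>
     (\<forall>\<sigma>\<in>\<Delta>. \<forall>\<tau>. \<tau> face_of \<sigma> \<and> \<tau> \<noteq> {} \<longrightarrow> \<tau> \<in> \<Delta>) \<and>
     (\<forall>\<sigma>\<in>\<Delta>. \<forall>\<tau>\<in>\<Delta>. (\<sigma> \<inter> \<tau>) face_of \<sigma> \<and> (\<sigma> \<inter> \<tau>) face_of \<tau>)"

definition rays :: "'v::real_vector set set \<Rightarrow> 'v set set" where
  "rays \<Delta> = {\<rho>\<in>\<Delta>. dim \<rho> = 1}"

definition ray_gen :: "'v::real_vector set \<Rightarrow> 'v set \<Rightarrow> 'v" where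
  "ray_gen L \<rho> =
     (THE u. u \<in> \<rho> \<inter> L \<and> u \<noteq> 0 \<and> (\<forall>w\<in>\<rho> \<inter> L. \<exists>n::nat. w = of_nat n *\<^sub>R u))"

definition smooth_fan :: "'v::real_vector set \<Rightarrow> 'v set set \<Rightarrow> bool" where
  "smooth_fan L \<Delta> \<longleftrightarrow>
     (\<forall>\<sigma>\<in>\<Delta>. \<exists>B. is_lattice_basis L B \<and> ray_gen L ` {\<rho>\<in>rays \<Delta>. \<rho> face_of \<sigma>} \<subseteq> B)"

definition complete_fan :: "'v::real_vector set set \<Rightarrow> bool" where
  "complete_fan \<Delta> \<longleftrightarrow> \<Union>\<Delta> = UNIV"

text \<open>
  The fan is the normal fan of a full-dimensional lattice polytope: \<open>\<phi>\<close> is the support function of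
  the polytope, that is, the integral support function of an ample divisor, and strict convexity
  is the condition on the full-dimensional cones.
\<close>

definition projective_fan :: "'v::real_vector set \<Rightarrow> 'v set set \<Rightarrow> bool" where
  "projective_fan L \<Delta> \<longleftrightarrow> complete_fan \<Delta> \<and>
     (\<exists>\<phi> :: 'v \<Rightarrow> real.
        (\<forall>\<sigma>\<in>\<Delta>. \<exists>m\<in>dual_lattice L. \<forall>u\<in>\<sigma>. \<phi> u = m u) \<and>
        (\<forall>\<sigma>\<in>\<Delta>. dim \<sigma> = dim (UNIV :: 'v set) \<longrightarrow>
           (\<forall>m\<in>dual_lattice L. (\<forall>u\<in>\<sigma>. \<phi> u = m u) \<longrightarrow>
              (\<forall>u. \<phi> u \<le> m u \<and> (\<phi> u = m u \<longrightarrow> u \<in> \<sigma>)))))"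

definition smooth_projective_fan :: "'v::real_vector set \<Rightarrow> 'v set set \<Rightarrow> bool" where
  "smooth_projective_fan L \<Delta> \<longleftrightarrow>
     is_lattice L \<and> is_fan L \<Delta> \<and> smooth_fan L \<Delta> \<and> projective_fan L \<Delta>"


section \<open>Picard group and Cox ring\<close>

type_synonym 'v divisor = "'v set \<Rightarrow>\<^sub>0 int"
type_synonym 'v pic = "'v divisor set"
type_synonym ('v, 'k) cox_poly = "('v set \<Rightarrow>\<^sub>0 nat) \<Rightarrow>\<^sub>0 'k"

text \<open>The divisors of the characters, inside the group of torus-invariant divisors.\<close>

definition principal_divisors :: "'v::real_vector set \<Rightarrow> 'v set set \<Rightarrow> 'v divisor set" where
  "principal_divisors L \<Delta> =
     {D \<in> carrier (free_Abelian_group (rays \<Delta>)).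
        \<exists>m\<in>dual_lattice L. \<forall>\<rho>\<in>rays \<Delta>. of_int (Poly_Mapping.lookup D \<rho>) = m (ray_gen L \<rho>)}"

text \<open>
  This is the divisor class group; it is the Picard group because every divisor on a smooth
  variety is Cartier. The group is written multiplicatively, with degrees as cosets.
\<close>

definition Pic :: "'v::real_vector set \<Rightarrow> 'v set set \<Rightarrow> 'v pic monoid" where
  "Pic L \<Delta> = free_Abelian_group (rays \<Delta>) Mod principal_divisors L \<Delta>"

definition monomial_degree ::
    "'v::real_vector set \<Rightarrow> 'v set set \<Rightarrow> ('v set \<Rightarrow>\<^sub>0 nat) \<Rightarrow> 'v pic" where
  "monomial_degree L \<Delta> a =
     principal_divisors L \<Delta> #>\<^bsub>free_Abelian_group (rays \<Delta>)\<^esub> Poly_Mapping.map int a"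

record ('a, 'b, 'g) graded = "('a, 'b) module" +
  grade :: "'g \<Rightarrow> 'b set"

text \<open>
  One record serves both as the ring and as the graded module of rank one over itself.
  The variables are the rays of the fan.
\<close>

definition cox_ring :: "'v::real_vector set \<Rightarrow> 'v set set \<Rightarrow>
    (('v, 'k::field) cox_poly, ('v, 'k) cox_poly, 'v pic) graded" where
  "cox_ring L \<Delta> = \<lparr>
     carrier = {p. \<forall>a\<in>Poly_Mapping.keys p. Poly_Mapping.keys a \<subseteq> rays \<Delta>},
     monoid.mult = (*), one = 1, ring.zero = 0, ring.add = (+), smult = (*),
     grade = (\<lambda>d. {p. \<forall>a\<in>Poly_Mapping.keys p.
                    Poly_Mapping.keys a \<subseteq> rays \<Delta> \<and> monomial_degree L \<Delta> a = d}) \<rparr>"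


section \<open>Graded modules\<close>

definition graded_module ::
    "'g monoid \<Rightarrow> ('a, 'a, 'g) graded \<Rightarrow> ('a, 'm, 'g) graded \<Rightarrow> bool" where
  "graded_module G R M \<longleftrightarrow>
     Module.module R M \<and>
     (\<forall>d\<in>carrier G. subgroup (grade M d) (add_monoid M)) \<and>
     (\<forall>x\<in>carrier M. \<exists>!c. c \<in> (\<Pi>\<^sub>E d\<in>carrier G. grade M d) \<and>
        finite {d\<in>carrier G. c d \<noteq> \<zero>\<^bsub>M\<^esub>} \<and>
        x = finsum M c {d\<in>carrier G. c d \<noteq> \<zero>\<^bsub>M\<^esub>}) \<and>
     (\<forall>d\<in>carrier G. \<forall>e\<in>carrier G. \<forall>r\<in>grade R d. \<forall>x\<in>grade M e.
        r \<odot>\<^bsub>M\<^esub> x \<in> grade M (d \<otimes>\<^bsub>G\<^esub> e))"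

definition finitely_generated :: "('a, 'a, 'g) graded \<Rightarrow> ('a, 'm, 'g) graded \<Rightarrow> bool" where
  "finitely_generated R M \<longleftrightarrow>
     (\<exists>A. finite A \<and> A \<subseteq> carrier M \<and>
        (\<forall>x\<in>carrier M. \<exists>c\<in>A \<rightarrow> carrier R. x = finsum M (\<lambda>a. c a \<odot>\<^bsub>M\<^esub> a) A))"

definition fg_graded_module ::
    "'g monoid \<Rightarrow> ('a, 'a, 'g) graded \<Rightarrow> ('a, 'm, 'g) graded \<Rightarrow> bool" where
  "fg_graded_module G R M \<longleftrightarrow> graded_module G R M \<and> finitely_generated R M"

definition fg_graded_free ::
    "'g monoid \<Rightarrow> ('a, 'a, 'g) graded \<Rightarrow> ('a, 'm, 'g) graded \<Rightarrow> bool" where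
  "fg_graded_free G R F \<longleftrightarrow> graded_module G R F \<and>
     (\<exists>B. finite B \<and> B \<subseteq> (\<Union>d\<in>carrier G. grade F d) \<and>
        (\<forall>x\<in>carrier F. \<exists>!c. c \<in> B \<rightarrow>\<^sub>E carrier R \<and> x = finsum F (\<lambda>b. c b \<odot>\<^bsub>F\<^esub> b) B))"

definition module_hom :: "('a, 'r) ring_scheme \<Rightarrow> ('a, 'm, 'x) module_scheme \<Rightarrow>
    ('a, 'n, 'y) module_scheme \<Rightarrow> ('m \<Rightarrow> 'n) \<Rightarrow> bool" where
  "module_hom R M N f \<longleftrightarrow>
     f \<in> carrier M \<rightarrow> carrier N \<and>
     (\<forall>x\<in>carrier M. \<forall>y\<in>carrier M. f (x \<oplus>\<^bsub>M\<^esub> y) = f x \<oplus>\<^bsub>N\<^esub> f y) \<and>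
     (\<forall>r\<in>carrier R. \<forall>x\<in>carrier M. f (r \<odot>\<^bsub>M\<^esub> x) = r \<odot>\<^bsub>N\<^esub> f x)"

definition graded_hom :: "'g monoid \<Rightarrow> ('a, 'a, 'g) graded \<Rightarrow> ('a, 'm, 'g) graded \<Rightarrow>
    ('a, 'n, 'g) graded \<Rightarrow> ('m \<Rightarrow> 'n) \<Rightarrow> bool" where
  "graded_hom G R M N f \<longleftrightarrow>
     module_hom R M N f \<and> (\<forall>d\<in>carrier G. f ` grade M d \<subseteq> grade N d)"

text \<open>The differential \<open>d i\<close> goes from \<open>F (Suc i)\<close> to \<open>F i\<close>.\<close>

definition fg_graded_free_complex :: "'g monoid \<Rightarrow> ('a, 'a, 'g) graded \<Rightarrow>
    (nat \<Rightarrow> ('a, 'f, 'g) graded) \<Rightarrow> (nat \<Rightarrow> 'f \<Rightarrow> 'f) \<Rightarrow> bool" where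
  "fg_graded_free_complex G R F d \<longleftrightarrow>
     (\<forall>i. fg_graded_free G R (F i)) \<and>
     (\<forall>i. graded_hom G R (F (Suc i)) (F i) (d i)) \<and>
     (\<forall>i. \<forall>x\<in>carrier (F (Suc (Suc i))). d i (d (Suc i) x) = \<zero>\<^bsub>F i\<^esub>)"

definition graded_free_resolution :: "'g monoid \<Rightarrow> ('a, 'a, 'g) graded \<Rightarrow>
    ('a, 'm, 'g) graded \<Rightarrow> (nat \<Rightarrow> ('a, 'f, 'g) graded) \<Rightarrow> (nat \<Rightarrow> 'f \<Rightarrow> 'f) \<Rightarrow>
    ('f \<Rightarrow> 'm) \<Rightarrow> bool" where
  "graded_free_resolution G R M F d \<epsilon> \<longleftrightarrow>
     fg_graded_free_complex G R F d \<and>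
     graded_hom G R (F 0) M \<epsilon> \<and>
     \<epsilon> ` carrier (F 0) = carrier M \<and>
     d 0 ` carrier (F 1) = {x \<in> carrier (F 0). \<epsilon> x = \<zero>\<^bsub>M\<^esub>} \<and>
     (\<forall>i. d (Suc i) ` carrier (F (Suc (Suc i))) =
          {x \<in> carrier (F (Suc i)). d i x = \<zero>\<^bsub>F i\<^esub>})"


section \<open>Ext and Tor\<close>

text \<open>
  In the records below only the module structure matters; the ring multiplication and unit
  inherited from the library's module record are irrelevant.
\<close>

definition subquotient ::
    "('a, 'm, 'g) graded \<Rightarrow> 'm set \<Rightarrow> 'm set \<Rightarrow> ('a, 'm set, 'g) graded" where
  "subquotient M K I = \<lparr>
     carrier = (\<lambda>x. I +>\<^bsub>M\<^esub> x) ` K,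
     monoid.mult = undefined, one = undefined,
     ring.zero = I, ring.add = set_add M,
     smult = (\<lambda>r X. \<Union>x\<in>X. I +>\<^bsub>M\<^esub> (r \<odot>\<^bsub>M\<^esub> x)),
     grade = (\<lambda>d. (\<lambda>x. I +>\<^bsub>M\<^esub> x) ` (K \<inter> grade M d)) \<rparr>"

definition hom_module :: "'g monoid \<Rightarrow> ('a, 'a, 'g) graded \<Rightarrow> ('a, 'm, 'g) graded \<Rightarrow>
    ('a, 'n, 'g) graded \<Rightarrow> ('a, 'm \<Rightarrow> 'n, 'g) graded" where
  "hom_module G R M N = \<lparr>
     carrier = {h \<in> extensional (carrier M). module_hom R M N h},
     monoid.mult = undefined, one = undefined,
     ring.zero = (\<lambda>x\<in>carrier M. \<zero>\<^bsub>N\<^esub>),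
     ring.add = (\<lambda>h k. \<lambda>x\<in>carrier M. h x \<oplus>\<^bsub>N\<^esub> k x),
     smult = (\<lambda>r h. \<lambda>x\<in>carrier M. r \<odot>\<^bsub>N\<^esub> h x),
     grade = (\<lambda>e. {h \<in> extensional (carrier M). module_hom R M N h \<and>
                    (\<forall>d\<in>carrier G. h ` grade M d \<subseteq> grade N (d \<otimes>\<^bsub>G\<^esub> e))}) \<rparr>"

definition tensor_relations :: "('a, 'a, 'g) graded \<Rightarrow> ('a, 'm, 'g) graded \<Rightarrow>
    ('a, 'n, 'g) graded \<Rightarrow> ('m \<times> 'n \<Rightarrow>\<^sub>0 int) set" where
  "tensor_relations R M N = generate (free_Abelian_group (carrier M \<times> carrier N))
     ({frag_of (x \<oplus>\<^bsub>M\<^esub> x', y) - frag_of (x, y) - frag_of (x', y) | x x' y.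
         x \<in> carrier M \<and> x' \<in> carrier M \<and> y \<in> carrier N} \<union>
      {frag_of (x, y \<oplus>\<^bsub>N\<^esub> y') - frag_of (x, y) - frag_of (x, y') | x y y'.
         x \<in> carrier M \<and> y \<in> carrier N \<and> y' \<in> carrier N} \<union>
      {frag_of (r \<odot>\<^bsub>M\<^esub> x, y) - frag_of (x, r \<odot>\<^bsub>N\<^esub> y) | r x y.
         r \<in> carrier R \<and> x \<in> carrier M \<and> y \<in> carrier N})"

definition tensor_coset :: "('a, 'a, 'g) graded \<Rightarrow> ('a, 'm, 'g) graded \<Rightarrow>
    ('a, 'n, 'g) graded \<Rightarrow> ('m \<times> 'n \<Rightarrow>\<^sub>0 int) \<Rightarrow> ('m \<times> 'n \<Rightarrow>\<^sub>0 int) set" where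
  "tensor_coset R M N c =
     tensor_relations R M N #>\<^bsub>free_Abelian_group (carrier M \<times> carrier N)\<^esub> c"

definition tensor_module :: "'g monoid \<Rightarrow> ('a, 'a, 'g) graded \<Rightarrow> ('a, 'm, 'g) graded \<Rightarrow>
    ('a, 'n, 'g) graded \<Rightarrow> ('a, ('m \<times> 'n \<Rightarrow>\<^sub>0 int) set, 'g) graded" where
  "tensor_module G R M N = \<lparr>
     carrier = tensor_coset R M N ` carrier (free_Abelian_group (carrier M \<times> carrier N)),
     monoid.mult = undefined, one = undefined,
     ring.zero = tensor_relations R M N,
     ring.add = set_mult (free_Abelian_group (carrier M \<times> carrier N)),
     smult = (\<lambda>r X. \<Union>c\<in>X. tensor_coset R M N
                (frag_extend (\<lambda>(x, y). frag_of (r \<odot>\<^bsub>M\<^esub> x, y)) c)),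
     grade = (\<lambda>d. tensor_coset R M N `
                generate (free_Abelian_group (carrier M \<times> carrier N))
                  {frag_of (x, y) | x y. \<exists>a\<in>carrier G. \<exists>b\<in>carrier G.
                     a \<otimes>\<^bsub>G\<^esub> b = d \<and> x \<in> grade M a \<and> y \<in> grade N b}) \<rparr>"

text \<open>The homomorphism \<open>f \<otimes> id\<close> from \<open>M \<otimes> N\<close> to \<open>M' \<otimes> N\<close>.\<close>

definition tensor_map :: "('a, 'a, 'g) graded \<Rightarrow> ('a, 'p, 'g) graded \<Rightarrow>
    ('a, 'n, 'g) graded \<Rightarrow> ('m \<Rightarrow> 'p) \<Rightarrow>
    ('m \<times> 'n \<Rightarrow>\<^sub>0 int) set \<Rightarrow> ('p \<times> 'n \<Rightarrow>\<^sub>0 int) set" where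
  "tensor_map R M' N f X =
     (\<Union>c\<in>X. tensor_coset R M' N (frag_extend (\<lambda>(x, y). frag_of (f x, y)) c))"

text \<open>
  For a graded free resolution \<open>(P, d)\<close> of \<open>M\<close> by finitely generated modules, the following are
  the graded modules \<open>Ext\<^sup>i(M, N)\<close> and \<open>Tor\<^sub>i(M, N)\<close>, computed as the cohomology of
  \<open>Hom(P, N)\<close> and the homology of \<open>P \<otimes> N\<close>.
\<close>

definition Ext_module :: "'g monoid \<Rightarrow> ('a, 'a, 'g) graded \<Rightarrow>
    (nat \<Rightarrow> ('a, 'f, 'g) graded) \<Rightarrow> (nat \<Rightarrow> 'f \<Rightarrow> 'f) \<Rightarrow> ('a, 'n, 'g) graded \<Rightarrow> nat \<Rightarrow>
    ('a, ('f \<Rightarrow> 'n) set, 'g) graded" where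
  "Ext_module G R P d N i =
     (let C = (\<lambda>j. hom_module G R (P j) N);
          \<delta> = (\<lambda>j h. restrict (h \<circ> d j) (carrier (P (Suc j))))
      in subquotient (C i)
           {h \<in> carrier (C i). \<delta> i h = \<zero>\<^bsub>C (Suc i)\<^esub>}
           (case i of 0 \<Rightarrow> {\<zero>\<^bsub>C 0\<^esub>} | Suc j \<Rightarrow> \<delta> j ` carrier (C j)))"

definition Tor_module :: "'g monoid \<Rightarrow> ('a, 'a, 'g) graded \<Rightarrow>
    (nat \<Rightarrow> ('a, 'f, 'g) graded) \<Rightarrow> (nat \<Rightarrow> 'f \<Rightarrow> 'f) \<Rightarrow> ('a, 'n, 'g) graded \<Rightarrow> nat \<Rightarrow>
    ('a, ('f \<times> 'n \<Rightarrow>\<^sub>0 int) set set, 'g) graded" where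
  "Tor_module G R P d N i =
     (let C = (\<lambda>j. tensor_module G R (P j) N);
          D = (\<lambda>j. tensor_map R (P j) N (d j))
      in subquotient (C i)
           (case i of 0 \<Rightarrow> carrier (C 0)
                    | Suc j \<Rightarrow> {z \<in> carrier (C (Suc j)). D j z = \<zero>\<^bsub>C j\<^esub>})
           (D i ` carrier (C (Suc i))))"


section \<open>The toric variety\<close>

text \<open>
  The (closed) points of the variety in homogeneous coordinates: the geometric quotient of the
  complement of the zero set of the irrelevant ideal by the group \<open>Hom(Pic X, k\<^sup>*)\<close>. A point is an
  orbit of coordinate vectors.
\<close>

type_synonym ('v, 'k) pt = "('v set \<Rightarrow> 'k) set"

definition irrelevant_locus :: "'v::real_vector set set \<Rightarrow> ('v set \<Rightarrow> 'k::field) set" where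
  "irrelevant_locus \<Delta> =
     {a \<in> rays \<Delta> \<rightarrow>\<^sub>E UNIV. \<forall>\<sigma>\<in>\<Delta>. (\<Prod>\<rho>\<in>{\<rho>\<in>rays \<Delta>. \<not> \<rho> face_of \<sigma>}. a \<rho>) = 0}"

definition cox_group ::
    "'v::real_vector set \<Rightarrow> 'v set set \<Rightarrow> ('v set \<Rightarrow> 'k::field) set" where
  "cox_group L \<Delta> = {t \<in> rays \<Delta> \<rightarrow>\<^sub>E (UNIV - {0}).
     \<forall>m\<in>dual_lattice L. (\<Prod>\<rho>\<in>rays \<Delta>. t \<rho> powi \<lfloor>m (ray_gen L \<rho>)\<rfloor>) = 1}"

definition toric_points ::
    "'v::real_vector set \<Rightarrow> 'v set set \<Rightarrow> ('v, 'k::field) pt set" where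
  "toric_points L \<Delta> =
     {(\<lambda>t. \<lambda>\<rho>\<in>rays \<Delta>. t \<rho> * a \<rho>) ` cox_group L \<Delta> | a.
        a \<in> (rays \<Delta> \<rightarrow>\<^sub>E UNIV) - irrelevant_locus \<Delta>}"

definition poly_eval :: "('v set \<Rightarrow> 'k::field) \<Rightarrow> ('v, 'k) cox_poly \<Rightarrow> 'k" where
  "poly_eval a p = (\<Sum>e\<in>Poly_Mapping.keys p. Poly_Mapping.lookup p e *
     (\<Prod>\<rho>\<in>Poly_Mapping.keys e. a \<rho> ^ Poly_Mapping.lookup e \<rho>))"

definition nonvanishing :: "('v, 'k::field) cox_poly \<Rightarrow> ('v, 'k) pt \<Rightarrow> bool" where
  "nonvanishing f P \<longleftrightarrow> (\<forall>a\<in>P. poly_eval a f \<noteq> 0)"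

definition homogeneous ::
    "'v::real_vector set \<Rightarrow> 'v set set \<Rightarrow> ('v, 'k::field) cox_poly set" where
  "homogeneous L \<Delta> = (\<Union>d\<in>carrier (Pic L \<Delta>). grade (cox_ring L \<Delta>) d)"

definition zariski ::
    "'v::real_vector set \<Rightarrow> 'v set set \<Rightarrow> ('v, 'k::field) pt topology" where
  "zariski L \<Delta> =
     topology_generated_by ((\<lambda>f. {P \<in> toric_points L \<Delta>. nonvanishing f P}) ` homogeneous L \<Delta>)"


section \<open>The sheaf associated to a graded module\<close>

text \<open>
  The stalk at a point consists of the fractions \<open>x / f\<close> of degree 0 with homogeneous
  denominator not vanishing at the point; a fraction is represented by its equivalence class of
  pairs.
\<close>

definition fraction_pairs :: "'v::real_vector set \<Rightarrow> 'v set set \<Rightarrow>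
    (('v, 'k::field) cox_poly, 'm, 'v pic) graded \<Rightarrow> ('v, 'k) pt \<Rightarrow>
    ('m \<times> ('v, 'k) cox_poly) set" where
  "fraction_pairs L \<Delta> M P = {(x, f). nonvanishing f P \<and>
     (\<exists>d\<in>carrier (Pic L \<Delta>). x \<in> grade M d \<and> f \<in> grade (cox_ring L \<Delta>) d)}"

definition fraction :: "'v::real_vector set \<Rightarrow> 'v set set \<Rightarrow>
    (('v, 'k::field) cox_poly, 'm, 'v pic) graded \<Rightarrow> ('v, 'k) pt \<Rightarrow>
    'm \<Rightarrow> ('v, 'k) cox_poly \<Rightarrow> ('m \<times> ('v, 'k) cox_poly) set" where
  "fraction L \<Delta> M P x f = {(y, g) \<in> fraction_pairs L \<Delta> M P.
     \<exists>h\<in>homogeneous L \<Delta>. nonvanishing h P \<and>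
       h \<odot>\<^bsub>M\<^esub> (g \<odot>\<^bsub>M\<^esub> x) = h \<odot>\<^bsub>M\<^esub> (f \<odot>\<^bsub>M\<^esub> y)}"

definition stalk_add :: "'v::real_vector set \<Rightarrow> 'v set set \<Rightarrow>
    (('v, 'k::field) cox_poly, 'm, 'v pic) graded \<Rightarrow> ('v, 'k) pt \<Rightarrow>
    ('m \<times> ('v, 'k) cox_poly) set \<Rightarrow> ('m \<times> ('v, 'k) cox_poly) set \<Rightarrow>
    ('m \<times> ('v, 'k) cox_poly) set" where
  "stalk_add L \<Delta> M P A B =
     (\<Union>(x, f)\<in>A. \<Union>(y, g)\<in>B. fraction L \<Delta> M P (g \<odot>\<^bsub>M\<^esub> x \<oplus>\<^bsub>M\<^esub> f \<odot>\<^bsub>M\<^esub> y) (f * g))"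

definition stalk_smult :: "'v::real_vector set \<Rightarrow> 'v set set \<Rightarrow>
    (('v, 'k::field) cox_poly, 'm, 'v pic) graded \<Rightarrow> ('v, 'k) pt \<Rightarrow>
    (('v, 'k) cox_poly \<times> ('v, 'k) cox_poly) set \<Rightarrow> ('m \<times> ('v, 'k) cox_poly) set \<Rightarrow>
    ('m \<times> ('v, 'k) cox_poly) set" where
  "stalk_smult L \<Delta> M P A B =
     (\<Union>(r, f)\<in>A. \<Union>(x, g)\<in>B. fraction L \<Delta> M P (r \<odot>\<^bsub>M\<^esub> x) (f * g))"

type_synonym ('v, 'k, 'm) section_fun =
  "('v, 'k) pt \<Rightarrow> ('m \<times> ('v, 'k) cox_poly) set"

type_synonym ('v, 'k, 'm) sheaf =
  "('v, 'k) pt set \<Rightarrow> (('v, 'k, ('v, 'k) cox_poly) section_fun, ('v, 'k, 'm) section_fun) module"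

text \<open>
  Sections over an open set are the functions to the stalks that are locally given by one
  fraction; restriction of sections is restriction of functions.
\<close>

definition tilde :: "'v::real_vector set \<Rightarrow> 'v set set \<Rightarrow>
    (('v, 'k::field) cox_poly, 'm, 'v pic) graded \<Rightarrow> ('v, 'k, 'm) sheaf" where
  "tilde L \<Delta> M U = \<lparr>
     carrier = {s \<in> extensional U. \<forall>P\<in>U. \<exists>V x f. openin (zariski L \<Delta>) V \<and> P \<in> V \<and> V \<subseteq> U \<and>
                 (\<forall>Q\<in>V. (x, f) \<in> fraction_pairs L \<Delta> M Q \<and> s Q = fraction L \<Delta> M Q x f)},
     monoid.mult = undefined, one = undefined,
     ring.zero = (\<lambda>P\<in>U. fraction L \<Delta> M P \<zero>\<^bsub>M\<^esub> 1),
     ring.add = (\<lambda>s t. \<lambda>P\<in>U. stalk_add L \<Delta> M P (s P) (t P)),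
     smult = (\<lambda>r s. \<lambda>P\<in>U. stalk_smult L \<Delta> M P (r P) (s P)) \<rparr>"

definition structure_sheaf :: "'v::real_vector set \<Rightarrow> 'v set set \<Rightarrow>
    ('v, 'k::field) pt set \<Rightarrow> ('v, 'k, ('v, 'k) cox_poly) section_fun ring" where
  "structure_sheaf L \<Delta> U =
     (let A = tilde L \<Delta> (cox_ring L \<Delta>) U
      in \<lparr> carrier = carrier A, monoid.mult = smult A,
           one = (\<lambda>P\<in>U. fraction L \<Delta> (cox_ring L \<Delta>) P 1 1),
           ring.zero = ring.zero A, ring.add = ring.add A \<rparr>)"

definition sheaf_hom :: "'v::real_vector set \<Rightarrow> 'v set set \<Rightarrow>
    ('v, 'k::field, 'm) sheaf \<Rightarrow> ('v, 'k, 'n) sheaf \<Rightarrow>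
    (('v, 'k) pt set \<Rightarrow> ('v, 'k, 'm) section_fun \<Rightarrow> ('v, 'k, 'n) section_fun) \<Rightarrow> bool" where
  "sheaf_hom L \<Delta> A B \<phi> \<longleftrightarrow>
     (\<forall>U. openin (zariski L \<Delta>) U \<longrightarrow> module_hom (structure_sheaf L \<Delta> U) (A U) (B U) (\<phi> U)) \<and>
     (\<forall>U V. openin (zariski L \<Delta>) U \<and> openin (zariski L \<Delta>) V \<and> V \<subseteq> U \<longrightarrow>
        (\<forall>s\<in>carrier (A U). \<phi> V (restrict s V) = restrict (\<phi> U s) V))"

definition tilde_map :: "'v::real_vector set \<Rightarrow> 'v set set \<Rightarrow>
    (('v, 'k::field) cox_poly, 'n, 'v pic) graded \<Rightarrow> ('m \<Rightarrow> 'n) \<Rightarrow>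
    ('v, 'k) pt set \<Rightarrow> ('v, 'k, 'm) section_fun \<Rightarrow> ('v, 'k, 'n) section_fun" where
  "tilde_map L \<Delta> N f U s = (\<lambda>P\<in>U. \<Union>(x, g)\<in>s P. fraction L \<Delta> N P (f x) g)"

text \<open>Membership of a section over \<open>U\<close> in the image sheaf of a morphism, that is, locally.\<close>

definition locally_in_image :: "'v::real_vector set \<Rightarrow> 'v set set \<Rightarrow>
    ('v, 'k::field, 'm) sheaf \<Rightarrow>
    (('v, 'k) pt set \<Rightarrow> ('v, 'k, 'm) section_fun \<Rightarrow> ('v, 'k, 'n) section_fun) \<Rightarrow>
    ('v, 'k) pt set \<Rightarrow> ('v, 'k, 'n) section_fun \<Rightarrow> bool" where
  "locally_in_image L \<Delta> A \<phi> U s \<longleftrightarrow>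
     (\<forall>P\<in>U. \<exists>V. openin (zariski L \<Delta>) V \<and> P \<in> V \<and> V \<subseteq> U \<and>
        (\<exists>t\<in>carrier (A V). \<phi> V t = restrict s V))"

definition sheaf_exact :: "'v::real_vector set \<Rightarrow> 'v set set \<Rightarrow>
    ('v, 'k::field, 'm) sheaf \<Rightarrow> ('v, 'k, 'n) sheaf \<Rightarrow> ('v, 'k, 'p) sheaf \<Rightarrow>
    (('v, 'k) pt set \<Rightarrow> ('v, 'k, 'm) section_fun \<Rightarrow> ('v, 'k, 'n) section_fun) \<Rightarrow>
    (('v, 'k) pt set \<Rightarrow> ('v, 'k, 'n) section_fun \<Rightarrow> ('v, 'k, 'p) section_fun) \<Rightarrow> bool" where
  "sheaf_exact L \<Delta> A B C \<phi> \<psi> \<longleftrightarrow>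
     (\<forall>U. openin (zariski L \<Delta>) U \<longrightarrow> (\<forall>s\<in>carrier (B U).
        \<psi> U s = \<zero>\<^bsub>C U\<^esub> \<longleftrightarrow> locally_in_image L \<Delta> A \<phi> U s))"

definition sheaf_surjective :: "'v::real_vector set \<Rightarrow> 'v set set \<Rightarrow>
    ('v, 'k::field, 'm) sheaf \<Rightarrow> ('v, 'k, 'n) sheaf \<Rightarrow>
    (('v, 'k) pt set \<Rightarrow> ('v, 'k, 'm) section_fun \<Rightarrow> ('v, 'k, 'n) section_fun) \<Rightarrow> bool" where
  "sheaf_surjective L \<Delta> A B \<phi> \<longleftrightarrow>
     (\<forall>U. openin (zariski L \<Delta>) U \<longrightarrow> (\<forall>s\<in>carrier (B U). locally_in_image L \<Delta> A \<phi> U s))"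

definition sheaf_zero ::
    "'v::real_vector set \<Rightarrow> 'v set set \<Rightarrow> ('v, 'k::field, 'm) sheaf \<Rightarrow> bool" where
  "sheaf_zero L \<Delta> A \<longleftrightarrow> (\<forall>U. openin (zariski L \<Delta>) U \<longrightarrow> carrier (A U) = {\<zero>\<^bsub>A U\<^esub>})"


section \<open>Virtual resolutions\<close>

text \<open>
  The augmentation is a morphism of sheaves and need not be induced by a homomorphism from
  \<open>F 0\<close> to \<open>M\<close>. The sheaves of the \<open>F i\<close> are vector bundles because the \<open>F i\<close> are free and the
  variety is smooth.
\<close>

definition virtual_resolution :: "'v::real_vector set \<Rightarrow> 'v set set \<Rightarrow>
    (('v, 'k::field) cox_poly, 'm, 'v pic) graded \<Rightarrow>
    (nat \<Rightarrow> (('v, 'k) cox_poly, 'f, 'v pic) graded) \<Rightarrow> (nat \<Rightarrow> 'f \<Rightarrow> 'f) \<Rightarrow> bool" where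
  "virtual_resolution L \<Delta> M F d \<longleftrightarrow>
     fg_graded_free_complex (Pic L \<Delta>) (cox_ring L \<Delta>) F d \<and>
     (\<exists>\<epsilon>. sheaf_hom L \<Delta> (tilde L \<Delta> (F 0)) (tilde L \<Delta> M) \<epsilon> \<and>
          sheaf_surjective L \<Delta> (tilde L \<Delta> (F 0)) (tilde L \<Delta> M) \<epsilon> \<and>
          sheaf_exact L \<Delta> (tilde L \<Delta> (F 1)) (tilde L \<Delta> (F 0)) (tilde L \<Delta> M)
            (tilde_map L \<Delta> (F 0) (d 0)) \<epsilon>) \<and>
     (\<forall>i. sheaf_exact L \<Delta>
            (tilde L \<Delta> (F (Suc (Suc i)))) (tilde L \<Delta> (F (Suc i))) (tilde L \<Delta> (F i))
            (tilde_map L \<Delta> (F (Suc i)) (d (Suc i))) (tilde_map L \<Delta> (F i) (d i)))"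

definition complex_length_le :: "(nat \<Rightarrow> ('a, 'f, 'g) graded) \<Rightarrow> nat \<Rightarrow> bool" where
  "complex_length_le F l \<longleftrightarrow> (\<forall>i>l. carrier (F i) = {\<zero>\<^bsub>F i\<^esub>})"

end

theory Submission
  imports Defs
begin

text \<open>
  The sheaf of a graded module vanishes as soon as, at every point of the variety, one homogeneous
  polynomial \<open>h\<close> that is nonzero at the point annihilates the module
  (\<open>sheaf_zero_if_annihilated\<close>). Such an \<open>h\<close> is found for \<open>Ext\<close> and \<open>Tor\<close> in degree \<open>i > l\<close> from
  a contraction: there are linear maps \<open>s'\<close> and \<open>s''\<close> with \<open>h x = s' (b x) + b (s'' x)\<close> for all
  \<open>x\<close> in \<open>P i\<close>, and \<open>Hom(-, N)\<close> and \<open>- \<otimes> N\<close> turn this identity into the statement that \<open>h\<close>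
  times a cycle is a boundary (\<open>Ext_annihilated\<close>, \<open>Tor_annihilated\<close>).

  The contraction is a comparison of resolutions. Fix a point and let \<open>W\<close> be the multiplicative set
  of homogeneous polynomials that are nonzero there. Up to multiplication by \<open>W\<close>, the complex \<open>F\<close> is
  a free resolution of \<open>M\<close>, and it has length \<open>l\<close>; the complex \<open>P\<close> is a free resolution. The usual
  construction gives maps \<open>\<alpha> : F \<rightarrow> P\<close> and \<open>\<beta> : P \<rightarrow> F\<close> such that \<open>\<alpha> \<beta>\<close> is homotopic to
  multiplication by an element of \<open>W\<close>; a denominator is picked up at each of finitely many steps.
  In degree \<open>i > l\<close> the composite \<open>\<alpha> \<beta>\<close> passes through \<open>F i = 0\<close>, and only the homotopy is left
  (\<open>comparison_step\<close>, \<open>homotopy_beyond_length\<close>).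

  Two obstacles separate sheaves from modules. Sheaves only see fractions of degree \<open>0\<close>. Here
  smoothness enters: if the point lies in the chart of a cone \<open>\<sigma>\<close>, then the classes of the divisors
  of the rays outside \<open>\<sigma>\<close> generate the Picard group, because the generators of the rays of \<open>\<sigma>\<close> are
  part of a lattice basis, and the variables of these rays are nonzero at the point. So every degree
  is a difference of degrees of elements of \<open>W\<close> (\<open>degree_ratio_of_units\<close>), and exactness of sheaves
  becomes exactness of modules up to \<open>W\<close> in all degrees (\<open>exact_at_point\<close>). Secondly, the
  augmentation is a morphism of sheaves which need not come from a homomorphism \<open>F 0 \<rightarrow> M\<close>. It is
  replaced by the relation saying that the augmentation maps \<open>x\<close> to \<open>m\<close> at the point. This relation
  is linear, and up to \<open>W\<close> it is total on both sides and single-valued; that is enough to begin the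
  comparison (\<open>comparison_base\<close>).
\<close>

section \<open>Homomorphisms out of free modules\<close>

lemma module_hom_closed: "module_hom R M N f \<Longrightarrow> x \<in> carrier M \<Longrightarrow> f x \<in> carrier N"
  by (auto simp: module_hom_def)

lemma module_hom_add:
  "module_hom R M N f \<Longrightarrow> x \<in> carrier M \<Longrightarrow> y \<in> carrier M \<Longrightarrow> f (x \<oplus>\<^bsub>M\<^esub> y) = f x \<oplus>\<^bsub>N\<^esub> f y"
  by (auto simp: module_hom_def)

lemma module_hom_smult:
  "module_hom R M N f \<Longrightarrow> r \<in> carrier R \<Longrightarrow> x \<in> carrier M \<Longrightarrow> f (r \<odot>\<^bsub>M\<^esub> x) = r \<odot>\<^bsub>N\<^esub> f x"
  by (auto simp: module_hom_def)

lemma module_hom_zero: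
  assumes "Module.module R M" "Module.module R N" "module_hom R M N f"
  shows "f \<zero>\<^bsub>M\<^esub> = \<zero>\<^bsub>N\<^esub>"
proof -
  interpret M: Module.module R M by fact
  interpret N: Module.module R N by fact
  have "f (\<zero>\<^bsub>R\<^esub> \<odot>\<^bsub>M\<^esub> \<zero>\<^bsub>M\<^esub>) = \<zero>\<^bsub>R\<^esub> \<odot>\<^bsub>N\<^esub> f \<zero>\<^bsub>M\<^esub>"
    by (rule module_hom_smult[OF assms(3)]) auto
  then show ?thesis
    using module_hom_closed[OF assms(3)] by simp
qed

lemma module_hom_minus:
  assumes "Module.module R M" "Module.module R N" "module_hom R M N f"
    and "x \<in> carrier M" "y \<in> carrier M"
  shows "f (x \<ominus>\<^bsub>M\<^esub> y) = f x \<ominus>\<^bsub>N\<^esub> f y"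
proof -
  interpret M: Module.module R M by fact
  interpret N: Module.module R N by fact
  note cl = module_hom_closed[OF assms(3)]
  have "f (x \<ominus>\<^bsub>M\<^esub> y) \<oplus>\<^bsub>N\<^esub> f y = f ((x \<ominus>\<^bsub>M\<^esub> y) \<oplus>\<^bsub>M\<^esub> y)"
    using assms(4,5) by (simp add: module_hom_add[OF assms(3)])
  also have "(x \<ominus>\<^bsub>M\<^esub> y) \<oplus>\<^bsub>M\<^esub> y = x"
    using assms(4,5) by (simp add: M.minus_eq M.add.m_assoc M.l_neg)
  finally show ?thesis
    using cl assms(4,5) by (metis M.minus_closed N.add.inv_solve_right a_minus_def)
qed

lemma module_hom_finsum:
  assumes "Module.module R M" "Module.module R N" "module_hom R M N f"
    and "finite A" "g \<in> A \<rightarrow> carrier M"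
  shows "f (finsum M g A) = finsum N (\<lambda>a. f (g a)) A"
proof -
  interpret M: Module.module R M by fact
  interpret N: Module.module R N by fact
  show ?thesis
    using assms(4,5)
  proof (induction A rule: finite_induct)
    case empty
    then show ?case by (simp add: module_hom_zero[OF assms(1-3)])
  next
    case (insert a A)
    then have "g \<in> A \<rightarrow> carrier M" "g a \<in> carrier M" by auto
    moreover have "(\<lambda>a. f (g a)) \<in> A \<rightarrow> carrier N" "f (g a) \<in> carrier N"
      using module_hom_closed[OF assms(3)] calculation by auto
    ultimately show ?case
      using insert by (simp add: module_hom_add[OF assms(3)])
  qed
qed

lemma module_hom_comp:
  assumes "module_hom R M N f" "module_hom R N P g"
  shows "module_hom R M P (\<lambda>x. g (f x))"
  using assms unfolding module_hom_def by (auto simp: Pi_iff)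

lemma module_hom_id: "module_hom R M M (\<lambda>x. x)"
  unfolding module_hom_def by auto

lemma module_hom_smult_fun:
  assumes "Module.module R N" "module_hom R M N f" "r \<in> carrier R"
  shows "module_hom R M N (\<lambda>x. r \<odot>\<^bsub>N\<^esub> f x)"
proof -
  interpret N: Module.module R N by fact
  have "r \<odot>\<^bsub>N\<^esub> (t \<odot>\<^bsub>N\<^esub> f x) = t \<odot>\<^bsub>N\<^esub> (r \<odot>\<^bsub>N\<^esub> f x)" if "t \<in> carrier R" "x \<in> carrier M" for t x
    using that assms(3) module_hom_closed[OF assms(2)]
    by (metis N.smult_assoc1 N.R.m_comm)
  then show ?thesis
    using assms unfolding module_hom_def by (auto simp: Pi_iff N.smult_r_distr)
qed

lemma module_hom_diff_fun:
  assumes "Module.module R N" "module_hom R M N f" "module_hom R M N g"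
  shows "module_hom R M N (\<lambda>x. f x \<ominus>\<^bsub>N\<^esub> g x)"
proof -
  interpret N: Module.module R N by fact
  have f: "f x \<in> carrier N" "g x \<in> carrier N" if "x \<in> carrier M" for x
    using that assms module_hom_closed by metis+
  show ?thesis
    using assms(2,3) f unfolding module_hom_def
    by (auto simp: Pi_iff N.minus_eq N.smult_r_distr N.smult_r_minus N.minus_add N.a_ac)
qed

definition free_basis :: "('a, 'r) ring_scheme \<Rightarrow> ('a, 'm, 'x) module_scheme \<Rightarrow> 'm set \<Rightarrow> bool" where
  "free_basis R F B \<longleftrightarrow> finite B \<and> B \<subseteq> carrier F \<and>
     (\<forall>x\<in>carrier F. \<exists>!c. c \<in> B \<rightarrow>\<^sub>E carrier R \<and> x = finsum F (\<lambda>b. c b \<odot>\<^bsub>F\<^esub> b) B)"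

lemma free_basis_subset: "free_basis R F B \<Longrightarrow> B \<subseteq> carrier F"
  by (simp add: free_basis_def)

text \<open>
  The map sends an element to the combination of the prescribed values with the coordinates of the
  element; it is linear because coordinates are unique.
\<close>

lemma free_basis_hom_exists:
  assumes F: "Module.module R F" and N: "Module.module R N" and B: "free_basis R F B"
    and t: "t \<in> B \<rightarrow> carrier N"
  obtains f where "module_hom R F N f" "\<And>b. b \<in> B \<Longrightarrow> f b = t b"
proof -
  interpret F: Module.module R F by fact
  interpret N: Module.module R N by fact
  have fin: "finite B" and BF: "B \<subseteq> carrier F"
    and ex: "\<And>x. x \<in> carrier F \<Longrightarrow> \<exists>!c. c \<in> B \<rightarrow>\<^sub>E carrier R \<and> x = finsum F (\<lambda>b. c b \<odot>\<^bsub>F\<^esub> b) B"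
    using B by (auto simp: free_basis_def)
  have "\<exists>co. \<forall>x\<in>carrier F. co x \<in> B \<rightarrow>\<^sub>E carrier R \<and> x = finsum F (\<lambda>b. co x b \<odot>\<^bsub>F\<^esub> b) B"
    by (rule bchoice) (use ex in blast)
  then obtain co where co: "\<And>x. x \<in> carrier F \<Longrightarrow> co x \<in> B \<rightarrow>\<^sub>E carrier R"
      "\<And>x. x \<in> carrier F \<Longrightarrow> x = finsum F (\<lambda>b. co x b \<odot>\<^bsub>F\<^esub> b) B"
    by blast
  have uniq: "co x = c" if "x \<in> carrier F" "c \<in> B \<rightarrow>\<^sub>E carrier R" "x = finsum F (\<lambda>b. c b \<odot>\<^bsub>F\<^esub> b) B" for x c
    using ex[OF that(1)] co[OF that(1)] that by blast
  have co': "co x b \<in> carrier R" if "x \<in> carrier F" "b \<in> B" for x b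
    using co(1)[OF that(1)] that(2) by (auto simp: PiE_iff)
  define f where "f x = finsum N (\<lambda>b. co x b \<odot>\<^bsub>N\<^esub> t b) B" for x
  have tN: "\<And>b. b \<in> B \<Longrightarrow> t b \<in> carrier N" using t by auto
  have fcl: "f x \<in> carrier N" if "x \<in> carrier F" for x
    unfolding f_def using that co' tN by (auto intro!: N.finsum_closed)
  have add: "f (x \<oplus>\<^bsub>F\<^esub> y) = f x \<oplus>\<^bsub>N\<^esub> f y" if x: "x \<in> carrier F" and y: "y \<in> carrier F" for x y
  proof -
    have "co (x \<oplus>\<^bsub>F\<^esub> y) = (\<lambda>b\<in>B. co x b \<oplus>\<^bsub>R\<^esub> co y b)"
    proof (rule uniq)
      have "x \<oplus>\<^bsub>F\<^esub> y = finsum F (\<lambda>b. co x b \<odot>\<^bsub>F\<^esub> b) B \<oplus>\<^bsub>F\<^esub> finsum F (\<lambda>b. co y b \<odot>\<^bsub>F\<^esub> b) B"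
        using co(2)[OF x] co(2)[OF y] by simp
      also have "\<dots> = finsum F (\<lambda>b. co x b \<odot>\<^bsub>F\<^esub> b \<oplus>\<^bsub>F\<^esub> co y b \<odot>\<^bsub>F\<^esub> b) B"
        using x y co' BF by (intro F.finsum_addf[symmetric]) auto
      also have "\<dots> = finsum F (\<lambda>b. (\<lambda>b\<in>B. co x b \<oplus>\<^bsub>R\<^esub> co y b) b \<odot>\<^bsub>F\<^esub> b) B"
        using x y co' BF by (intro F.M.finsum_cong') (auto simp: F.smult_l_distr subset_iff)
      finally show "x \<oplus>\<^bsub>F\<^esub> y = finsum F (\<lambda>b. (\<lambda>b\<in>B. co x b \<oplus>\<^bsub>R\<^esub> co y b) b \<odot>\<^bsub>F\<^esub> b) B" .
    qed (use x y co' in auto)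
    then have "f (x \<oplus>\<^bsub>F\<^esub> y) = finsum N (\<lambda>b. co x b \<odot>\<^bsub>N\<^esub> t b \<oplus>\<^bsub>N\<^esub> co y b \<odot>\<^bsub>N\<^esub> t b) B"
      unfolding f_def using x y co' tN by (intro N.M.finsum_cong') (auto simp: N.smult_l_distr)
    also have "\<dots> = f x \<oplus>\<^bsub>N\<^esub> f y"
      unfolding f_def using x y co' tN by (intro N.finsum_addf) auto
    finally show ?thesis .
  qed
  have sm: "f (r \<odot>\<^bsub>F\<^esub> x) = r \<odot>\<^bsub>N\<^esub> f x" if r: "r \<in> carrier R" and x: "x \<in> carrier F" for r x
  proof -
    have "co (r \<odot>\<^bsub>F\<^esub> x) = (\<lambda>b\<in>B. r \<otimes>\<^bsub>R\<^esub> co x b)"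
    proof (rule uniq)
      have "r \<odot>\<^bsub>F\<^esub> x = r \<odot>\<^bsub>F\<^esub> finsum F (\<lambda>b. co x b \<odot>\<^bsub>F\<^esub> b) B"
        using co(2)[OF x] by simp
      also have "\<dots> = finsum F (\<lambda>b. r \<odot>\<^bsub>F\<^esub> (co x b \<odot>\<^bsub>F\<^esub> b)) B"
        using r x co' BF fin by (intro F.finsum_smult_ldistr) auto
      also have "\<dots> = finsum F (\<lambda>b. (\<lambda>b\<in>B. r \<otimes>\<^bsub>R\<^esub> co x b) b \<odot>\<^bsub>F\<^esub> b) B"
        using x r co' BF by (intro F.M.finsum_cong') (auto simp: F.smult_assoc1 subset_iff)
      finally show "r \<odot>\<^bsub>F\<^esub> x = finsum F (\<lambda>b. (\<lambda>b\<in>B. r \<otimes>\<^bsub>R\<^esub> co x b) b \<odot>\<^bsub>F\<^esub> b) B" .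
    qed (use x r co' in auto)
    then have "f (r \<odot>\<^bsub>F\<^esub> x) = finsum N (\<lambda>b. r \<odot>\<^bsub>N\<^esub> (co x b \<odot>\<^bsub>N\<^esub> t b)) B"
      unfolding f_def using x r co' tN by (intro N.M.finsum_cong') (auto simp: N.smult_assoc1)
    also have "\<dots> = r \<odot>\<^bsub>N\<^esub> f x"
      unfolding f_def using x r co' tN fin by (intro N.finsum_smult_ldistr[symmetric]) auto
    finally show ?thesis .
  qed
  have ft: "f b = t b" if b: "b \<in> B" for b
  proof -
    have bF: "b \<in> carrier F" using b BF by auto
    have "co b = (\<lambda>b'\<in>B. if b = b' then \<one>\<^bsub>R\<^esub> else \<zero>\<^bsub>R\<^esub>)"
    proof (rule uniq[OF bF])
      have "finsum F (\<lambda>b'. (\<lambda>b'\<in>B. if b = b' then \<one>\<^bsub>R\<^esub> else \<zero>\<^bsub>R\<^esub>) b' \<odot>\<^bsub>F\<^esub> b') B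
          = finsum F (\<lambda>b'. if b = b' then b' else \<zero>\<^bsub>F\<^esub>) B"
        using BF by (intro F.M.finsum_cong') (auto simp: subset_iff)
      also have "\<dots> = b"
        using F.M.finsum_singleton[OF b fin, of "\<lambda>x. x"] BF by auto
      finally show "b = finsum F (\<lambda>b'. (\<lambda>b'\<in>B. if b = b' then \<one>\<^bsub>R\<^esub> else \<zero>\<^bsub>R\<^esub>) b' \<odot>\<^bsub>F\<^esub> b') B"
        by simp
    qed auto
    then have "f b = finsum N (\<lambda>b'. if b = b' then t b' else \<zero>\<^bsub>N\<^esub>) B"
      unfolding f_def using tN by (intro N.M.finsum_cong') auto
    also have "\<dots> = t b"
      using N.M.finsum_singleton[OF b fin, of t] tN by auto
    finally show ?thesis .
  qed
  show ?thesis
    by (rule that[of f]) (use fcl add sm ft in \<open>auto simp: module_hom_def\<close>)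
qed

lemma free_basis_hom_eqI:
  assumes F: "Module.module R F" and N: "Module.module R N" and B: "free_basis R F B"
    and f: "module_hom R F N f" and g: "module_hom R F N g"
    and eq: "\<And>b. b \<in> B \<Longrightarrow> f b = g b" and x: "x \<in> carrier F"
  shows "f x = g x"
proof -
  interpret F: Module.module R F by fact
  interpret N: Module.module R N by fact
  have fin: "finite B" and BF: "B \<subseteq> carrier F"
    using B by (auto simp: free_basis_def)
  obtain c where c: "c \<in> B \<rightarrow>\<^sub>E carrier R" "x = finsum F (\<lambda>b. c b \<odot>\<^bsub>F\<^esub> b) B"
    using B x unfolding free_basis_def by blast
  have cR: "c b \<in> carrier R" if "b \<in> B" for b using c that by (auto simp: PiE_iff)
  have "k x = finsum N (\<lambda>b. c b \<odot>\<^bsub>N\<^esub> k b) B" if k: "module_hom R F N k" for k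
  proof -
    have "k x = finsum N (\<lambda>b. k (c b \<odot>\<^bsub>F\<^esub> b)) B"
      unfolding c(2) by (rule module_hom_finsum[OF F N k fin]) (use cR BF in auto)
    also have "\<dots> = finsum N (\<lambda>b. c b \<odot>\<^bsub>N\<^esub> k b) B"
      using cR BF module_hom_closed[OF k]
      by (intro N.M.finsum_cong') (auto simp: module_hom_smult[OF k] subset_iff)
    finally show ?thesis .
  qed
  from this[OF f] this[OF g] show ?thesis
    using eq cR BF module_hom_closed[OF g] by (auto intro!: N.M.finsum_cong')
qed

lemma (in abelian_group) add_minus_minus:
  assumes "x \<in> carrier G" "y \<in> carrier G" "z \<in> carrier G"
  shows "(y \<oplus> z) \<oplus> (x \<ominus> y \<ominus> z) = x"
proof -
  have "(y \<oplus> z) \<oplus> (x \<ominus> y \<ominus> z) = y \<oplus> (\<ominus> y \<oplus> (z \<oplus> (\<ominus> z \<oplus> x)))"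
    using assms by (simp add: minus_eq a_ac)
  then show ?thesis using assms by (simp add: r_neg2)
qed

lemma (in abelian_group) minus_minus_cancel:
  assumes "y \<in> carrier G" "z \<in> carrier G"
  shows "(y \<oplus> z) \<ominus> y \<ominus> z = \<zero>"
proof -
  have "(y \<oplus> z) \<ominus> y \<ominus> z = (y \<oplus> \<ominus> y) \<oplus> (z \<oplus> \<ominus> z)"
    using assms by (simp only: minus_eq a_ac a_closed a_inv_closed)
  then show ?thesis using assms by (simp add: r_neg)
qed

section \<open>Comparison of complexes up to a multiplicative set\<close>

locale mult_subset = R?: cring R for R (structure) +
  fixes W
  assumes W_carrier: "W \<subseteq> carrier R" and W_one: "\<one> \<in> W"
    and W_mult: "v \<in> W \<Longrightarrow> w \<in> W \<Longrightarrow> v \<otimes> w \<in> W"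
begin

lemma W_in [simp, intro]: "w \<in> W \<Longrightarrow> w \<in> carrier R"
  using W_carrier by auto

text \<open>
  Finitely many denominators have a common multiple; the last hypothesis says that the property
  survives the passage to a multiple.
\<close>

lemma common_multiplier:
  assumes "finite B" "\<And>b. b \<in> B \<Longrightarrow> \<exists>w\<in>W. Q w b"
    and "\<And>v w b. v \<in> W \<Longrightarrow> w \<in> W \<Longrightarrow> b \<in> B \<Longrightarrow> Q w b \<Longrightarrow> Q (v \<otimes> w) b"
  shows "\<exists>w\<in>W. \<forall>b\<in>B. Q w b"
  using assms
proof (induction B rule: finite_induct)
  case empty
  then show ?case using W_one by auto
next
  case (insert b B)
  then obtain w where w: "w \<in> W" "\<forall>b\<in>B. Q w b" by blast
  obtain v where v: "v \<in> W" "Q v b" using insert.prems(1)[of b] by auto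
  have "Q (v \<otimes> w) b'" if "b' \<in> insert b B" for b'
  proof (cases "b' = b")
    case True
    have "Q (w \<otimes> v) b" by (rule insert.prems(2)) (use v w in auto)
    then show ?thesis using True v w by (simp add: R.m_comm)
  next
    case False
    then show ?thesis using insert.prems(2)[of v w b'] v w that by auto
  qed
  then show ?case using W_mult v w by blast
qed

text \<open>
  A free module is projective also up to \<open>W\<close>: lift the finitely many basis elements and clear
  denominators. The case \<open>W = {1}\<close> is the usual lifting property.
\<close>

lemma lift_up_to_W:
  assumes P: "Module.module R P" and E: "Module.module R E" and N: "Module.module R N"
    and B: "free_basis R P B" and u: "module_hom R P N u" and d: "module_hom R E N d"
    and ex: "\<And>x. x \<in> B \<Longrightarrow> \<exists>w\<in>W. w \<odot>\<^bsub>N\<^esub> u x \<in> d ` carrier E"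
  obtains w f where "w \<in> W" "module_hom R P E f" "\<And>x. x \<in> carrier P \<Longrightarrow> d (f x) = w \<odot>\<^bsub>N\<^esub> u x"
proof -
  interpret P: Module.module R P by fact
  interpret E: Module.module R E by fact
  interpret N: Module.module R N by fact
  have fin: "finite B" and BP: "B \<subseteq> carrier P" using B by (auto simp: free_basis_def)
  have "\<exists>w\<in>W. \<forall>b\<in>B. w \<odot>\<^bsub>N\<^esub> u b \<in> d ` carrier E"
  proof (rule common_multiplier[OF fin])
    fix v w b assume *: "v \<in> W" "w \<in> W" "b \<in> B" "w \<odot>\<^bsub>N\<^esub> u b \<in> d ` carrier E"
    then obtain e where e: "e \<in> carrier E" "w \<odot>\<^bsub>N\<^esub> u b = d e" by auto
    have "(v \<otimes> w) \<odot>\<^bsub>N\<^esub> u b = d (v \<odot>\<^bsub>E\<^esub> e)"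
      using * e BP module_hom_closed[OF u, of b]
      by (auto simp: N.smult_assoc1 module_hom_smult[OF d])
    then show "(v \<otimes> w) \<odot>\<^bsub>N\<^esub> u b \<in> d ` carrier E"
      using e * by auto
  qed (use ex BP in auto)
  then obtain w where w: "w \<in> W" "\<forall>b\<in>B. w \<odot>\<^bsub>N\<^esub> u b \<in> d ` carrier E" by blast
  then have "\<forall>b\<in>B. \<exists>e. e \<in> carrier E \<and> d e = w \<odot>\<^bsub>N\<^esub> u b" by (metis imageE)
  then obtain t where t: "\<And>b. b \<in> B \<Longrightarrow> t b \<in> carrier E" "\<And>b. b \<in> B \<Longrightarrow> d (t b) = w \<odot>\<^bsub>N\<^esub> u b"
    using bchoice[of B "\<lambda>b e. e \<in> carrier E \<and> d e = w \<odot>\<^bsub>N\<^esub> u b"] by blast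
  obtain f where f: "module_hom R P E f" "\<And>b. b \<in> B \<Longrightarrow> f b = t b"
    using free_basis_hom_exists[OF P E B, of t] t by auto
  have "d (f x) = w \<odot>\<^bsub>N\<^esub> u x" if "x \<in> carrier P" for x
    by (rule free_basis_hom_eqI[OF P N B module_hom_comp[OF f(1) d] module_hom_smult_fun[OF N u]])
      (use w t f that in auto)
  then show ?thesis using that w f by blast
qed

lemma lift_through_image:
  assumes P: "Module.module R P" and E: "Module.module R E" and N: "Module.module R N"
    and B: "free_basis R P B" and u: "module_hom R P N u" and d: "module_hom R E N d"
    and ex: "\<And>x. x \<in> carrier P \<Longrightarrow> u x \<in> d ` carrier E"
  obtains f where "module_hom R P E f" "\<And>x. x \<in> carrier P \<Longrightarrow> d (f x) = u x"
proof -
  interpret N: Module.module R N by fact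
  interpret one: mult_subset R "{\<one>}" by unfold_locales auto
  show ?thesis
  proof (rule one.lift_up_to_W[OF P E N B u d])
    fix x assume "x \<in> B"
    then have "x \<in> carrier P" using B by (auto simp: free_basis_def)
    then show "\<exists>w\<in>{\<one>}. w \<odot>\<^bsub>N\<^esub> u x \<in> d ` carrier E" using ex module_hom_closed[OF u] by auto
  qed (use that module_hom_closed[OF u] in auto)
qed

text \<open>
  The state of the comparison of complexes \<open>P\<close> and \<open>F\<close> in one degree, with \<open>P'\<close> and \<open>F'\<close> the
  modules in the next degree: \<open>\<alpha>\<close> and \<open>\<beta>\<close> can be continued to the next degree, and \<open>\<alpha> \<beta>\<close>
  agrees with multiplication by \<open>h\<close> up to the homotopy \<open>s\<close>. The homotopy identity is demanded only
  on boundaries, where its other term \<open>s' b\<close> vanishes, so that the state does not mention the previous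
  degree; this lets the same induction start at the augmentation.
\<close>

definition comparison :: "('a,'p,'x) module_scheme \<Rightarrow> ('a,'p,'x) module_scheme \<Rightarrow>
    ('a,'f,'y) module_scheme \<Rightarrow> ('a,'f,'y) module_scheme \<Rightarrow> ('p \<Rightarrow> 'p) \<Rightarrow> ('f \<Rightarrow> 'f) \<Rightarrow>
    'a \<Rightarrow> ('f \<Rightarrow> 'p) \<Rightarrow> ('p \<Rightarrow> 'f) \<Rightarrow> ('p \<Rightarrow> 'p) \<Rightarrow> bool" where
  "comparison P P' F F' b d h \<alpha> \<beta> s \<longleftrightarrow> h \<in> W \<and> module_hom R F P \<alpha> \<and> module_hom R P F \<beta> \<and>
     module_hom R P P' s \<and>
     (\<forall>x\<in>carrier F'. \<alpha> (d x) \<in> b ` carrier P') \<and>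
     (\<forall>x\<in>carrier P'. \<exists>w\<in>W. w \<odot>\<^bsub>F\<^esub> \<beta> (b x) \<in> d ` carrier F') \<and>
     (\<forall>x\<in>carrier P'. h \<odot>\<^bsub>P\<^esub> b x = \<alpha> (\<beta> (b x)) \<oplus>\<^bsub>P\<^esub> b (s (b x)))"

text \<open>
  \<open>P\<close> is exact, so \<open>\<alpha>\<close> lifts as it stands; \<open>F\<close> is exact up to \<open>W\<close>, so \<open>\<beta>\<close> lifts after
  multiplication by some \<open>g\<close>, and the whole homotopy identity has to be multiplied by \<open>g\<close>. The
  defect of the new identity is a cycle of \<open>P\<close>, hence lifts to a new homotopy.
\<close>

lemma comparison_step:
  assumes mods: "Module.module R P0" "Module.module R P1" "Module.module R P2"
      "Module.module R F0" "Module.module R F1" "Module.module R F2"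
    and bas: "free_basis R P1 BP" "free_basis R F1 BF"
    and homs: "module_hom R P1 P0 b0" "module_hom R P2 P1 b1" "module_hom R F1 F0 d0" "module_hom R F2 F1 d1"
    and exP: "b1 ` carrier P2 = {x \<in> carrier P1. b0 x = \<zero>\<^bsub>P0\<^esub>}"
    and dd: "\<And>x. x \<in> carrier F2 \<Longrightarrow> d0 (d1 x) = \<zero>\<^bsub>F0\<^esub>"
    and exF: "\<And>x. x \<in> carrier F1 \<Longrightarrow> d0 x = \<zero>\<^bsub>F0\<^esub> \<Longrightarrow> \<exists>w\<in>W. w \<odot>\<^bsub>F1\<^esub> x \<in> d1 ` carrier F2"
    and cmp: "comparison P0 P1 F0 F1 b0 d0 h \<alpha> \<beta> s"
  obtains h' \<alpha>' \<beta>' s' s'' where "comparison P1 P2 F1 F2 b1 d1 h' \<alpha>' \<beta>' s'" "module_hom R P0 P1 s''"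
    "\<And>x. x \<in> carrier P1 \<Longrightarrow> h' \<odot>\<^bsub>P1\<^esub> x = (\<alpha>' (\<beta>' x) \<oplus>\<^bsub>P1\<^esub> s'' (b0 x)) \<oplus>\<^bsub>P1\<^esub> b1 (s' x)"
proof -
  interpret P0: Module.module R P0 by fact
  interpret P1: Module.module R P1 by fact
  interpret P2: Module.module R P2 by fact
  interpret F0: Module.module R F0 by fact
  interpret F1: Module.module R F1 by fact
  interpret F2: Module.module R F2 by fact
  have h: "h \<in> W" and \<alpha>: "module_hom R F0 P0 \<alpha>" and \<beta>: "module_hom R P0 F0 \<beta>"
    and s: "module_hom R P0 P1 s"
    and c1: "\<And>x. x \<in> carrier F1 \<Longrightarrow> \<alpha> (d0 x) \<in> b0 ` carrier P1"
    and c2: "\<And>x. x \<in> carrier P1 \<Longrightarrow> \<exists>w\<in>W. w \<odot>\<^bsub>F0\<^esub> \<beta> (b0 x) \<in> d0 ` carrier F1"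
    and c3: "\<And>x. x \<in> carrier P1 \<Longrightarrow> h \<odot>\<^bsub>P0\<^esub> b0 x = \<alpha> (\<beta> (b0 x)) \<oplus>\<^bsub>P0\<^esub> b0 (s (b0 x))"
    using cmp unfolding comparison_def by blast+
  have bb: "b0 (b1 x) = \<zero>\<^bsub>P0\<^esub>" if "x \<in> carrier P2" for x using exP that by blast
  obtain \<alpha>' where \<alpha>': "module_hom R F1 P1 \<alpha>'" and \<alpha>'b: "\<And>x. x \<in> carrier F1 \<Longrightarrow> b0 (\<alpha>' x) = \<alpha> (d0 x)"
    using lift_through_image[OF mods(5,2,1) bas(2) module_hom_comp[OF homs(3) \<alpha>] homs(1)] c1 by blast
  obtain g \<beta>' where g: "g \<in> W" and \<beta>': "module_hom R P1 F1 \<beta>'"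
    and \<beta>'d: "\<And>x. x \<in> carrier P1 \<Longrightarrow> d0 (\<beta>' x) = g \<odot>\<^bsub>F0\<^esub> \<beta> (b0 x)"
    using lift_up_to_W[OF mods(2,5,4) bas(1) module_hom_comp[OF homs(1) \<beta>] homs(3)]
      c2 free_basis_subset[OF bas(1)] by blast
  have gc: "g \<in> carrier R" and hc: "h \<in> carrier R" using g h by auto
  \<comment> \<open>\<open>k\<close> is the defect: what the next homotopy has to produce\<close>
  define s'' where "s'' = (\<lambda>x. g \<odot>\<^bsub>P1\<^esub> s x)"
  have s'': "module_hom R P0 P1 s''"
    unfolding s''_def by (rule module_hom_smult_fun[OF mods(2) s gc])
  define k where "k x = (g \<otimes> h) \<odot>\<^bsub>P1\<^esub> x \<ominus>\<^bsub>P1\<^esub> \<alpha>' (\<beta>' x) \<ominus>\<^bsub>P1\<^esub> s'' (b0 x)" for x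
  have k: "module_hom R P1 P1 k"
    unfolding k_def
    by (intro module_hom_diff_fun[OF mods(2)] module_hom_smult_fun[OF mods(2) module_hom_id]
      module_hom_comp[OF \<beta>' \<alpha>'] module_hom_comp[OF homs(1) s'']) (use gc hc in auto)
  note cl = module_hom_closed[OF homs(1)] module_hom_closed[OF \<beta>'] module_hom_closed[OF \<alpha>']
    module_hom_closed[OF s''] module_hom_closed[OF \<alpha>] module_hom_closed[OF \<beta>] module_hom_closed[OF s]
    module_hom_closed[OF homs(2)] module_hom_closed[OF homs(3)] module_hom_closed[OF homs(4)]
  have kim: "k x \<in> b1 ` carrier P2" if x: "x \<in> carrier P1" for x
  proof -
    have "b0 (k x) = b0 ((g \<otimes> h) \<odot>\<^bsub>P1\<^esub> x) \<ominus>\<^bsub>P0\<^esub> b0 (\<alpha>' (\<beta>' x)) \<ominus>\<^bsub>P0\<^esub> b0 (s'' (b0 x))"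
      unfolding k_def using x gc hc cl by (simp add: module_hom_minus[OF mods(2,1) homs(1)])
    also have "b0 (\<alpha>' (\<beta>' x)) = \<alpha> (g \<odot>\<^bsub>F0\<^esub> \<beta> (b0 x))"
      using x cl by (simp add: \<alpha>'b \<beta>'d)
    also have "\<dots> = g \<odot>\<^bsub>P0\<^esub> \<alpha> (\<beta> (b0 x))"
      using x gc cl by (simp add: module_hom_smult[OF \<alpha>])
    also have "b0 (s'' (b0 x)) = g \<odot>\<^bsub>P0\<^esub> b0 (s (b0 x))"
      unfolding s''_def using x gc cl by (simp add: module_hom_smult[OF homs(1)])
    also have "b0 ((g \<otimes> h) \<odot>\<^bsub>P1\<^esub> x) = g \<odot>\<^bsub>P0\<^esub> (h \<odot>\<^bsub>P0\<^esub> b0 x)"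
      using x gc hc cl by (simp add: module_hom_smult[OF homs(1)] P0.smult_assoc1)
    also have "\<dots> = g \<odot>\<^bsub>P0\<^esub> \<alpha> (\<beta> (b0 x)) \<oplus>\<^bsub>P0\<^esub> g \<odot>\<^bsub>P0\<^esub> b0 (s (b0 x))"
      using x gc cl by (simp add: c3 P0.smult_r_distr)
    finally have "b0 (k x) = \<zero>\<^bsub>P0\<^esub>"
      using x gc cl by (simp add: P0.minus_minus_cancel)
    then show ?thesis using exP module_hom_closed[OF k x] by blast
  qed
  obtain s' where s': "module_hom R P1 P2 s'" and s'b: "\<And>x. x \<in> carrier P1 \<Longrightarrow> b1 (s' x) = k x"
    using lift_through_image[OF mods(2,3,2) bas(1) k homs(2)] kim by blast
  have main: "(g \<otimes> h) \<odot>\<^bsub>P1\<^esub> x = (\<alpha>' (\<beta>' x) \<oplus>\<^bsub>P1\<^esub> s'' (b0 x)) \<oplus>\<^bsub>P1\<^esub> b1 (s' x)"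
    if x: "x \<in> carrier P1" for x
    using x gc hc cl unfolding s'b[OF x] k_def
    by (simp add: P1.add_minus_minus)
  have "comparison P1 P2 F1 F2 b1 d1 (g \<otimes> h) \<alpha>' \<beta>' s'"
    unfolding comparison_def
  proof (intro conjI ballI)
    show "g \<otimes> h \<in> W" using g h W_mult by auto
    fix x assume x: "x \<in> carrier F2"
    have "b0 (\<alpha>' (d1 x)) = \<zero>\<^bsub>P0\<^esub>"
      using x cl by (simp add: \<alpha>'b dd module_hom_zero[OF mods(4,1) \<alpha>])
    then show "\<alpha>' (d1 x) \<in> b1 ` carrier P2" using exP x cl by auto
  next
    fix x assume x: "x \<in> carrier P2"
    have "d0 (\<beta>' (b1 x)) = \<zero>\<^bsub>F0\<^esub>"
      using x cl gc by (simp add: \<beta>'d bb module_hom_zero[OF mods(1,4) \<beta>])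
    then show "\<exists>w\<in>W. w \<odot>\<^bsub>F1\<^esub> \<beta>' (b1 x) \<in> d1 ` carrier F2" using exF x cl by auto
  next
    fix x assume x: "x \<in> carrier P2"
    have "(g \<otimes> h) \<odot>\<^bsub>P1\<^esub> b1 x = (\<alpha>' (\<beta>' (b1 x)) \<oplus>\<^bsub>P1\<^esub> s'' (b0 (b1 x))) \<oplus>\<^bsub>P1\<^esub> b1 (s' (b1 x))"
      using x cl by (intro main) auto
    then show "(g \<otimes> h) \<odot>\<^bsub>P1\<^esub> b1 x = \<alpha>' (\<beta>' (b1 x)) \<oplus>\<^bsub>P1\<^esub> b1 (s' (b1 x))"
      using x cl by (simp add: bb module_hom_zero[OF mods(1,2) s''])
  qed (use \<alpha>' \<beta>' s' in auto)
  then show ?thesis using that s'' main by blast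
qed

text \<open>
  Where \<open>F\<close> vanishes, \<open>\<beta>\<close> is zero and the homotopy identity becomes a contraction of multiplication
  by an element of \<open>W\<close>.
\<close>

lemma homotopy_beyond_length:
  assumes mods: "\<And>j. Module.module R (P j)" "\<And>j. Module.module R (F j)"
    and bas: "\<And>j. \<exists>B. free_basis R (P j) B" "\<And>j. \<exists>B. free_basis R (F j) B"
    and homs: "\<And>j. module_hom R (P (Suc j)) (P j) (b j)" "\<And>j. module_hom R (F (Suc j)) (F j) (d j)"
    and exP: "\<And>j. b (Suc j) ` carrier (P (Suc (Suc j))) = {x \<in> carrier (P (Suc j)). b j x = \<zero>\<^bsub>P j\<^esub>}"
    and dd: "\<And>j x. x \<in> carrier (F (Suc (Suc j))) \<Longrightarrow> d j (d (Suc j) x) = \<zero>\<^bsub>F j\<^esub>"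
    and exF: "\<And>j x. x \<in> carrier (F (Suc j)) \<Longrightarrow> d j x = \<zero>\<^bsub>F j\<^esub> \<Longrightarrow>
        \<exists>w\<in>W. w \<odot>\<^bsub>F (Suc j)\<^esub> x \<in> d (Suc j) ` carrier (F (Suc (Suc j)))"
    and cmp: "comparison (P 0) (P 1) (F 0) (F 1) (b 0) (d 0) h \<alpha> \<beta> s"
    and triv: "carrier (F (Suc i)) = {\<zero>\<^bsub>F (Suc i)\<^esub>}"
  obtains h' s' s'' where "h' \<in> W" "module_hom R (P i) (P (Suc i)) s'"
    "module_hom R (P (Suc i)) (P (Suc (Suc i))) s''"
    "\<And>x. x \<in> carrier (P (Suc i)) \<Longrightarrow>
       h' \<odot>\<^bsub>P (Suc i)\<^esub> x = s' (b i x) \<oplus>\<^bsub>P (Suc i)\<^esub> b (Suc i) (s'' x)"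
proof -
  have step: thesis' if c: "comparison (P j) (P (Suc j)) (F j) (F (Suc j)) (b j) (d j) h \<alpha> \<beta> s"
    and th: "\<And>h' \<alpha>' \<beta>' s' s''. comparison (P (Suc j)) (P (Suc (Suc j))) (F (Suc j)) (F (Suc (Suc j)))
       (b (Suc j)) (d (Suc j)) h' \<alpha>' \<beta>' s' \<Longrightarrow> module_hom R (P j) (P (Suc j)) s'' \<Longrightarrow>
       (\<And>x. x \<in> carrier (P (Suc j)) \<Longrightarrow> h' \<odot>\<^bsub>P (Suc j)\<^esub> x =
         (\<alpha>' (\<beta>' x) \<oplus>\<^bsub>P (Suc j)\<^esub> s'' (b j x)) \<oplus>\<^bsub>P (Suc j)\<^esub> b (Suc j) (s' x)) \<Longrightarrow> thesis'"
    for j h \<alpha> \<beta> s thesis'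
  proof -
    obtain BP where BP: "free_basis R (P (Suc j)) BP" using bas(1) by blast
    obtain BF where BF: "free_basis R (F (Suc j)) BF" using bas(2) by blast
    show ?thesis
      by (rule comparison_step[OF mods(1) mods(1) mods(1) mods(2) mods(2) mods(2) BP BF
        homs(1) homs(1) homs(2) homs(2) exP dd exF c])
        (auto intro: th)
  qed
  have "\<exists>h \<alpha> \<beta> s. comparison (P j) (P (Suc j)) (F j) (F (Suc j)) (b j) (d j) h \<alpha> \<beta> s" for j
  proof (induction j)
    case 0
    then show ?case using cmp by auto
  next
    case (Suc j)
    then obtain h \<alpha> \<beta> s where c: "comparison (P j) (P (Suc j)) (F j) (F (Suc j)) (b j) (d j) h \<alpha> \<beta> s"
      by blast
    show ?case by (rule step[OF c]) blast
  qed
  then obtain h \<alpha> \<beta> s where c: "comparison (P i) (P (Suc i)) (F i) (F (Suc i)) (b i) (d i) h \<alpha> \<beta> s"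
    by blast
  show ?thesis
  proof (rule step[OF c])
    fix h' \<alpha>' \<beta>' s' s''
    assume c': "comparison (P (Suc i)) (P (Suc (Suc i))) (F (Suc i)) (F (Suc (Suc i)))
         (b (Suc i)) (d (Suc i)) h' \<alpha>' \<beta>' s'" and s'': "module_hom R (P i) (P (Suc i)) s''"
      and eq: "\<And>x. x \<in> carrier (P (Suc i)) \<Longrightarrow> h' \<odot>\<^bsub>P (Suc i)\<^esub> x =
         (\<alpha>' (\<beta>' x) \<oplus>\<^bsub>P (Suc i)\<^esub> s'' (b i x)) \<oplus>\<^bsub>P (Suc i)\<^esub> b (Suc i) (s' x)"
    from c' have W: "h' \<in> W" and s': "module_hom R (P (Suc i)) (P (Suc (Suc i))) s'"
      and \<alpha>': "module_hom R (F (Suc i)) (P (Suc i)) \<alpha>'"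
      and \<beta>': "module_hom R (P (Suc i)) (F (Suc i)) \<beta>'"
      unfolding comparison_def by auto
    interpret Pi: Module.module R "P (Suc i)" by (rule mods)
    show ?thesis
    proof (rule that[OF W s'' s'])
      fix x assume x: "x \<in> carrier (P (Suc i))"
      have "\<beta>' x = \<zero>\<^bsub>F (Suc i)\<^esub>" using module_hom_closed[OF \<beta>' x] triv by auto
      then have "\<alpha>' (\<beta>' x) = \<zero>\<^bsub>P (Suc i)\<^esub>"
        using module_hom_zero[OF mods(2) mods(1) \<alpha>'] by simp
      then show "h' \<odot>\<^bsub>P (Suc i)\<^esub> x = s'' (b i x) \<oplus>\<^bsub>P (Suc i)\<^esub> b (Suc i) (s' x)"
        using eq[OF x] x module_hom_closed[OF s''] module_hom_closed[OF homs(1)] by simp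
    qed
  qed
qed

end

lemma (in abelian_group) minus_zero_right: "x \<in> carrier G \<Longrightarrow> x \<ominus> \<zero> = x"
  using l_neg[of \<zero>] by (simp add: minus_eq)

context mult_subset begin

text \<open>
  The comparison in degree \<open>0\<close>, with a linear relation \<open>\<rho>\<close> between \<open>F0\<close> and \<open>M\<close> in the role of an
  augmentation of \<open>F\<close>. Being a submodule of the product, the relation is itself a module \<open>E\<close> with
  projections to \<open>F0\<close> and \<open>M\<close>, both surjective up to \<open>W\<close>. Lifting the identity of \<open>F0\<close> through the
  first projection, and then through \<open>\<eta>\<close>, gives \<open>\<alpha>\<close> up to a factor in \<open>W\<close>; lifting \<open>\<eta>\<close> through the second projection
  gives \<open>\<beta>\<close>.
\<close>

lemma comparison_base:
  fixes F0 :: "('a, 'f, 'x) module_scheme" and M :: "('a, 'm, 'y) module_scheme"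
  assumes mods: "Module.module R P0" "Module.module R P1" "Module.module R F0" "Module.module R F1"
      "Module.module R M"
    and bas: "free_basis R P0 BP" "free_basis R F0 BF" "free_basis R F1 BF1"
    and homs: "module_hom R P1 P0 b0" "module_hom R F1 F0 d0" "module_hom R P0 M \<eta>"
    and surj: "\<eta> ` carrier P0 = carrier M"
    and exP: "b0 ` carrier P1 = {x \<in> carrier P0. \<eta> x = \<zero>\<^bsub>M\<^esub>}"
    and \<rho>_carrier: "\<rho> \<subseteq> carrier F0 \<times> carrier M"
    and \<rho>_zero: "(\<zero>\<^bsub>F0\<^esub>, \<zero>\<^bsub>M\<^esub>) \<in> \<rho>"
    and \<rho>_add: "\<And>x m y n. (x, m) \<in> \<rho> \<Longrightarrow> (y, n) \<in> \<rho> \<Longrightarrow> (x \<oplus>\<^bsub>F0\<^esub> y, m \<oplus>\<^bsub>M\<^esub> n) \<in> \<rho>"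
    and \<rho>_smult: "\<And>r x m. r \<in> carrier R \<Longrightarrow> (x, m) \<in> \<rho> \<Longrightarrow> (r \<odot>\<^bsub>F0\<^esub> x, r \<odot>\<^bsub>M\<^esub> m) \<in> \<rho>"
    and tot_F: "\<And>e. e \<in> BF \<Longrightarrow> \<exists>w\<in>W. \<exists>m. (w \<odot>\<^bsub>F0\<^esub> e, m) \<in> \<rho>"
    and tot_M: "\<And>a. a \<in> BP \<Longrightarrow> \<exists>w\<in>W. \<exists>x. (x, w \<odot>\<^bsub>M\<^esub> \<eta> a) \<in> \<rho>"
    and ker_F: "\<And>x. (x, \<zero>\<^bsub>M\<^esub>) \<in> \<rho> \<Longrightarrow> \<exists>w\<in>W. w \<odot>\<^bsub>F0\<^esub> x \<in> d0 ` carrier F1"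
    and ker_M: "\<And>m. (\<zero>\<^bsub>F0\<^esub>, m) \<in> \<rho> \<Longrightarrow> \<exists>w\<in>W. w \<odot>\<^bsub>M\<^esub> m = \<zero>\<^bsub>M\<^esub>"
    and im_F: "\<And>y. y \<in> carrier F1 \<Longrightarrow> (d0 y, \<zero>\<^bsub>M\<^esub>) \<in> \<rho>"
  shows "\<exists>h \<alpha> \<beta> s. comparison P0 P1 F0 F1 b0 d0 h \<alpha> \<beta> s"
proof -
  interpret P0: Module.module R P0 by fact
  interpret P1: Module.module R P1 by fact
  interpret F0: Module.module R F0 by fact
  interpret F1: Module.module R F1 by fact
  interpret M: Module.module R M by fact
  define E :: "('a, 'f \<times> 'm) module" where "E = \<lparr>carrier = \<rho>, monoid.mult = (\<lambda>_. undefined), one = undefined,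
     ring.zero = (\<zero>\<^bsub>F0\<^esub>, \<zero>\<^bsub>M\<^esub>), ring.add = (\<lambda>p q. (fst p \<oplus>\<^bsub>F0\<^esub> fst q, snd p \<oplus>\<^bsub>M\<^esub> snd q)),
     smult = (\<lambda>r p. (r \<odot>\<^bsub>F0\<^esub> fst p, r \<odot>\<^bsub>M\<^esub> snd p))\<rparr>"
  have cl: "fst p \<in> carrier F0" "snd p \<in> carrier M" if "p \<in> \<rho>" for p
    using that \<rho>_carrier by auto
  have E: "Module.module R E"
  proof (rule moduleI)
    show "abelian_group E"
    proof (rule abelian_groupI)
      fix p assume p: "p \<in> carrier E"
      have m1: "\<ominus> \<one> \<in> carrier R" by simp
      have "(\<ominus> \<one>) \<odot>\<^bsub>F0\<^esub> fst p = \<ominus>\<^bsub>F0\<^esub> fst p" "(\<ominus> \<one>) \<odot>\<^bsub>M\<^esub> snd p = \<ominus>\<^bsub>M\<^esub> snd p"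
        using p cl[of p] F0.smult_l_minus[of \<one> "fst p"] M.smult_l_minus[of \<one> "snd p"]
        by (auto simp: E_def)
      then have "(\<ominus>\<^bsub>F0\<^esub> fst p, \<ominus>\<^bsub>M\<^esub> snd p) \<in> \<rho>"
        using \<rho>_smult[OF m1, of "fst p" "snd p"] p by (simp add: E_def)
      then show "\<exists>q\<in>carrier E. q \<oplus>\<^bsub>E\<^esub> p = \<zero>\<^bsub>E\<^esub>"
        using p cl[of p] by (auto simp: E_def F0.l_neg M.l_neg intro!: bexI)
    qed (use cl \<rho>_add \<rho>_zero in \<open>auto simp: E_def F0.a_ac M.a_ac\<close>)
  qed (use cl \<rho>_smult R.is_cring in \<open>auto simp: E_def F0.smult_l_distr M.smult_l_distr
        F0.smult_r_distr M.smult_r_distr F0.smult_assoc1 M.smult_assoc1\<close>)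
  have p1: "module_hom R E F0 fst" and p2: "module_hom R E M snd"
    unfolding module_hom_def E_def using cl by auto
  obtain w f where w: "w \<in> W" and f: "module_hom R F0 E f"
    and f1: "\<And>x. x \<in> carrier F0 \<Longrightarrow> fst (f x) = w \<odot>\<^bsub>F0\<^esub> x"
  proof (rule lift_up_to_W[OF mods(3) E mods(3) bas(2) module_hom_id p1])
    fix e assume "e \<in> BF"
    then show "\<exists>w\<in>W. w \<odot>\<^bsub>F0\<^esub> e \<in> fst ` carrier E"
      using tot_F[of e] by (force simp: E_def image_iff)
  qed blast
  obtain w' f' where w': "w' \<in> W" and f': "module_hom R P0 E f'"
    and f'2: "\<And>x. x \<in> carrier P0 \<Longrightarrow> snd (f' x) = w' \<odot>\<^bsub>M\<^esub> \<eta> x"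
  proof (rule lift_up_to_W[OF mods(1) E mods(5) bas(1) homs(3) p2])
    fix e assume "e \<in> BP"
    then show "\<exists>w\<in>W. w \<odot>\<^bsub>M\<^esub> \<eta> e \<in> snd ` carrier E"
      using tot_M[of e] by (force simp: E_def image_iff)
  qed blast
  define \<beta> where "\<beta> = (\<lambda>x. fst (f' x))"
  have \<beta>: "module_hom R P0 F0 \<beta>" unfolding \<beta>_def by (rule module_hom_comp[OF f' p1])
  have \<beta>\<rho>: "(\<beta> x, w' \<odot>\<^bsub>M\<^esub> \<eta> x) \<in> \<rho>" if "x \<in> carrier P0" for x
    using module_hom_closed[OF f' that] f'2[OF that, symmetric] by (simp add: \<beta>_def E_def)
  obtain \<alpha> where \<alpha>: "module_hom R F0 P0 \<alpha>" and \<alpha>\<eta>: "\<And>x. x \<in> carrier F0 \<Longrightarrow> \<eta> (\<alpha> x) = snd (f x)"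
    using lift_through_image[OF mods(3) mods(1) mods(5) bas(2) module_hom_comp[OF f p2] homs(3)]
      surj module_hom_closed[OF module_hom_comp[OF f p2]] by metis
  have \<alpha>\<rho>: "(w \<odot>\<^bsub>F0\<^esub> x, \<eta> (\<alpha> x)) \<in> \<rho>" if "x \<in> carrier F0" for x
    using module_hom_closed[OF f that] f1[OF that, symmetric] \<alpha>\<eta>[OF that] by (simp add: E_def)
  note hcl = module_hom_closed[OF \<alpha>] module_hom_closed[OF \<beta>] module_hom_closed[OF homs(1)]
    module_hom_closed[OF homs(2)] module_hom_closed[OF homs(3)]
  \<comment> \<open>linearity turns the kernel condition into single-valuedness up to \<open>W\<close>\<close>
  have sv: "\<exists>v\<in>W. v \<odot>\<^bsub>M\<^esub> (m \<ominus>\<^bsub>M\<^esub> n) = \<zero>\<^bsub>M\<^esub>" if "(x, m) \<in> \<rho>" "(x, n) \<in> \<rho>" for x m n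
  proof (rule ker_M)
    have c: "x \<in> carrier F0" "m \<in> carrier M" "n \<in> carrier M" using that \<rho>_carrier by auto
    have "(\<ominus> \<one> \<odot>\<^bsub>F0\<^esub> x, \<ominus> \<one> \<odot>\<^bsub>M\<^esub> n) \<in> \<rho>" by (rule \<rho>_smult) (use that in auto)
    then have "(\<ominus>\<^bsub>F0\<^esub> x, \<ominus>\<^bsub>M\<^esub> n) \<in> \<rho>"
      using F0.smult_l_minus[of \<one> x] M.smult_l_minus[of \<one> n] c by simp
    from \<rho>_add[OF that(1) this] show "(\<zero>\<^bsub>F0\<^esub>, m \<ominus>\<^bsub>M\<^esub> n) \<in> \<rho>"
      using c by (simp add: F0.r_neg M.minus_eq)
  qed
  obtain v k where v: "v \<in> W" and k: "module_hom R F1 P1 k"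
    and kb: "\<And>y. y \<in> carrier F1 \<Longrightarrow> b0 (k y) = v \<odot>\<^bsub>P0\<^esub> \<alpha> (d0 y)"
  proof (rule lift_up_to_W[OF mods(4) mods(2) mods(1) bas(3) module_hom_comp[OF homs(2) \<alpha>] homs(1)])
    fix y assume "y \<in> BF1"
    then have y: "y \<in> carrier F1" using bas(3) free_basis_subset by auto
    have "(w \<odot>\<^bsub>F0\<^esub> d0 y, w \<odot>\<^bsub>M\<^esub> \<zero>\<^bsub>M\<^esub>) \<in> \<rho>" using \<rho>_smult[OF _ im_F[OF y], of w] w by auto
    from sv[OF \<alpha>\<rho> this] obtain v where v: "v \<in> W" "v \<odot>\<^bsub>M\<^esub> \<eta> (\<alpha> (d0 y)) = \<zero>\<^bsub>M\<^esub>"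
      using y hcl w by (auto simp: M.minus_zero_right)
    then have "v \<odot>\<^bsub>P0\<^esub> \<alpha> (d0 y) \<in> b0 ` carrier P1"
      unfolding exP using y hcl by (auto simp: module_hom_smult[OF homs(3)])
    then show "\<exists>v\<in>W. v \<odot>\<^bsub>P0\<^esub> \<alpha> (d0 y) \<in> b0 ` carrier P1" using v by blast
  qed blast
  define u where "u x = (w \<otimes> w') \<odot>\<^bsub>P0\<^esub> x \<ominus>\<^bsub>P0\<^esub> \<alpha> (\<beta> x)" for x
  have u: "module_hom R P0 P0 u"
    unfolding u_def by (intro module_hom_diff_fun[OF mods(1)] module_hom_smult_fun[OF mods(1) module_hom_id]
      module_hom_comp[OF \<beta> \<alpha>]) (use w w' in auto)
  obtain v' s where v': "v' \<in> W" and s: "module_hom R P0 P1 s"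
    and sb: "\<And>x. x \<in> carrier P0 \<Longrightarrow> b0 (s x) = v' \<odot>\<^bsub>P0\<^esub> u x"
  proof (rule lift_up_to_W[OF mods(1) mods(2) mods(1) bas(1) u homs(1)])
    fix x assume "x \<in> BP"
    then have x: "x \<in> carrier P0" using bas(1) free_basis_subset by auto
    have "(w \<odot>\<^bsub>F0\<^esub> \<beta> x, w \<odot>\<^bsub>M\<^esub> (w' \<odot>\<^bsub>M\<^esub> \<eta> x)) \<in> \<rho>" using \<rho>_smult[OF _ \<beta>\<rho>[OF x], of w] w by auto
    from sv[OF this \<alpha>\<rho>] obtain v where v: "v \<in> W"
        "v \<odot>\<^bsub>M\<^esub> (w \<odot>\<^bsub>M\<^esub> (w' \<odot>\<^bsub>M\<^esub> \<eta> x) \<ominus>\<^bsub>M\<^esub> \<eta> (\<alpha> (\<beta> x))) = \<zero>\<^bsub>M\<^esub>"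
      using x hcl w by auto
    have "\<eta> (v \<odot>\<^bsub>P0\<^esub> u x) = \<zero>\<^bsub>M\<^esub>"
      unfolding u_def using v x hcl w w'
      by (simp add: module_hom_smult[OF homs(3)] module_hom_minus[OF mods(1,5) homs(3)] M.smult_assoc1)
    then have "v \<odot>\<^bsub>P0\<^esub> u x \<in> b0 ` carrier P1"
      unfolding exP using x v module_hom_closed[OF u] by auto
    then show "\<exists>v\<in>W. v \<odot>\<^bsub>P0\<^esub> u x \<in> b0 ` carrier P1" using v by blast
  qed blast
  note scl = module_hom_closed[OF s] module_hom_closed[OF k]
  have Wc: "v \<in> carrier R" "v' \<in> carrier R" "w \<in> carrier R" "w' \<in> carrier R" using v v' w w' by auto
  have "comparison P0 P1 F0 F1 b0 d0 (v \<otimes> v' \<otimes> (w \<otimes> w')) (\<lambda>x. (v \<otimes> v') \<odot>\<^bsub>P0\<^esub> \<alpha> x) \<beta> (\<lambda>x. v \<odot>\<^bsub>P1\<^esub> s x)"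
    unfolding comparison_def
  proof (intro conjI ballI)
    fix y assume y: "y \<in> carrier F1"
    have "(v \<otimes> v') \<odot>\<^bsub>P0\<^esub> \<alpha> (d0 y) = b0 (v' \<odot>\<^bsub>P1\<^esub> k y)"
      using y Wc hcl scl by (simp add: module_hom_smult[OF homs(1)] kb P0.smult_assoc1[symmetric] R.m_comm)
    then show "(v \<otimes> v') \<odot>\<^bsub>P0\<^esub> \<alpha> (d0 y) \<in> b0 ` carrier P1" using y Wc scl by auto
  next
    fix x assume x: "x \<in> carrier P1"
    have "\<eta> (b0 x) = \<zero>\<^bsub>M\<^esub>" using exP x by blast
    then have "(\<beta> (b0 x), \<zero>\<^bsub>M\<^esub>) \<in> \<rho>" using \<beta>\<rho>[of "b0 x"] x hcl Wc by simp
    then show "\<exists>w\<in>W. w \<odot>\<^bsub>F0\<^esub> \<beta> (b0 x) \<in> d0 ` carrier F1" by (rule ker_F)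
  next
    fix x assume "x \<in> carrier P1"
    then have x: "b0 x \<in> carrier P0" using hcl by auto
    let ?x = "b0 x"
    have "b0 (v \<odot>\<^bsub>P1\<^esub> s ?x) = (v \<otimes> v') \<odot>\<^bsub>P0\<^esub> ((w \<otimes> w') \<odot>\<^bsub>P0\<^esub> ?x \<ominus>\<^bsub>P0\<^esub> \<alpha> (\<beta> ?x))"
      using x Wc hcl scl by (simp add: module_hom_smult[OF homs(1)] sb u_def P0.smult_assoc1)
    also have "\<dots> = (v \<otimes> v') \<odot>\<^bsub>P0\<^esub> ((w \<otimes> w') \<odot>\<^bsub>P0\<^esub> ?x) \<ominus>\<^bsub>P0\<^esub> (v \<otimes> v') \<odot>\<^bsub>P0\<^esub> \<alpha> (\<beta> ?x)"
      using x Wc hcl by (simp add: P0.minus_eq P0.smult_r_distr P0.smult_r_minus)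
    finally show "(v \<otimes> v' \<otimes> (w \<otimes> w')) \<odot>\<^bsub>P0\<^esub> ?x =
        (v \<otimes> v') \<odot>\<^bsub>P0\<^esub> \<alpha> (\<beta> ?x) \<oplus>\<^bsub>P0\<^esub> b0 (v \<odot>\<^bsub>P1\<^esub> s ?x)"
      using x Wc hcl by (simp add: P0.smult_assoc1 P0.minus_eq P0.a_ac P0.r_neg2 P0.r_neg1 P0.r_neg)
  qed (use v v' w w' W_mult \<beta> module_hom_smult_fun[OF mods(1) \<alpha>] module_hom_smult_fun[OF mods(2) s] in auto)
  then show ?thesis by blast
qed

end

section \<open>Homogeneous components\<close>

lemma graded_module_module: "graded_module G R M \<Longrightarrow> Module.module R M"
  by (simp add: graded_module_def)

lemma grade_subset: "graded_module G R M \<Longrightarrow> d \<in> carrier G \<Longrightarrow> grade M d \<subseteq> carrier M"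
  using subgroup.subset by (fastforce simp: graded_module_def)

lemma grade_zero: "graded_module G R M \<Longrightarrow> d \<in> carrier G \<Longrightarrow> \<zero>\<^bsub>M\<^esub> \<in> grade M d"
  using subgroup.one_closed by (fastforce simp: graded_module_def)

lemma grade_add: "graded_module G R M \<Longrightarrow> d \<in> carrier G \<Longrightarrow> x \<in> grade M d \<Longrightarrow> y \<in> grade M d \<Longrightarrow>
    x \<oplus>\<^bsub>M\<^esub> y \<in> grade M d"
  using subgroup.m_closed by (fastforce simp: graded_module_def)

lemma grade_smult: "graded_module G R M \<Longrightarrow> d \<in> carrier G \<Longrightarrow> e \<in> carrier G \<Longrightarrow> r \<in> grade R d \<Longrightarrow>
    x \<in> grade M e \<Longrightarrow> r \<odot>\<^bsub>M\<^esub> x \<in> grade M (d \<otimes>\<^bsub>G\<^esub> e)"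
  by (simp add: graded_module_def)

lemma homogeneous_decomposition:
  assumes "graded_module G R M" "x \<in> carrier M"
  obtains D c where "finite D" "D \<subseteq> carrier G" "\<And>d. d \<in> D \<Longrightarrow> c d \<in> grade M d" "x = finsum M c D"
proof -
  obtain c where c: "c \<in> (\<Pi>\<^sub>E d\<in>carrier G. grade M d)" "finite {d\<in>carrier G. c d \<noteq> \<zero>\<^bsub>M\<^esub>}"
        "x = finsum M c {d\<in>carrier G. c d \<noteq> \<zero>\<^bsub>M\<^esub>}"
    using assms unfolding graded_module_def by blast
  show ?thesis by (rule that[of "{d\<in>carrier G. c d \<noteq> \<zero>\<^bsub>M\<^esub>}" c]) (use c in auto)
qed

text \<open>
  The decomposition of zero is unique, and the family of zeros is one such decomposition.
\<close>

lemma homogeneous_components_zero: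
  assumes M: "graded_module G R M" and fin: "finite D" and D: "D \<subseteq> carrier G"
    and c: "\<And>d. d \<in> D \<Longrightarrow> c d \<in> grade M d" and sum: "finsum M c D = \<zero>\<^bsub>M\<^esub>" and d: "d \<in> D"
  shows "c d = \<zero>\<^bsub>M\<^esub>"
proof -
  interpret M: Module.module R M using M by (rule graded_module_module)
  define Q where "Q k \<longleftrightarrow> k \<in> (\<Pi>\<^sub>E d\<in>carrier G. grade M d) \<and>
        finite {d\<in>carrier G. k d \<noteq> \<zero>\<^bsub>M\<^esub>} \<and>
        \<zero>\<^bsub>M\<^esub> = finsum M k {d\<in>carrier G. k d \<noteq> \<zero>\<^bsub>M\<^esub>}" for k
  have ex1: "\<exists>!k. Q k"
    using M unfolding graded_module_def Q_def by blast
  define c' where "c' = (\<lambda>d\<in>carrier G. if d \<in> D then c d else \<zero>\<^bsub>M\<^esub>)"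
  have sub: "{d\<in>carrier G. c' d \<noteq> \<zero>\<^bsub>M\<^esub>} \<subseteq> D" by (auto simp: c'_def split: if_splits)
  have cM: "c d \<in> carrier M" if "d \<in> D" for d
    using c[OF that] grade_subset[OF M, of d] D that by auto
  have "finsum M c' {d\<in>carrier G. c' d \<noteq> \<zero>\<^bsub>M\<^esub>} = finsum M c D"
    by (rule M.add.finprod_mono_neutral_cong_left)
      (use sub fin D cM in \<open>auto simp: c'_def split: if_splits\<close>)
  then have "Q c'" unfolding Q_def
    using sum sub fin c D grade_zero[OF M] by (auto simp: c'_def finite_subset)
  moreover have "{d \<in> carrier G. (\<lambda>d\<in>carrier G. \<zero>\<^bsub>M\<^esub>) d \<noteq> \<zero>\<^bsub>M\<^esub>} = {}" by auto
  then have "Q (\<lambda>d\<in>carrier G. \<zero>\<^bsub>M\<^esub>)" unfolding Q_def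
    using grade_zero[OF M] by (simp only:) auto
  ultimately have "c' = (\<lambda>d\<in>carrier G. \<zero>\<^bsub>M\<^esub>)" using ex1 by blast
  then have "c' d = \<zero>\<^bsub>M\<^esub>" using d D by auto
  then show ?thesis using d D by (auto simp: c'_def)
qed

context mult_subset begin

lemma multiplier_into_submodule_sum:
  assumes M: "Module.module R M" and I0: "\<zero>\<^bsub>M\<^esub> \<in> I"
    and Iadd: "\<And>x y. x \<in> I \<Longrightarrow> y \<in> I \<Longrightarrow> x \<oplus>\<^bsub>M\<^esub> y \<in> I"
    and Ismult: "\<And>r x. r \<in> carrier R \<Longrightarrow> x \<in> I \<Longrightarrow> r \<odot>\<^bsub>M\<^esub> x \<in> I"
    and fin: "finite D" and c: "\<And>d. d \<in> D \<Longrightarrow> c d \<in> carrier M"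
    and ex: "\<And>d. d \<in> D \<Longrightarrow> \<exists>w\<in>W. w \<odot>\<^bsub>M\<^esub> c d \<in> I"
  shows "\<exists>w\<in>W. w \<odot>\<^bsub>M\<^esub> finsum M c D \<in> I"
proof -
  interpret M: Module.module R M by fact
  obtain w where w: "w \<in> W" "\<And>d. d \<in> D \<Longrightarrow> w \<odot>\<^bsub>M\<^esub> c d \<in> I"
    using common_multiplier[OF fin, of "\<lambda>w d. w \<odot>\<^bsub>M\<^esub> c d \<in> I"] ex Ismult c
    by (auto simp: M.smult_assoc1)
  have "w \<odot>\<^bsub>M\<^esub> finsum M c D \<in> I"
    using fin c w(2)
  proof (induction D rule: finite_induct)
    case empty
    then show ?case using I0 w by simp
  next
    case (insert d D)
    then have "finsum M c (insert d D) = c d \<oplus>\<^bsub>M\<^esub> finsum M c D" by (intro M.finsum_insert) auto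
    then show ?case using insert w(1) by (auto simp: M.smult_r_distr Iadd)
  qed
  then show ?thesis using w by blast
qed

lemma hom_image_submodule:
  assumes "Module.module R N" "Module.module R M" "module_hom R N M f"
  shows "\<zero>\<^bsub>M\<^esub> \<in> f ` carrier N"
    and "\<And>x y. x \<in> f ` carrier N \<Longrightarrow> y \<in> f ` carrier N \<Longrightarrow> x \<oplus>\<^bsub>M\<^esub> y \<in> f ` carrier N"
    and "\<And>r x. r \<in> carrier R \<Longrightarrow> x \<in> f ` carrier N \<Longrightarrow> r \<odot>\<^bsub>M\<^esub> x \<in> f ` carrier N"
proof -
  interpret N: Module.module R N by fact
  show "\<zero>\<^bsub>M\<^esub> \<in> f ` carrier N" using module_hom_zero[OF assms] by (metis N.zero_closed image_eqI)
  show "x \<oplus>\<^bsub>M\<^esub> y \<in> f ` carrier N" if "x \<in> f ` carrier N" "y \<in> f ` carrier N" for x y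
    using that module_hom_add[OF assms(3)] by (metis (no_types, lifting) N.add.m_closed image_iff)
  show "r \<odot>\<^bsub>M\<^esub> x \<in> f ` carrier N" if "r \<in> carrier R" "x \<in> f ` carrier N" for r x
    using that module_hom_smult[OF assms(3)] by (metis (no_types, lifting) N.smult_closed image_iff)
qed

end

text \<open>
  A graded map kills an element only if it kills each homogeneous component; the denominators of the
  finitely many components have a common multiple.
\<close>

lemma exact_up_to_W_from_homogeneous:
  assumes W: "mult_subset R W"
    and gr: "graded_module G R A" "graded_module G R B" "graded_module G R C"
    and d': "module_hom R A B d'" and d: "graded_hom G R B C d"
    and ex: "\<And>e x. e \<in> carrier G \<Longrightarrow> x \<in> grade B e \<Longrightarrow> d x = \<zero>\<^bsub>C\<^esub> \<Longrightarrow> \<exists>w\<in>W. w \<odot>\<^bsub>B\<^esub> x \<in> d' ` carrier A"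
    and x: "x \<in> carrier B" "d x = \<zero>\<^bsub>C\<^esub>"
  shows "\<exists>w\<in>W. w \<odot>\<^bsub>B\<^esub> x \<in> d' ` carrier A"
proof -
  interpret mult_subset R W by fact
  note mods = gr[THEN graded_module_module]
  interpret B: Module.module R B by (rule mods)
  interpret C: Module.module R C by (rule mods)
  have dm: "module_hom R B C d" and dg: "\<And>e. e \<in> carrier G \<Longrightarrow> d ` grade B e \<subseteq> grade C e"
    using d by (auto simp: graded_hom_def)
  obtain D c where D: "finite D" "D \<subseteq> carrier G" "\<And>e. e \<in> D \<Longrightarrow> c e \<in> grade B e" "x = finsum B c D"
    using homogeneous_decomposition[OF gr(2) x(1)] by blast
  have cB: "c e \<in> carrier B" if "e \<in> D" for e using D that grade_subset[OF gr(2)] by blast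
  have "finsum C (\<lambda>e. d (c e)) D = \<zero>\<^bsub>C\<^esub>"
    using x(2) module_hom_finsum[OF mods(2,3) dm D(1), of c] cB D(4) by auto
  then have z: "d (c e) = \<zero>\<^bsub>C\<^esub>" if "e \<in> D" for e
    using homogeneous_components_zero[OF gr(3) D(1,2), of "\<lambda>e. d (c e)"] D dg that by blast
  show ?thesis
    unfolding D(4)
    by (rule multiplier_into_submodule_sum[OF mods(2) hom_image_submodule[OF mods(1,2) d'] D(1)])
      (use cB ex D z in auto)
qed

lemma (in abelian_monoid) finsum_add_at:
  assumes "finite D" "\<And>d. d \<in> D \<Longrightarrow> c d \<in> carrier G" "x \<in> carrier G"
  shows "finsum G (\<lambda>d. if d = e then (if e \<in> D then x \<oplus> c e else x) else c d) (insert e D) = x \<oplus> finsum G c D"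
proof -
  let ?c = "\<lambda>d. if d = e then (if e \<in> D then x \<oplus> c e else x) else c d"
  have "finsum G ?c (insert e (D - {e})) = ?c e \<oplus> finsum G ?c (D - {e})"
    by (rule finsum_insert) (use assms in auto)
  also have "finsum G ?c (D - {e}) = finsum G c (D - {e})"
    by (rule finsum_cong') (use assms in auto)
  also have "?c e \<oplus> finsum G c (D - {e}) = x \<oplus> finsum G c D"
  proof (cases "e \<in> D")
    case True
    have "finsum G c (insert e (D - {e})) = c e \<oplus> finsum G c (D - {e})"
      by (rule finsum_insert) (use assms True in auto)
    moreover have "finsum G c (D - {e}) \<in> carrier G" by (rule finsum_closed) (use assms in auto)
    ultimately show ?thesis using True assms by (simp add: insert_absorb a_assoc)
  qed simp
  finally show ?thesis by simp
qed

text \<open>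
  Additive closure suffices to obtain a submodule of the product, because every scalar is a sum of
  homogeneous ones.
\<close>

inductive_set homogeneous_span :: "('a,'f,'x) module_scheme \<Rightarrow> ('a,'m,'y) module_scheme \<Rightarrow> ('g \<Rightarrow> 'f \<Rightarrow> 'm \<Rightarrow> bool)
    \<Rightarrow> ('f \<times> 'm) set" for F M rel where
  zero: "(\<zero>\<^bsub>F\<^esub>, \<zero>\<^bsub>M\<^esub>) \<in> homogeneous_span F M rel"
| add: "rel e x m \<Longrightarrow> (y, n) \<in> homogeneous_span F M rel \<Longrightarrow> (x \<oplus>\<^bsub>F\<^esub> y, m \<oplus>\<^bsub>M\<^esub> n) \<in> homogeneous_span F M rel"

locale homogeneous_relation =
  fixes G :: "'g monoid" and R :: "('a,'a,'g) graded" and F :: "('a,'f,'g) graded"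
    and M :: "('a,'m,'g) graded" and rel :: "'g \<Rightarrow> 'f \<Rightarrow> 'm \<Rightarrow> bool"
  assumes gF: "graded_module G R F" and gM: "graded_module G R M"
    and rel_grade: "rel e x m \<Longrightarrow> e \<in> carrier G \<and> x \<in> grade F e \<and> m \<in> grade M e"
    and rel_add: "rel e x m \<Longrightarrow> rel e y n \<Longrightarrow> rel e (x \<oplus>\<^bsub>F\<^esub> y) (m \<oplus>\<^bsub>M\<^esub> n)"
    and rel_smult: "c \<in> carrier G \<Longrightarrow> r \<in> grade R c \<Longrightarrow> rel e x m \<Longrightarrow>
      rel (c \<otimes>\<^bsub>G\<^esub> e) (r \<odot>\<^bsub>F\<^esub> x) (r \<odot>\<^bsub>M\<^esub> m)"
    and grade_R: "c \<in> carrier G \<Longrightarrow> grade R c \<subseteq> carrier R"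
    and homogeneous_induct: "\<And>Q r. Q \<zero>\<^bsub>R\<^esub> \<Longrightarrow> (\<And>c s t. c \<in> carrier G \<Longrightarrow> s \<in> grade R c \<Longrightarrow> t \<in> carrier R \<Longrightarrow>
      Q t \<Longrightarrow> Q (s \<oplus>\<^bsub>R\<^esub> t)) \<Longrightarrow> r \<in> carrier R \<Longrightarrow> Q r"
begin

abbreviation "\<rho> \<equiv> homogeneous_span F M rel"

sublocale F: Module.module R F using gF by (rule graded_module_module)
sublocale M: Module.module R M using gM by (rule graded_module_module)

lemma rel_carrier: "rel e x m \<Longrightarrow> x \<in> carrier F" "rel e x m \<Longrightarrow> m \<in> carrier M"
  using rel_grade grade_subset[OF gF] grade_subset[OF gM] by blast+

lemma span_carrier: "(x, m) \<in> \<rho> \<Longrightarrow> x \<in> carrier F \<and> m \<in> carrier M"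
  by (induction rule: homogeneous_span.induct) (use rel_carrier in auto)

lemma rel_span: assumes "rel e x m" shows "(x, m) \<in> \<rho>"
  using homogeneous_span.add[of rel, OF assms homogeneous_span.zero[of F M rel]] rel_carrier[OF assms] by simp

lemma span_add: "(x, m) \<in> \<rho> \<Longrightarrow> (y, n) \<in> \<rho> \<Longrightarrow> (x \<oplus>\<^bsub>F\<^esub> y, m \<oplus>\<^bsub>M\<^esub> n) \<in> \<rho>"
proof (induction rule: homogeneous_span.induct)
  case zero
  then show ?case using span_carrier by auto
next
  case (add e x m y' n')
  then have "(x \<oplus>\<^bsub>F\<^esub> (y' \<oplus>\<^bsub>F\<^esub> y), m \<oplus>\<^bsub>M\<^esub> (n' \<oplus>\<^bsub>M\<^esub> n)) \<in> \<rho>"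
    by (intro homogeneous_span.add[of rel, OF add.hyps(1)]) auto
  then show ?case
    using span_carrier[OF add.hyps(2)] span_carrier[OF add.prems] rel_carrier[OF add.hyps(1)]
    by (simp add: F.a_assoc M.a_assoc)
qed

lemma span_smult_homogeneous:
  assumes "c \<in> carrier G" "r \<in> grade R c"
  shows "(x, m) \<in> \<rho> \<Longrightarrow> (r \<odot>\<^bsub>F\<^esub> x, r \<odot>\<^bsub>M\<^esub> m) \<in> \<rho>"
proof (induction rule: homogeneous_span.induct)
  case zero
  then show ?case using grade_R assms homogeneous_span.zero by fastforce
next
  case (add e x m y n)
  have "r \<in> carrier R" using grade_R assms by auto
  then show ?case
    using homogeneous_span.add[of rel, OF rel_smult[OF assms add.hyps(1)] add.IH]
      span_carrier[OF add.hyps(2)] rel_carrier[OF add.hyps(1)]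
    by (simp add: F.smult_r_distr M.smult_r_distr)
qed

lemma span_smult:
  assumes xm: "(x, m) \<in> \<rho>" and r: "r \<in> carrier R"
  shows "(r \<odot>\<^bsub>F\<^esub> x, r \<odot>\<^bsub>M\<^esub> m) \<in> \<rho>"
proof (rule homogeneous_induct[OF _ _ r])
  show "(\<zero>\<^bsub>R\<^esub> \<odot>\<^bsub>F\<^esub> x, \<zero>\<^bsub>R\<^esub> \<odot>\<^bsub>M\<^esub> m) \<in> \<rho>"
    using span_carrier[OF xm] homogeneous_span.zero by fastforce
  fix c s t
  assume *: "c \<in> carrier G" "s \<in> grade R c" "t \<in> carrier R" "(t \<odot>\<^bsub>F\<^esub> x, t \<odot>\<^bsub>M\<^esub> m) \<in> \<rho>"
  have "s \<in> carrier R" using grade_R * by auto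
  then show "((s \<oplus>\<^bsub>R\<^esub> t) \<odot>\<^bsub>F\<^esub> x, (s \<oplus>\<^bsub>R\<^esub> t) \<odot>\<^bsub>M\<^esub> m) \<in> \<rho>"
    using span_add[OF span_smult_homogeneous[OF *(1,2) xm] *(4)] span_carrier[OF xm] *(3)
    by (simp add: F.smult_l_distr M.smult_l_distr)
qed

text \<open>
  Summands of equal degree can be collected since \<open>rel\<close> is additive in each degree.
\<close>

lemma span_components:
  "(x, m) \<in> \<rho> \<Longrightarrow> \<exists>D c k. finite D \<and> D \<subseteq> carrier G \<and> (\<forall>e\<in>D. rel e (c e) (k e)) \<and>
     x = finsum F c D \<and> m = finsum M k D"
proof (induction rule: homogeneous_span.induct)
  case zero
  show ?case by (rule exI[of _ "{}"]) auto
next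
  case (add e x m y n)
  then obtain D c k where D: "finite D" "D \<subseteq> carrier G" "\<forall>e\<in>D. rel e (c e) (k e)"
     "y = finsum F c D" "n = finsum M k D" by blast
  have cl: "c d \<in> carrier F" "k d \<in> carrier M" if "d \<in> D" for d using D(3) rel_carrier that by blast+
  have xm: "x \<in> carrier F" "m \<in> carrier M" using rel_carrier[OF add.hyps(1)] .
  have e: "e \<in> carrier G" using rel_grade[OF add.hyps(1)] by auto
  define c' where "c' = (\<lambda>d. if d = e then (if e \<in> D then x \<oplus>\<^bsub>F\<^esub> c e else x) else c d)"
  define k' where "k' = (\<lambda>d. if d = e then (if e \<in> D then m \<oplus>\<^bsub>M\<^esub> k e else m) else k d)"
  have "finsum F c' (insert e D) = x \<oplus>\<^bsub>F\<^esub> y" "finsum M k' (insert e D) = m \<oplus>\<^bsub>M\<^esub> n"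
    unfolding c'_def k'_def D(4,5)
    by (rule F.finsum_add_at[OF D(1) cl(1) xm(1)], assumption)
      (rule M.finsum_add_at[OF D(1) cl(2) xm(2)])
  then show ?case
    by (intro exI[of _ "insert e D"] exI[of _ c'] exI[of _ k'])
      (use D e add.hyps(1) rel_add in \<open>auto simp: c'_def k'_def\<close>)
qed

lemma span_right_zero:
  assumes "(x, \<zero>\<^bsub>M\<^esub>) \<in> \<rho>"
  obtains D c where "finite D" "D \<subseteq> carrier G" "\<And>e. e \<in> D \<Longrightarrow> rel e (c e) \<zero>\<^bsub>M\<^esub>" "x = finsum F c D"
proof -
  obtain D c k where D: "finite D" "D \<subseteq> carrier G" "\<forall>e\<in>D. rel e (c e) (k e)"
     "x = finsum F c D" "\<zero>\<^bsub>M\<^esub> = finsum M k D" using span_components[OF assms] by blast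
  have "k e = \<zero>\<^bsub>M\<^esub>" if "e \<in> D" for e
    using homogeneous_components_zero[OF gM D(1,2), of k] D rel_grade that by metis
  then show ?thesis using D that by metis
qed

lemma span_left_zero:
  assumes "(\<zero>\<^bsub>F\<^esub>, m) \<in> \<rho>"
  obtains D k where "finite D" "D \<subseteq> carrier G" "\<And>e. e \<in> D \<Longrightarrow> rel e \<zero>\<^bsub>F\<^esub> (k e)" "m = finsum M k D"
proof -
  obtain D c k where D: "finite D" "D \<subseteq> carrier G" "\<forall>e\<in>D. rel e (c e) (k e)"
     "\<zero>\<^bsub>F\<^esub> = finsum F c D" "m = finsum M k D" using span_components[OF assms] by blast
  have "c e = \<zero>\<^bsub>F\<^esub>" if "e \<in> D" for e
    using homogeneous_components_zero[OF gF D(1,2), of c] D rel_grade that by metis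
  then show ?thesis using D that by metis
qed

text \<open>
  The hypotheses of \<open>comparison_base\<close> about the span of \<open>rel\<close> need to be checked on homogeneous
  elements only: the bases are homogeneous, and a pair in the span with one zero entry decomposes into
  homogeneous pairs with that entry zero.
\<close>

lemma comparison_from_relation:
  assumes W: "mult_subset R W"
    and gF1: "graded_module G R F1" and gP0: "graded_module G R P0" and gP1: "graded_module G R P1"
    and bas: "free_basis R P0 BP" "free_basis R F BF" "free_basis R F1 BF1"
    and hbas: "BP \<subseteq> (\<Union>e\<in>carrier G. grade P0 e)" "BF \<subseteq> (\<Union>e\<in>carrier G. grade F e)"
    and homs: "module_hom R P1 P0 b0" "graded_hom G R F1 F d0" "graded_hom G R P0 M \<eta>"
    and surj: "\<eta> ` carrier P0 = carrier M"
    and exP: "b0 ` carrier P1 = {x \<in> carrier P0. \<eta> x = \<zero>\<^bsub>M\<^esub>}"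
    and tot_F: "\<And>e x. e \<in> carrier G \<Longrightarrow> x \<in> grade F e \<Longrightarrow> \<exists>w\<in>W. \<exists>m c. rel c (w \<odot>\<^bsub>F\<^esub> x) m"
    and tot_M: "\<And>e m. e \<in> carrier G \<Longrightarrow> m \<in> grade M e \<Longrightarrow> \<exists>w\<in>W. \<exists>x c. rel c x (w \<odot>\<^bsub>M\<^esub> m)"
    and ker_F: "\<And>e x. rel e x \<zero>\<^bsub>M\<^esub> \<Longrightarrow> \<exists>w\<in>W. w \<odot>\<^bsub>F\<^esub> x \<in> d0 ` carrier F1"
    and ker_M: "\<And>e m. rel e \<zero>\<^bsub>F\<^esub> m \<Longrightarrow> \<exists>w\<in>W. w \<odot>\<^bsub>M\<^esub> m = \<zero>\<^bsub>M\<^esub>"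
    and im_F: "\<And>e y. e \<in> carrier G \<Longrightarrow> y \<in> grade F1 e \<Longrightarrow> rel e (d0 y) \<zero>\<^bsub>M\<^esub>"
  shows "\<exists>h \<alpha> \<beta> s. mult_subset.comparison R W P0 P1 F F1 b0 d0 h \<alpha> \<beta> s"
proof -
  interpret mult_subset R W by fact
  interpret F1: Module.module R F1 using gF1 by (rule graded_module_module)
  have d0: "module_hom R F1 F d0" and \<eta>: "module_hom R P0 M \<eta>"
    using homs by (auto simp: graded_hom_def)
  note mods = graded_module_module[OF gP0] graded_module_module[OF gP1] F.module_axioms
    F1.module_axioms M.module_axioms
  show ?thesis
  proof (rule comparison_base[OF mods bas homs(1) d0 \<eta> surj exP, of \<rho>])
    show "\<rho> \<subseteq> carrier F \<times> carrier M" using span_carrier by auto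
    show "\<exists>w\<in>W. \<exists>m. (w \<odot>\<^bsub>F\<^esub> e, m) \<in> \<rho>" if eB: "e \<in> BF" for e
    proof -
      obtain c where "c \<in> carrier G" "e \<in> grade F c" using eB hbas by blast
      then show ?thesis using tot_F rel_span by blast
    qed
    show "\<exists>w\<in>W. \<exists>x. (x, w \<odot>\<^bsub>M\<^esub> \<eta> a) \<in> \<rho>" if aB: "a \<in> BP" for a
    proof -
      obtain c where c: "c \<in> carrier G" "a \<in> grade P0 c" using aB hbas by blast
      then have "\<eta> a \<in> grade M c" using homs(3) by (auto simp: graded_hom_def)
      then show ?thesis using tot_M c rel_span by blast
    qed
    show "\<exists>w\<in>W. w \<odot>\<^bsub>F\<^esub> x \<in> d0 ` carrier F1" if x: "(x, \<zero>\<^bsub>M\<^esub>) \<in> \<rho>" for x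
    proof -
      obtain D c where D: "finite D" "D \<subseteq> carrier G" "\<And>e. e \<in> D \<Longrightarrow> rel e (c e) \<zero>\<^bsub>M\<^esub>" "x = finsum F c D"
        using span_right_zero[OF x] by blast
      show ?thesis unfolding D(4)
        by (rule multiplier_into_submodule_sum[OF mods(3) hom_image_submodule[OF mods(4,3) d0] D(1)])
          (use rel_carrier(1)[OF D(3)] ker_F[OF D(3)] in auto)
    qed
    show "\<exists>w\<in>W. w \<odot>\<^bsub>M\<^esub> m = \<zero>\<^bsub>M\<^esub>" if m: "(\<zero>\<^bsub>F\<^esub>, m) \<in> \<rho>" for m
    proof -
      obtain D k where D: "finite D" "D \<subseteq> carrier G" "\<And>e. e \<in> D \<Longrightarrow> rel e \<zero>\<^bsub>F\<^esub> (k e)" "m = finsum M k D"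
        using span_left_zero[OF m] by blast
      have "\<exists>w\<in>W. w \<odot>\<^bsub>M\<^esub> finsum M k D \<in> {\<zero>\<^bsub>M\<^esub>}"
        by (rule multiplier_into_submodule_sum[OF mods(5) _ _ _ D(1)])
          (use rel_carrier(2)[OF D(3)] ker_M[OF D(3)] in auto)
      then show ?thesis unfolding D(4) by auto
    qed
    show "(d0 y, \<zero>\<^bsub>M\<^esub>) \<in> \<rho>" if y: "y \<in> carrier F1" for y
    proof -
      obtain D c where D: "finite D" "D \<subseteq> carrier G" "\<And>e. e \<in> D \<Longrightarrow> c e \<in> grade F1 e" "y = finsum F1 c D"
        using homogeneous_decomposition[OF gF1 y] by blast
      have cl: "c e \<in> carrier F1" if "e \<in> D" for e using that D grade_subset[OF gF1] by blast
      have "d0 y = finsum F (\<lambda>e. d0 (c e)) D"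
        unfolding D(4) by (rule module_hom_finsum[OF mods(4,3) d0 D(1)]) (use cl in auto)
      moreover have "(finsum F (\<lambda>e. d0 (c e)) D, \<zero>\<^bsub>M\<^esub>) \<in> \<rho>"
        using D(1-3) cl
      proof (induction D rule: finite_induct)
        case empty
        then show ?case using homogeneous_span.zero by simp
      next
        case (insert e D)
        have "(d0 (c e) \<oplus>\<^bsub>F\<^esub> finsum F (\<lambda>e. d0 (c e)) D, \<zero>\<^bsub>M\<^esub> \<oplus>\<^bsub>M\<^esub> \<zero>\<^bsub>M\<^esub>) \<in> \<rho>"
          by (rule homogeneous_span.add[of rel, OF im_F]) (use insert in auto)
        moreover have "finsum F (\<lambda>e. d0 (c e)) (insert e D) = d0 (c e) \<oplus>\<^bsub>F\<^esub> finsum F (\<lambda>e. d0 (c e)) D"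
          by (rule F.finsum_insert) (use insert module_hom_closed[OF d0] in auto)
        ultimately show ?case by simp
      qed
      ultimately show ?thesis by simp
    qed
  qed (use homogeneous_span.zero span_add span_smult in auto)
qed

end

section \<open>Cosets in free abelian groups\<close>

lemma free_Abelian_subgroup_normal:
  "subgroup T (free_Abelian_group S) \<Longrightarrow> T \<lhd> free_Abelian_group S"
  by (simp add: abelian_free_Abelian_group comm_group.normal_iff_subgroup)

lemma frag_coset_eq_iff:
  assumes T: "subgroup T (free_Abelian_group S)" and c: "Poly_Mapping.keys c \<subseteq> S" "Poly_Mapping.keys c' \<subseteq> S"
  shows "T #>\<^bsub>free_Abelian_group S\<^esub> c = T #>\<^bsub>free_Abelian_group S\<^esub> c' \<longleftrightarrow> c - c' \<in> T"
proof -
  interpret A: group "free_Abelian_group S" by simp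
  have "T #>\<^bsub>free_Abelian_group S\<^esub> c = T #>\<^bsub>free_Abelian_group S\<^esub> c' \<longleftrightarrow> c \<in> T #>\<^bsub>free_Abelian_group S\<^esub> c'"
    using A.repr_independence[OF _ _ T] A.repr_independenceD[OF T] c A.rcos_self[OF _ T]
    by (metis carrier_free_Abelian_group_iff)
  also have "\<dots> \<longleftrightarrow> c - c' \<in> T"
    by (auto simp: r_coset_def) (metis diff_add_cancel)
  finally show ?thesis .
qed

lemma frag_coset_mult:
  assumes T: "subgroup T (free_Abelian_group S)" and c: "Poly_Mapping.keys c \<subseteq> S" "Poly_Mapping.keys c' \<subseteq> S"
  shows "(T #>\<^bsub>free_Abelian_group S\<^esub> c) <#>\<^bsub>free_Abelian_group S\<^esub> (T #>\<^bsub>free_Abelian_group S\<^esub> c') =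
     T #>\<^bsub>free_Abelian_group S\<^esub> (c + c')"
  using normal.rcos_sum[OF free_Abelian_subgroup_normal[OF T], of c c'] c by simp

lemma keys_subset_add: "Poly_Mapping.keys c \<subseteq> S \<Longrightarrow> Poly_Mapping.keys c' \<subseteq> S \<Longrightarrow> Poly_Mapping.keys (c + c') \<subseteq> S"
  using Poly_Mapping.keys_add[of c c'] by auto

section \<open>Lattices and ray generators\<close>

lemma lattice_basis_dual:
  fixes g :: "'v::real_vector \<Rightarrow> int"
  assumes "is_lattice_basis L B"
  obtains m where "m \<in> dual_lattice L" "\<And>b. b \<in> B \<Longrightarrow> m b = of_int (g b)"
proof -
  have B: "finite B" "independent B" and L: "L = {(\<Sum>b\<in>B. of_int (c b) *\<^sub>R b) | c :: 'v \<Rightarrow> int. True}"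
    using assms by (auto simp: is_lattice_basis_def)
  obtain m :: "'v \<Rightarrow> real" where m: "linear m" "\<forall>b\<in>B. m b = of_int (g b)"
    using linear_independent_extend[OF B(2), of "\<lambda>b. of_int (g b)"] by blast
  have "m u \<in> \<int>" if "u \<in> L" for u
  proof -
    obtain c :: "'v \<Rightarrow> int" where u: "u = (\<Sum>b\<in>B. of_int (c b) *\<^sub>R b)" using \<open>u \<in> L\<close> L by auto
    have "m u = (\<Sum>b\<in>B. of_int (c b) * of_int (g b))"
      unfolding u using m by (simp add: linear_sum linear_scale)
    also have "\<dots> \<in> \<int>" by (intro Ints_sum) auto
    finally show ?thesis .
  qed
  then show ?thesis using that[of m] m by (auto simp: dual_lattice_def)
qed

lemma lattice_combination:
  assumes "is_lattice L" "u \<in> L" "w \<in> L"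
  shows "u - of_int k *\<^sub>R w \<in> L"
proof -
  obtain B where B: "is_lattice_basis L B" using assms by (auto simp: is_lattice_def)
  then have L: "L = {(\<Sum>b\<in>B. of_int (c b) *\<^sub>R b) | c :: 'a \<Rightarrow> int. True}"
    by (simp add: is_lattice_basis_def)
  obtain c :: "'a \<Rightarrow> int" where c: "u = (\<Sum>b\<in>B. of_int (c b) *\<^sub>R b)" using assms(2) L by auto
  obtain c' :: "'a \<Rightarrow> int" where c': "w = (\<Sum>b\<in>B. of_int (c' b) *\<^sub>R b)" using assms(3) L by auto
  have "u - of_int k *\<^sub>R w = (\<Sum>b\<in>B. of_int (c b - k * c' b) *\<^sub>R b)"
    unfolding c c' by (simp add: scaleR_sum_right sum_subtractf scaleR_diff_left)
  then show ?thesis unfolding L by (intro CollectI exI conjI TrueI)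
qed

lemma lattice_nonzero_dual:
  assumes "is_lattice L" "u \<in> L" "u \<noteq> 0"
  obtains m where "m \<in> dual_lattice L" "m u \<noteq> 0"
proof -
  obtain B where B: "is_lattice_basis L B" using assms by (auto simp: is_lattice_def)
  then have fin: "finite B" and L: "L = {(\<Sum>b\<in>B. of_int (c b) *\<^sub>R b) | c :: 'a \<Rightarrow> int. True}"
    by (simp_all add: is_lattice_basis_def)
  obtain c :: "'a \<Rightarrow> int" where c: "u = (\<Sum>b\<in>B. of_int (c b) *\<^sub>R b)" using assms(2) L by auto
  have "\<exists>b\<in>B. c b \<noteq> 0"
  proof (rule ccontr)
    assume "\<not> (\<exists>b\<in>B. c b \<noteq> 0)"
    then have "u = 0" unfolding c by (intro sum.neutral) auto
    then show False using assms(3) by simp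
  qed
  then obtain b where b: "b \<in> B" "c b \<noteq> 0" by blast
  obtain m where m: "m \<in> dual_lattice L" "\<And>x. x \<in> B \<Longrightarrow> m x = of_int (if x = b then 1 else 0)"
    using lattice_basis_dual[OF B, of "\<lambda>x. if x = b then 1 else 0"] by blast
  have "m u = (\<Sum>x\<in>B. of_int (c x) * m x)"
    unfolding c using m by (simp add: dual_lattice_def linear_sum linear_scale)
  also have "\<dots> = (\<Sum>x\<in>B. if x = b then of_int (c b) else 0)"
    using m(2) by (intro sum.cong) auto
  finally have "m u = of_int (c b)" using b fin by simp
  then show ?thesis using that m b by auto
qed

text \<open>
  A cone of dimension one is contained in a line, and strong convexity leaves one half of it.
\<close>

lemma ray_halfline:
  assumes \<rho>: "\<rho> \<in> rays \<Delta>" and fan: "is_fan L \<Delta>"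
  obtains a where "a \<in> L" "a \<noteq> 0" "\<rho> = {t *\<^sub>R a | t. t \<ge> 0}"
proof -
  have "rational_cone L \<rho>" "strongly_convex \<rho>" and dim: "dim \<rho> = 1"
    using assms by (auto simp: is_fan_def rays_def)
  then obtain A where A: "A \<subseteq> L" "\<rho> = convex_cone hull A" by (auto simp: rational_cone_def)
  obtain C where C: "C \<subseteq> \<rho>" "independent C" "\<rho> \<subseteq> span C" "card C = dim \<rho>"
    using basis_exists[of \<rho>] by blast
  obtain v where v: "C = {v}" using C(4) dim by (metis card_1_singletonE)
  then have v: "v \<in> \<rho>" "v \<noteq> 0" "\<rho> \<subseteq> span {v}" using C by (auto simp: dependent_zero)
  have "\<not> A \<subseteq> {0}"
  proof
    assume "A \<subseteq> {0}"
    then have "convex_cone hull A \<subseteq> {0}" by (intro hull_minimal) auto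
    then show False using v A by auto
  qed
  then obtain a where a: "a \<in> A" "a \<noteq> 0" by auto
  have a\<rho>: "a \<in> \<rho>" using a A by (simp add: hull_inc)
  then obtain k where k: "a = k *\<^sub>R v" using v(3) by (auto simp: span_singleton)
  then have k0: "k \<noteq> 0" using a by auto
  have "x \<in> {t *\<^sub>R a | t. t \<ge> 0}" if x: "x \<in> \<rho>" for x
  proof -
    obtain j where j: "x = j *\<^sub>R v" using x v(3) by (auto simp: span_singleton)
    then have xa: "x = (j / k) *\<^sub>R a" using k k0 by simp
    have "j / k \<ge> 0"
    proof (rule ccontr)
      assume neg: "\<not> j / k \<ge> 0"
      then have "1 / - (j / k) \<ge> 0" by (intro divide_nonneg_nonneg) auto
      then have "(1 / - (j / k)) *\<^sub>R x \<in> \<rho>"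
        using x unfolding A(2) by (intro convex_cone_hull_mul)
      moreover have "j \<noteq> 0" using neg by auto
      then have "(1 / - (j / k)) *\<^sub>R x = - a" using k0 by (simp add: xa)
      ultimately have "a \<in> \<rho> \<inter> uminus ` \<rho>" using a\<rho> by (metis IntI image_eqI minus_minus)
      then show False using \<open>strongly_convex \<rho>\<close> a by (auto simp: strongly_convex_def)
    qed
    then show ?thesis using xa by blast
  qed
  moreover have "t *\<^sub>R a \<in> \<rho>" if "t \<ge> 0" for t
    using that a\<rho> A(2) by (simp add: convex_cone_hull_mul)
  ultimately have "\<rho> = {t *\<^sub>R a | t. t \<ge> 0}" by blast
  then show ?thesis using that a A by auto
qed

text \<open>
  An integral functional that is nonzero on the ray embeds the lattice points of the ray into the
  natural numbers, up to a sign; the smallest positive value is attained at the generator, by division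
  with remainder.
\<close>

lemma ray_gen_exists:
  assumes L: "is_lattice L" and \<rho>: "\<rho> \<in> rays \<Delta>" and fan: "is_fan L \<Delta>"
  shows "\<exists>u. u \<in> \<rho> \<inter> L \<and> u \<noteq> 0 \<and> (\<forall>w\<in>\<rho> \<inter> L. \<exists>n::nat. w = of_nat n *\<^sub>R u)"
proof -
  obtain a where a: "a \<in> L" "a \<noteq> 0" "\<rho> = {t *\<^sub>R a | t. t \<ge> 0}" using ray_halfline[OF \<rho> fan] .
  obtain m where m: "m \<in> dual_lattice L" "m a \<noteq> 0" using lattice_nonzero_dual[OF L a(1,2)] .
  have lin: "linear m" and int: "\<And>u. u \<in> L \<Longrightarrow> m u \<in> \<int>" using m by (auto simp: dual_lattice_def)
  define k where "k = \<bar>m a\<bar>"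
  have k: "k > 0" using m by (simp add: k_def)
  have mult: "\<exists>n::nat. t * k = of_nat n" if t: "t \<ge> 0" "t *\<^sub>R a \<in> L" for t
  proof -
    have "t * m a \<in> \<int>" using int[OF t(2)] lin by (simp add: linear_scale)
    then have "t * k \<in> \<int>" unfolding k_def by (cases "m a \<ge> 0") auto
    moreover have "t * k \<ge> 0" using t k by simp
    ultimately show ?thesis by (metis Nats_cases Nats_altdef2 mem_Collect_eq)
  qed
  define Q where "Q n \<longleftrightarrow> n > 0 \<and> (of_nat n / k) *\<^sub>R a \<in> L" for n :: nat
  obtain n1 where n1: "1 * k = of_nat n1" using mult[of 1] a by auto
  then have "Q n1" using k a by (auto simp: Q_def)
  define n0 where "n0 = (LEAST n. Q n)"
  have n0: "Q n0" and least: "\<And>n. Q n \<Longrightarrow> n0 \<le> n"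
    unfolding n0_def using \<open>Q n1\<close> by (auto intro: LeastI Least_le)
  define u where "u = (of_nat n0 / k) *\<^sub>R a"
  have n0pos: "n0 > 0" and uL: "u \<in> L" using n0 by (auto simp: Q_def u_def)
  have "\<exists>n::nat. w = of_nat n *\<^sub>R u" if w: "w \<in> \<rho> \<inter> L" for w
  proof -
    obtain t where t: "t \<ge> 0" "w = t *\<^sub>R a" using w a(3) by auto
    obtain j :: nat where j: "t * k = of_nat j" using mult[of t] t w by auto
    have wj: "w = (of_nat j / k) *\<^sub>R a" using t j k by (simp add: field_simps)
    have "real j = real (j div n0) * real n0 + real (j mod n0)"
      by (metis div_mult_mod_eq of_nat_add of_nat_mult)
    then have "real j / k = real (j mod n0) / k + real (j div n0) * (real n0 / k)"
      by (simp add: add_divide_distrib)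
    then have r: "w = (of_nat (j mod n0) / k) *\<^sub>R a + of_nat (j div n0) *\<^sub>R u"
      unfolding wj u_def by (simp add: scaleR_add_left)
    then have "(of_nat (j mod n0) / k) *\<^sub>R a = w - of_int (int (j div n0)) *\<^sub>R u" by simp
    then have "(of_nat (j mod n0) / k) *\<^sub>R a \<in> L"
      using lattice_combination[OF L _ uL, of w "int (j div n0)"] w by simp
    then have "\<not> j mod n0 > 0" using least[of "j mod n0"] mod_less_divisor[OF n0pos, of j]
      by (auto simp: Q_def simp del: mod_less_divisor)
    then show ?thesis using r by auto
  qed
  moreover have "u \<in> \<rho>" unfolding a(3) u_def using k by (auto intro!: exI[of _ "of_nat n0 / k"])
  moreover have "u \<noteq> 0" using n0pos k a by (simp add: u_def)
  ultimately show ?thesis using uL by blast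
qed

lemma ray_gen_props:
  assumes L: "is_lattice L" and \<rho>: "\<rho> \<in> rays \<Delta>" and fan: "is_fan L \<Delta>"
  shows "ray_gen L \<rho> \<in> \<rho>" "ray_gen L \<rho> \<in> L" "ray_gen L \<rho> \<noteq> 0"
proof -
  let ?Q = "\<lambda>u. u \<in> \<rho> \<inter> L \<and> u \<noteq> 0 \<and> (\<forall>w\<in>\<rho> \<inter> L. \<exists>n::nat. w = of_nat n *\<^sub>R u)"
  have "\<exists>!u. ?Q u"
  proof (rule ex_ex1I)
    fix u u' assume u: "?Q u" and u': "?Q u'"
    then obtain n n' :: nat where n: "u = of_nat n *\<^sub>R u'" "u' = of_nat n' *\<^sub>R u" by blast
    then have "u = of_nat (n * n') *\<^sub>R u" by (metis of_nat_mult scaleR_scaleR)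
    then have "(1 - real (n * n')) *\<^sub>R u = 0" by (simp add: scaleR_diff_left)
    then have "real (n * n') = 1" using u by simp
    then have "n * n' = 1" by (metis of_nat_eq_1_iff)
    then have "n = 1" by simp
    with n(1) show "u = u'" by simp
  qed (rule ray_gen_exists[OF assms])
  from theI'[OF this] show "ray_gen L \<rho> \<in> \<rho>" "ray_gen L \<rho> \<in> L" "ray_gen L \<rho> \<noteq> 0"
    unfolding ray_gen_def by auto
qed

text \<open>
  A ray is the half-line through its generator.
\<close>

lemma ray_gen_inj:
  assumes L: "is_lattice L" and fan: "is_fan L \<Delta>"
  shows "inj_on (ray_gen L) (rays \<Delta>)"
proof -
  have ray: "\<rho> = {t *\<^sub>R ray_gen L \<rho> | t. t \<ge> 0}" if \<rho>: "\<rho> \<in> rays \<Delta>" for \<rho>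
  proof -
    obtain a where a: "a \<in> L" "a \<noteq> 0" "\<rho> = {t *\<^sub>R a | t. t \<ge> 0}" using ray_halfline[OF \<rho> fan] .
    obtain t0 where t0: "t0 \<ge> 0" "ray_gen L \<rho> = t0 *\<^sub>R a"
      using ray_gen_props(1)[OF L \<rho> fan] a(3) by auto
    then have pos: "t0 > 0" using ray_gen_props(3)[OF L \<rho> fan] by (cases "t0 = 0") auto
    have "{t *\<^sub>R a | t. t \<ge> 0} = {t *\<^sub>R ray_gen L \<rho> | t. t \<ge> 0}"
    proof (intro equalityI subsetI)
      fix x assume "x \<in> {t *\<^sub>R a | t. t \<ge> 0}"
      then obtain t where t: "t \<ge> 0" "x = t *\<^sub>R a" by blast
      then have "t / t0 \<ge> 0" "x = (t / t0) *\<^sub>R ray_gen L \<rho>" using pos t0(2) by simp_all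
      then show "x \<in> {t *\<^sub>R ray_gen L \<rho> | t. t \<ge> 0}" by blast
    next
      fix x assume "x \<in> {t *\<^sub>R ray_gen L \<rho> | t. t \<ge> 0}"
      then obtain t where t: "t \<ge> 0" "x = t *\<^sub>R ray_gen L \<rho>" by blast
      then have "t * t0 \<ge> 0" "x = (t * t0) *\<^sub>R a" using pos t0(2) by simp_all
      then show "x \<in> {t *\<^sub>R a | t. t \<ge> 0}" by blast
    qed
    then show ?thesis using a(3) by simp
  qed
  show ?thesis
  proof (rule inj_onI)
    fix \<rho> \<rho>' assume "\<rho> \<in> rays \<Delta>" "\<rho>' \<in> rays \<Delta>" "ray_gen L \<rho> = ray_gen L \<rho>'"
    then have "\<rho> = {t *\<^sub>R ray_gen L \<rho> | t. t \<ge> 0}" "\<rho>' = {t *\<^sub>R ray_gen L \<rho> | t. t \<ge> 0}"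
      using ray[of \<rho>] ray[of \<rho>'] by simp_all
    then show "\<rho> = \<rho>'" by (rule trans[OF _ sym])
  qed
qed

section \<open>Evaluation of polynomials\<close>

lemma poly_mapping_sum_single:
  "(\<Sum>a\<in>Poly_Mapping.keys p. Poly_Mapping.single a (Poly_Mapping.lookup p a)) = p"
proof (rule poly_mapping_eqI)
  fix k
  show "Poly_Mapping.lookup (\<Sum>a\<in>Poly_Mapping.keys p. Poly_Mapping.single a (Poly_Mapping.lookup p a)) k =
        Poly_Mapping.lookup p k"
    by (auto simp: lookup_sum lookup_single when_def in_keys_iff)
qed

definition monomial_eval :: "('v set \<Rightarrow> 'k::field) \<Rightarrow> ('v set \<Rightarrow>\<^sub>0 nat) \<Rightarrow> 'k" where
  "monomial_eval a e = (\<Prod>\<rho>\<in>Poly_Mapping.keys e. a \<rho> ^ Poly_Mapping.lookup e \<rho>)"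

lemma monomial_eval_superset:
  assumes "finite K" "Poly_Mapping.keys e \<subseteq> K"
  shows "monomial_eval a e = (\<Prod>\<rho>\<in>K. a \<rho> ^ Poly_Mapping.lookup e \<rho>)"
  unfolding monomial_eval_def using assms
  by (intro prod.mono_neutral_left) (auto simp: in_keys_iff)

lemma monomial_eval_add: "monomial_eval a (e + e') = monomial_eval a e * monomial_eval a e'"
proof -
  let ?K = "Poly_Mapping.keys e \<union> Poly_Mapping.keys e'"
  have "finite ?K" "Poly_Mapping.keys (e + e') \<subseteq> ?K" using Poly_Mapping.keys_add[of e e'] by auto
  then show ?thesis
    by (simp add: monomial_eval_superset[of ?K] lookup_add power_add prod.distrib)
qed

lemma poly_eval_superset:
  assumes "finite K" "Poly_Mapping.keys p \<subseteq> K"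
  shows "poly_eval a p = (\<Sum>e\<in>K. Poly_Mapping.lookup p e * monomial_eval a e)"
  unfolding poly_eval_def monomial_eval_def[symmetric] using assms
  by (intro sum.mono_neutral_left) (auto simp: in_keys_iff)

lemma poly_eval_add: "poly_eval a (p + q) = poly_eval a p + poly_eval a q"
proof -
  let ?K = "Poly_Mapping.keys p \<union> Poly_Mapping.keys q"
  have "finite ?K" "Poly_Mapping.keys (p + q) \<subseteq> ?K" using Poly_Mapping.keys_add[of p q] by auto
  then show ?thesis
    by (simp add: poly_eval_superset[of ?K] lookup_add distrib_right sum.distrib)
qed

lemma poly_eval_single: "poly_eval a (Poly_Mapping.single e c) = c * monomial_eval a e"
  by (simp add: poly_eval_superset[of "{e}"])

lemma poly_eval_one: "poly_eval a 1 = 1"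
  using poly_eval_single[of a 0 1] by (simp add: monomial_eval_def)

lemma poly_eval_sum: "poly_eval a (\<Sum>i\<in>I. p i) = (\<Sum>i\<in>I. poly_eval a (p i))"
  by (induction I rule: infinite_finite_induct) (auto simp: poly_eval_add poly_eval_def[of a 0])

lemma poly_eval_mult: "poly_eval a (p * q) = poly_eval a p * poly_eval a q"
proof -
  have "p * q = (\<Sum>e\<in>Poly_Mapping.keys p. Poly_Mapping.single e (Poly_Mapping.lookup p e)) *
                (\<Sum>e\<in>Poly_Mapping.keys q. Poly_Mapping.single e (Poly_Mapping.lookup q e))"
    by (simp only: poly_mapping_sum_single)
  also have "poly_eval a \<dots> = (\<Sum>e\<in>Poly_Mapping.keys p. \<Sum>e'\<in>Poly_Mapping.keys q.
      (Poly_Mapping.lookup p e * monomial_eval a e) * (Poly_Mapping.lookup q e' * monomial_eval a e'))"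
    by (simp add: sum_product poly_eval_sum mult_single poly_eval_single monomial_eval_add mult_ac)
  also have "\<dots> = poly_eval a p * poly_eval a q"
    by (simp add: sum_product poly_eval_superset[OF finite_keys order_refl])
  finally show ?thesis .
qed

lemma nonvanishing_mult: "nonvanishing f P \<Longrightarrow> nonvanishing g P \<Longrightarrow> nonvanishing (f * g) P"
  by (auto simp: nonvanishing_def poly_eval_mult)

lemma nonvanishing_one: "nonvanishing 1 P"
  by (auto simp: nonvanishing_def poly_eval_one)

lemma nonvanishing_mult_iff: "nonvanishing (f * g) P \<longleftrightarrow> nonvanishing f P \<and> nonvanishing g P"
  by (auto simp: nonvanishing_def poly_eval_mult)

section \<open>The Picard group and the Cox ring\<close>

locale toric =
  fixes L :: "'v::real_vector set" and \<Delta> :: "'v set set"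
begin

abbreviation "Div \<equiv> free_Abelian_group (rays \<Delta>)"
abbreviation "PD \<equiv> principal_divisors L \<Delta>"
abbreviation "G \<equiv> Pic L \<Delta>"
abbreviation pic_mult (infixl "\<cdot>" 70) where "d \<cdot> e \<equiv> d \<otimes>\<^bsub>Pic L \<Delta>\<^esub> e"
abbreviation "mdeg \<equiv> monomial_degree L \<Delta>"
abbreviation S :: "(('v, 'k::field) cox_poly, ('v, 'k) cox_poly, 'v pic) graded" where
  "S \<equiv> cox_ring L \<Delta>"
abbreviation "homog \<equiv> homogeneous L \<Delta>"
abbreviation "X \<equiv> toric_points L \<Delta>"
abbreviation "zopen \<equiv> openin (zariski L \<Delta>)"
abbreviation "pairs \<equiv> fraction_pairs L \<Delta>"
abbreviation "fract \<equiv> fraction L \<Delta>"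
abbreviation "sadd \<equiv> stalk_add L \<Delta>"
abbreviation "ssmult \<equiv> stalk_smult L \<Delta>"
abbreviation "\<T> \<equiv> tilde L \<Delta>"
abbreviation "tmap \<equiv> tilde_map L \<Delta>"

lemma finite_rays: "is_fan L \<Delta> \<Longrightarrow> finite (rays \<Delta>)"
  by (auto simp: is_fan_def rays_def)

lemma principal_divisors_subgroup:
  "subgroup PD Div"
proof
  show "PD \<subseteq> carrier Div"
    by (auto simp: principal_divisors_def)
  show "\<one>\<^bsub>Div\<^esub> \<in> PD"
    by (auto simp: principal_divisors_def dual_lattice_def intro!: exI[of _ "\<lambda>_. 0"] linear_zero)
next
  fix D E assume "D \<in> PD" "E \<in> PD"
  then obtain m n where *: "m \<in> dual_lattice L" "n \<in> dual_lattice L"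
      "Poly_Mapping.keys D \<subseteq> rays \<Delta>" "Poly_Mapping.keys E \<subseteq> rays \<Delta>"
     "\<And>\<rho>. \<rho> \<in> rays \<Delta> \<Longrightarrow> of_int (Poly_Mapping.lookup D \<rho>) = m (ray_gen L \<rho>)"
     "\<And>\<rho>. \<rho> \<in> rays \<Delta> \<Longrightarrow> of_int (Poly_Mapping.lookup E \<rho>) = n (ray_gen L \<rho>)"
    by (auto simp: principal_divisors_def)
  have "(\<lambda>x. m x + n x) \<in> dual_lattice L"
    using *(1,2) by (auto simp: dual_lattice_def linear_compose_add)
  then show "D \<otimes>\<^bsub>Div\<^esub> E \<in> PD"
    using * keys_subset_add[OF *(3,4)]
    by (auto simp: principal_divisors_def lookup_add intro!: bexI[of _ "\<lambda>x. m x + n x"])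
next
  fix D assume "D \<in> PD"
  then obtain m where *: "m \<in> dual_lattice L" "Poly_Mapping.keys D \<subseteq> rays \<Delta>"
     "\<And>\<rho>. \<rho> \<in> rays \<Delta> \<Longrightarrow> of_int (Poly_Mapping.lookup D \<rho>) = m (ray_gen L \<rho>)"
    by (auto simp: principal_divisors_def)
  have "(\<lambda>x. - m x) \<in> dual_lattice L"
    using *(1) by (auto simp: dual_lattice_def linear_compose_neg)
  then show "inv\<^bsub>Div\<^esub> D \<in> PD"
    using * by (auto simp: principal_divisors_def intro!: bexI[of _ "\<lambda>x. - m x"])
qed

lemma Pic_comm_group: "comm_group G"
  unfolding Pic_def
  by (rule comm_group.abelian_FactGroup[OF abelian_free_Abelian_group principal_divisors_subgroup])

sublocale G: comm_group G by (rule Pic_comm_group)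

lemma carrier_PicE:
  assumes "d \<in> carrier G"
  obtains D where "Poly_Mapping.keys D \<subseteq> rays \<Delta>"
    "d = PD #>\<^bsub>Div\<^esub> D"
  using assms by (auto simp: Pic_def carrier_FactGroup)

lemma keys_map_int: "Poly_Mapping.keys (Poly_Mapping.map int a) = Poly_Mapping.keys a"
  by (auto simp: in_keys_iff Poly_Mapping.map.rep_eq when_def split: if_splits)

lemma map_int_add: "Poly_Mapping.map int (a + b) = Poly_Mapping.map int a + Poly_Mapping.map int b"
  by (rule poly_mapping_eqI) (auto simp: Poly_Mapping.map.rep_eq lookup_add when_def)

lemma monomial_degree_carrier:
  "Poly_Mapping.keys a \<subseteq> rays \<Delta> \<Longrightarrow> mdeg a \<in> carrier G"
  by (auto simp: monomial_degree_def Pic_def carrier_FactGroup keys_map_int)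

lemma monomial_degree_add:
  assumes "Poly_Mapping.keys a \<subseteq> rays \<Delta>" "Poly_Mapping.keys b \<subseteq> rays \<Delta>"
  shows "mdeg (a + b) = mdeg a \<cdot> mdeg b"
  using frag_coset_mult[OF principal_divisors_subgroup, of "Poly_Mapping.map int a" "Poly_Mapping.map int b"] assms
  by (simp add: monomial_degree_def Pic_def map_int_add keys_map_int)

lemma monomial_degree_zero: "mdeg 0 = \<one>\<^bsub>G\<^esub>"
proof -
  have "Poly_Mapping.map int 0 = (0 :: 'v set \<Rightarrow>\<^sub>0 int)"
    by (rule poly_mapping_eqI) (simp add: Poly_Mapping.map.rep_eq)
  moreover have "0 \<in> PD"
    using subgroup.one_closed[OF principal_divisors_subgroup] by simp
  then have "PD #>\<^bsub>Div\<^esub> 0 = PD"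
    by (intro group.coset_join2 principal_divisors_subgroup) auto
  ultimately show ?thesis by (simp add: monomial_degree_def Pic_def)
qed

lemma cox_ring_simps [simp]:
  "x \<otimes>\<^bsub>S\<^esub> y = x * y" "\<one>\<^bsub>S\<^esub> = 1" "\<zero>\<^bsub>S\<^esub> = 0"
  "x \<oplus>\<^bsub>S\<^esub> y = x + y" "x \<odot>\<^bsub>S\<^esub> y = x * y"
  by (simp_all add: cox_ring_def)

lemma cox_grade_iff: "p \<in> grade S d \<longleftrightarrow>
    (\<forall>a\<in>Poly_Mapping.keys p. Poly_Mapping.keys a \<subseteq> rays \<Delta> \<and> mdeg a = d)"
  by (simp add: cox_ring_def)

lemma cox_carrier_iff: "p \<in> carrier S \<longleftrightarrow>
    (\<forall>a\<in>Poly_Mapping.keys p. Poly_Mapping.keys a \<subseteq> rays \<Delta>)"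
  by (simp add: cox_ring_def)

lemma cox_grade_carrier: "p \<in> grade S d \<Longrightarrow> p \<in> carrier S"
  by (auto simp: cox_grade_iff cox_carrier_iff)

lemma cox_grade_zero: "0 \<in> grade S d"
  by (simp add: cox_grade_iff)

lemma cox_grade_mult:
  assumes "f \<in> grade S d" "g \<in> grade S e"
  shows "f * g \<in> grade S (d \<cdot> e)"
  unfolding cox_grade_iff
proof
  fix a assume "a \<in> Poly_Mapping.keys (f * g)"
  then obtain b c where a: "a = b + c" "b \<in> Poly_Mapping.keys f" "c \<in> Poly_Mapping.keys g"
    using keys_mult[of f g] by blast
  then show "Poly_Mapping.keys a \<subseteq> rays \<Delta> \<and> mdeg a = d \<cdot> e"
    using assms keys_subset_add[of b "rays \<Delta>" c] monomial_degree_add[of b c]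
    unfolding cox_grade_iff by auto
qed

lemma cox_grade_one: "1 \<in> grade S \<one>\<^bsub>G\<^esub>"
  by (simp add: cox_grade_iff monomial_degree_zero)

lemma cox_grade_single:
  "Poly_Mapping.keys a \<subseteq> rays \<Delta> \<Longrightarrow> Poly_Mapping.single a c \<in> grade S (mdeg a)"
  by (simp add: cox_grade_iff)

text \<open>
  Monomials are homogeneous, so every polynomial is a sum of homogeneous ones.
\<close>

lemma cox_homogeneous_induct:
  assumes "Q 0"
    and "\<And>c s t. c \<in> carrier G \<Longrightarrow> s \<in> grade S c \<Longrightarrow> t \<in> carrier S \<Longrightarrow>
      Q t \<Longrightarrow> Q (s + t)"
    and r: "r \<in> carrier S"
  shows "Q r"
proof -
  have "Q (\<Sum>a\<in>K. Poly_Mapping.single a (Poly_Mapping.lookup r a)) \<and>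
      (\<Sum>a\<in>K. Poly_Mapping.single a (Poly_Mapping.lookup r a)) \<in> carrier S"
    if "finite K" "K \<subseteq> Poly_Mapping.keys r" for K
    using that
  proof (induction K rule: finite_induct)
    case empty
    then show ?case using assms(1) by (simp add: cox_carrier_iff)
  next
    case (insert a K)
    have a: "Poly_Mapping.keys a \<subseteq> rays \<Delta>" using insert.prems r by (auto simp: cox_carrier_iff)
    let ?s = "Poly_Mapping.single a (Poly_Mapping.lookup r a)"
    let ?t = "\<Sum>a\<in>K. Poly_Mapping.single a (Poly_Mapping.lookup r a)"
    have t: "Q ?t" "?t \<in> carrier S" using insert by auto
    have "Q (?s + ?t)"
      by (rule assms(2)[OF monomial_degree_carrier[OF a] cox_grade_single[OF a] t(2,1)])
    moreover have "?s + ?t \<in> carrier S"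
      using Poly_Mapping.keys_add[of ?s ?t] t(2) a unfolding cox_carrier_iff by (auto split: if_splits)
    ultimately show ?case using insert.hyps by simp
  qed
  from this[of "Poly_Mapping.keys r"] show ?thesis by (simp add: poly_mapping_sum_single)
qed

section \<open>Denominators at a point\<close>

definition units :: "('v, 'k::field) pt \<Rightarrow> ('v, 'k) cox_poly set" where
  "units P = {h \<in> homog. nonvanishing h P}"

lemma homogeneousI: "d \<in> carrier G \<Longrightarrow> f \<in> grade S d \<Longrightarrow> f \<in> homog"
  by (auto simp: homogeneous_def)

lemma homogeneousE:
  assumes "f \<in> homog"
  obtains d where "d \<in> carrier G" "f \<in> grade S d"
  using assms by (auto simp: homogeneous_def)

lemma homogeneous_one: "1 \<in> homog"
  by (rule homogeneousI[OF G.one_closed cox_grade_one])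

lemma homogeneous_mult:
  assumes "f \<in> homog" "g \<in> homog"
  shows "f * g \<in> homog"
proof -
  obtain d where d: "d \<in> carrier G" "f \<in> grade S d"
    using assms(1) by (rule homogeneousE)
  obtain e where e: "e \<in> carrier G" "g \<in> grade S e"
    using assms(2) by (rule homogeneousE)
  show ?thesis by (rule homogeneousI[OF G.m_closed[OF d(1) e(1)] cox_grade_mult[OF d(2) e(2)]])
qed

lemma homogeneous_carrier: "f \<in> homog \<Longrightarrow> f \<in> carrier S"
  using cox_grade_carrier unfolding homogeneous_def by blast

lemma units_mult_subset:
  fixes P :: "('v, 'k::field) pt"
  assumes "cring (S :: (('v, 'k) cox_poly, ('v, 'k) cox_poly, 'v pic) graded)"
  shows "mult_subset S (units P)"
  unfolding mult_subset_def mult_subset_axioms_def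
  using assms homogeneous_one homogeneous_mult nonvanishing_one nonvanishing_mult homogeneous_carrier
  by (auto simp: units_def)

text \<open>
  This is where smoothness enters. A point has a cone \<open>\<sigma>\<close> such that the variables of the
  rays outside \<open>\<sigma>\<close> are nonzero at the point. Since the generators of the rays of \<open>\<sigma>\<close> extend to a
  lattice basis, a divisor can be changed by the divisor of a character so that its coefficients on
  the rays of \<open>\<sigma>\<close> become zero; the positive and the negative part of the result are the exponents of
  two monomials that are nonzero at the point.
\<close>

lemma degree_ratio_of_units:
  fixes P :: "('v, 'k::field) pt"
  assumes fan: "smooth_projective_fan L \<Delta>" and P: "P \<in> X"
    and d: "d \<in> carrier G"
  obtains v g e where "e \<in> carrier G" "v \<in> grade S e" "nonvanishing v P"
     "g \<in> grade S (e \<cdot> d)" "nonvanishing g P"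
proof -
  have L: "is_lattice L" and F: "is_fan L \<Delta>" and sm: "smooth_fan L \<Delta>"
    using fan by (auto simp: smooth_projective_fan_def)
  obtain D where D: "Poly_Mapping.keys D \<subseteq> rays \<Delta>"
    "d = PD #>\<^bsub>Div\<^esub> D"
    using carrier_PicE[OF d] .
  obtain a where a: "a \<notin> irrelevant_locus \<Delta>" "a \<in> rays \<Delta> \<rightarrow>\<^sub>E UNIV"
      "P = (\<lambda>t. \<lambda>\<rho>\<in>rays \<Delta>. t \<rho> * a \<rho>) ` cox_group L \<Delta>"
    using P by (auto simp: toric_points_def)
  then obtain \<sigma> where \<sigma>: "\<sigma> \<in> \<Delta>" "(\<Prod>\<rho>\<in>{\<rho>\<in>rays \<Delta>. \<not> \<rho> face_of \<sigma>}. a \<rho>) \<noteq> 0"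
    by (auto simp: irrelevant_locus_def)
  have a0: "a \<rho> \<noteq> 0" if "\<rho> \<in> rays \<Delta>" "\<not> \<rho> face_of \<sigma>" for \<rho>
    using \<sigma>(2) that finite_rays[OF F] by (auto simp: prod_zero_iff)
  let ?R = "{\<rho>\<in>rays \<Delta>. \<rho> face_of \<sigma>}"
  obtain B where B: "is_lattice_basis L B" "ray_gen L ` ?R \<subseteq> B"
    using sm \<sigma>(1) by (auto simp: smooth_fan_def)
  have inj: "inj_on (ray_gen L) ?R"
    using ray_gen_inj[OF L F] by (rule inj_on_subset) auto
  obtain m where m: "m \<in> dual_lattice L"
      "\<And>b. b \<in> B \<Longrightarrow> m b = of_int (Poly_Mapping.lookup D (inv_into ?R (ray_gen L) b))"
    using lattice_basis_dual[OF B(1), of "\<lambda>b. Poly_Mapping.lookup D (inv_into ?R (ray_gen L) b)"] by blast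
  have m\<rho>: "m (ray_gen L \<rho>) = of_int (Poly_Mapping.lookup D \<rho>)" if \<rho>: "\<rho> \<in> ?R" for \<rho>
  proof -
    have "ray_gen L \<rho> \<in> B" using B(2) \<rho> by blast
    from m(2)[OF this] show ?thesis using inv_into_f_f[OF inj \<rho>] by simp
  qed
  \<comment> \<open>\<open>E\<close> is the divisor of the character \<open>m\<close>\<close>
  define E where "E = (\<Sum>\<rho>\<in>rays \<Delta>. Poly_Mapping.single \<rho> (\<lfloor>m (ray_gen L \<rho>)\<rfloor>))"
  have lE: "Poly_Mapping.lookup E \<rho> = (if \<rho> \<in> rays \<Delta> then \<lfloor>m (ray_gen L \<rho>)\<rfloor> else 0)" for \<rho>
    unfolding E_def using finite_rays[OF F] by (auto simp: lookup_sum lookup_single when_def)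
  have Epr: "E \<in> PD"
  proof -
    have "of_int (Poly_Mapping.lookup E \<rho>) = m (ray_gen L \<rho>)" if "\<rho> \<in> rays \<Delta>" for \<rho>
      using ray_gen_props(2)[OF L that F] m(1) that by (auto simp: lE dual_lattice_def elim!: Ints_cases)
    moreover have "Poly_Mapping.keys E \<subseteq> rays \<Delta>" by (auto simp: in_keys_iff lE split: if_splits)
    ultimately show ?thesis using m(1) by (auto simp: principal_divisors_def)
  qed
  define C where "C = D - E"
  have C: "Poly_Mapping.keys C \<subseteq> {\<rho>\<in>rays \<Delta>. \<not> \<rho> face_of \<sigma>}"
  proof
    fix \<rho> assume "\<rho> \<in> Poly_Mapping.keys C"
    then have ne: "Poly_Mapping.lookup D \<rho> \<noteq> Poly_Mapping.lookup E \<rho>"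
      by (simp add: C_def in_keys_iff lookup_minus)
    have \<rho>: "\<rho> \<in> rays \<Delta>"
    proof (rule ccontr)
      assume "\<rho> \<notin> rays \<Delta>"
      moreover from this have "Poly_Mapping.lookup D \<rho> = 0" using D(1) by (metis in_keys_iff subsetD)
      ultimately show False using ne lE[of \<rho>] by simp
    qed
    then show "\<rho> \<in> {\<rho>\<in>rays \<Delta>. \<not> \<rho> face_of \<sigma>}" using m\<rho>[of \<rho>] ne lE[of \<rho>] by auto
  qed
  define p where "p = Poly_Mapping.map nat C"
  define q where "q = Poly_Mapping.map nat (- C)"
  have kp: "Poly_Mapping.keys p \<subseteq> {\<rho>\<in>rays \<Delta>. \<not> \<rho> face_of \<sigma>}" "Poly_Mapping.keys q \<subseteq> {\<rho>\<in>rays \<Delta>. \<not> \<rho> face_of \<sigma>}"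
  proof -
    have "Poly_Mapping.keys p \<subseteq> Poly_Mapping.keys C" "Poly_Mapping.keys q \<subseteq> Poly_Mapping.keys C"
      by (auto simp: p_def q_def in_keys_iff Poly_Mapping.map.rep_eq when_def split: if_splits)
    then show "Poly_Mapping.keys p \<subseteq> {\<rho>\<in>rays \<Delta>. \<not> \<rho> face_of \<sigma>}"
        "Poly_Mapping.keys q \<subseteq> {\<rho>\<in>rays \<Delta>. \<not> \<rho> face_of \<sigma>}"
      using C by blast+
  qed
  have pq: "Poly_Mapping.map int p = Poly_Mapping.map int q + C"
    by (rule poly_mapping_eqI) (auto simp: p_def q_def Poly_Mapping.map.rep_eq when_def lookup_add)
  have kp': "Poly_Mapping.keys p \<subseteq> rays \<Delta>" "Poly_Mapping.keys q \<subseteq> rays \<Delta>" using kp by auto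
  have nv: "nonvanishing (Poly_Mapping.single e (1::'k)) P"
    if e: "Poly_Mapping.keys e \<subseteq> {\<rho>\<in>rays \<Delta>. \<not> \<rho> face_of \<sigma>}" for e
    unfolding nonvanishing_def
  proof
    fix x assume "x \<in> P"
    then obtain t where t: "t \<in> cox_group L \<Delta>" "x = (\<lambda>\<rho>\<in>rays \<Delta>. t \<rho> * a \<rho>)" using a(3) by auto
    have "x \<rho> \<noteq> 0" if "\<rho> \<in> Poly_Mapping.keys e" for \<rho>
    proof -
      have "\<rho> \<in> rays \<Delta>" "a \<rho> \<noteq> 0" "t \<rho> \<noteq> 0" using that e a0 t(1) by (auto simp: cox_group_def)
      then show ?thesis using t(2) by simp
    qed
    then show "poly_eval x (Poly_Mapping.single e (1::'k)) \<noteq> 0"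
      by (simp add: poly_eval_single monomial_eval_def)
  qed
  have "d = PD #>\<^bsub>Div\<^esub> C"
    unfolding D(2) using D(1) C Epr
    by (subst frag_coset_eq_iff[OF principal_divisors_subgroup]) (auto simp: C_def)
  then have deg: "mdeg p = mdeg q \<cdot> d"
    using frag_coset_mult[OF principal_divisors_subgroup, of "Poly_Mapping.map int q" C] C kp'
    by (auto simp: monomial_degree_def Pic_def pq keys_map_int)
  show ?thesis
  proof (rule that)
    show "mdeg q \<in> carrier G" by (rule monomial_degree_carrier[OF kp'(2)])
    show "Poly_Mapping.single q 1 \<in> grade S (mdeg q)"
      using kp' by (intro cox_grade_single)
    show "Poly_Mapping.single p 1 \<in> grade S (mdeg q \<cdot> d)"
      unfolding deg[symmetric] using kp' by (intro cox_grade_single)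
  qed (use nv kp in auto)
qed

section \<open>Fractions and sections\<close>

text \<open>
  Operations on fractions are defined as unions over all representatives; they are computed from a
  single one once the value is known to be the same for all.
\<close>

lemma UN_pair_const:
  assumes "p \<in> A" "\<And>x f. (x, f) \<in> A \<Longrightarrow> K x f = C"
  shows "(\<Union>(x, f)\<in>A. K x f) = C"
proof (intro equalityI subsetI)
  show "z \<in> C" if "z \<in> (\<Union>(x, f)\<in>A. K x f)" for z using that assms(2) by auto
  show "z \<in> (\<Union>(x, f)\<in>A. K x f)" if "z \<in> C" for z
    by (rule UN_I[OF assms(1)]) (use that assms in \<open>auto split: prod.splits\<close>)
qed

definition basic_open :: "('v, 'k::field) cox_poly \<Rightarrow> ('v, 'k) pt set" ("\<D>") where
  "\<D> f = {P \<in> X. nonvanishing f P}"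

lemma basic_open_openin: "f \<in> homog \<Longrightarrow> zopen (\<D> f)"
  unfolding zariski_def basic_open_def by (rule topology_generated_by_Basis) auto

lemma basic_open_mult: "\<D> (f * g) = \<D> f \<inter> \<D> g"
  by (auto simp: basic_open_def nonvanishing_mult_iff)

lemma zariski_open_subset: "zopen U \<Longrightarrow> U \<subseteq> X"
  using openin_subset[of "zariski L \<Delta>" U] by (auto simp: zariski_def)

lemma unitsI: "h \<in> homog \<Longrightarrow> nonvanishing h P \<Longrightarrow> h \<in> units P"
  by (simp add: units_def)

lemma unitsD: "h \<in> units P \<Longrightarrow> h \<in> homog" "h \<in> units P \<Longrightarrow> nonvanishing h P"
  by (simp_all add: units_def)

lemma units_mult: "f \<in> units P \<Longrightarrow> g \<in> units P \<Longrightarrow> f * g \<in> units P"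
  by (simp add: units_def homogeneous_mult nonvanishing_mult)

lemma units_one: "1 \<in> units P"
  by (simp add: units_def homogeneous_one nonvanishing_one)

lemma units_carrier: "h \<in> units P \<Longrightarrow> h \<in> carrier S"
  by (simp add: units_def homogeneous_carrier)

lemma cox_carrier_mult:
  assumes "f \<in> carrier S" "g \<in> carrier S"
  shows "f * g \<in> carrier S"
  unfolding cox_carrier_iff
proof
  fix a assume "a \<in> Poly_Mapping.keys (f * g)"
  then obtain b c where "a = b + c" "b \<in> Poly_Mapping.keys f" "c \<in> Poly_Mapping.keys g"
    using keys_mult[of f g] by blast
  then show "Poly_Mapping.keys a \<subseteq> rays \<Delta>"
    using assms keys_subset_add[of b "rays \<Delta>" c] by (auto simp: cox_carrier_iff)
qed

definition sec :: "(('v, 'k::field) cox_poly, 'm, 'v pic) graded \<Rightarrow> ('v, 'k) pt set \<Rightarrow> 'm \<Rightarrow> ('v, 'k) cox_poly \<Rightarrow>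
    ('v, 'k, 'm) section_fun" where
  "sec M U x f = (\<lambda>Q\<in>U. fract M Q x f)"

lemma sec_apply: "Q \<in> U \<Longrightarrow> sec M U x f Q = fract M Q x f"
  by (simp add: sec_def)

lemma sec_restrict:
  "V \<subseteq> U \<Longrightarrow> restrict (sec M U x f) V = sec M V x f"
  by (auto simp: sec_def restrict_def fun_eq_iff)

lemma fraction_pairsI:
  "d \<in> carrier G \<Longrightarrow> x \<in> grade M d \<Longrightarrow> f \<in> grade S d \<Longrightarrow> nonvanishing f P \<Longrightarrow>
    (x, f) \<in> pairs M P"
  by (auto simp: fraction_pairs_def)

lemma tilde_carrier_iff: "s \<in> carrier (\<T> M U) \<longleftrightarrow> s \<in> extensional U \<and>
    (\<forall>P\<in>U. \<exists>V x f. zopen V \<and> P \<in> V \<and> V \<subseteq> U \<and>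
       (\<forall>Q\<in>V. (x, f) \<in> pairs M Q \<and> s Q = fract M Q x f))"
  unfolding tilde_def partial_object.select_convs mem_Collect_eq by (rule refl)

lemma sec_carrier:
  assumes "d \<in> carrier G" "x \<in> grade M d" "f \<in> grade S d"
    and "zopen U" "U \<subseteq> \<D> f"
  shows "sec M U x f \<in> carrier (\<T> M U)"
proof -
  have "(x, f) \<in> pairs M Q" if "Q \<in> U" for Q
    by (rule fraction_pairsI[OF assms(1-3)]) (use assms(5) that in \<open>auto simp: basic_open_def\<close>)
  then have "\<forall>P\<in>U. \<exists>V y g. zopen V \<and> P \<in> V \<and> V \<subseteq> U \<and> (\<forall>Q\<in>V. (y, g) \<in> pairs M Q \<and>
      sec M U x f Q = fract M Q y g)"
    using assms(4) by (intro ballI exI[of _ U] exI[of _ x] exI[of _ f]) (auto simp: sec_apply)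
  moreover have "sec M U x f \<in> extensional U" by (simp add: sec_def)
  ultimately show ?thesis
    unfolding tilde_carrier_iff by (rule conjI[rotated])
qed

lemma tilde_sectionE:
  assumes "s \<in> carrier (\<T> M U)" "P \<in> U"
  obtains V x f d where "zopen V" "P \<in> V" "V \<subseteq> U" "d \<in> carrier G"
    "x \<in> grade M d" "f \<in> grade S d" "V \<subseteq> \<D> f"
    "restrict s V = sec M V x f"
proof -
  obtain V x f where V: "zopen V" "P \<in> V" "V \<subseteq> U"
    "\<And>Q. Q \<in> V \<Longrightarrow> (x, f) \<in> pairs M Q \<and> s Q = fract M Q x f"
    using assms unfolding tilde_carrier_iff by meson
  have "(x, f) \<in> pairs M P" using V by blast
  then obtain d where d: "d \<in> carrier G" "x \<in> grade M d" "f \<in> grade S d"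
    by (auto simp: fraction_pairs_def)
  have "V \<subseteq> \<D> f"
    using V(4) zariski_open_subset[OF V(1)] by (auto simp: basic_open_def fraction_pairs_def)
  moreover have "restrict s V = sec M V x f"
    using V(4) by (auto simp: sec_def restrict_def fun_eq_iff)
  ultimately show ?thesis using that[OF V(1-3) d] by blast
qed

lemma tilde_zero_apply: "Q \<in> U \<Longrightarrow> \<zero>\<^bsub>\<T> M U\<^esub> Q = fract M Q \<zero>\<^bsub>M\<^esub> 1"
  by (simp add: tilde_def)

end

locale toric_module = toric L \<Delta> for L :: "'v::real_vector set" and \<Delta> +
  fixes M :: "(('v, 'k::field) cox_poly, 'm, 'v pic) graded" (structure)
  assumes gM: "graded_module G S M"
begin

sublocale M: Module.module S M by (rule graded_module_module[OF gM])

lemma smult_smult: "f \<in> carrier S \<Longrightarrow> g \<in> carrier S \<Longrightarrow> x \<in> carrier M \<Longrightarrow>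
    f \<odot> (g \<odot> x) = (f * g) \<odot> x"
  using M.smult_assoc1[of f g x] by simp

lemma one_smult: "x \<in> carrier M \<Longrightarrow> 1 \<odot> x = x"
  using M.smult_one[of x] by simp

lemma grade_carrier: "d \<in> carrier G \<Longrightarrow> x \<in> grade M d \<Longrightarrow> x \<in> carrier M"
  using grade_subset[OF gM] by blast

lemma smult_grade: "d \<in> carrier G \<Longrightarrow> e \<in> carrier G \<Longrightarrow> r \<in> grade S d \<Longrightarrow> x \<in> grade M e \<Longrightarrow>
    r \<odot> x \<in> grade M (d \<cdot> e)"
  by (rule grade_smult[OF gM])

lemma pairsE:
  assumes "(x, f) \<in> pairs M P"
  obtains d where "d \<in> carrier G" "x \<in> grade M d" "f \<in> grade S d" "nonvanishing f P"
    "x \<in> carrier M" "f \<in> carrier S" "f \<in> units P"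
proof -
  obtain d where d: "d \<in> carrier G" "x \<in> grade M d" "f \<in> grade S d" "nonvanishing f P"
    using assms by (auto simp: fraction_pairs_def)
  show ?thesis
    by (rule that[OF d grade_carrier[OF d(1,2)] cox_grade_carrier[OF d(3)] unitsI[OF homogeneousI[OF d(1,3)] d(4)]])
qed

lemma fraction_iff: "(y, g) \<in> fract M P x f \<longleftrightarrow> (y, g) \<in> pairs M P \<and>
    (\<exists>h\<in>units P. h \<odot> (g \<odot> x) = h \<odot> (f \<odot> y))"
  by (auto simp: fraction_def units_def)

lemma fraction_self: "(x, f) \<in> pairs M P \<Longrightarrow> (x, f) \<in> fract M P x f"
  unfolding fraction_iff by (intro conjI bexI[OF _ units_one]) auto

text \<open>
  Transitivity of the equality of fractions: \<open>k y\<close> and \<open>g z\<close> agree after multiplication by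
  \<open>h h' f\<close>.
\<close>

lemma fraction_subset:
  assumes x: "(x, f) \<in> pairs M P" and y: "(y, g) \<in> pairs M P"
    and h: "h \<in> units P" "h \<odot> (g \<odot> x) = h \<odot> (f \<odot> y)"
  shows "fract M P x f \<subseteq> fract M P y g"
proof
  fix zk assume zk: "zk \<in> fract M P x f"
  obtain z k where [simp]: "zk = (z, k)" by (cases zk)
  have z: "(z, k) \<in> pairs M P" using zk by (simp add: fraction_iff)
  obtain h' where h': "h' \<in> units P" "h' \<odot> (k \<odot> x) = h' \<odot> (f \<odot> z)"
    using zk by (auto simp: fraction_iff)
  note [simp] = smult_smult cox_carrier_mult
  have c: "x \<in> carrier M" "y \<in> carrier M" "z \<in> carrier M" "f \<in> carrier S" "g \<in> carrier S" "k \<in> carrier S"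
    "h \<in> carrier S" "h' \<in> carrier S" and fu: "f \<in> units P"
    using pairsE[OF x] pairsE[OF y] pairsE[OF z] units_carrier[OF h(1)] units_carrier[OF h'(1)] by metis+
  have "(h * h' * f) \<odot> (k \<odot> y) = (h' * k) \<odot> (h \<odot> (f \<odot> y))"
    using c by (simp add: mult_ac)
  also have "\<dots> = (h' * k) \<odot> (h \<odot> (g \<odot> x))" by (simp only: h(2))
  also have "\<dots> = (h * g) \<odot> (h' \<odot> (k \<odot> x))"
    using c by (simp add: mult_ac)
  also have "\<dots> = (h * g) \<odot> (h' \<odot> (f \<odot> z))" by (simp only: h'(2))
  also have "\<dots> = (h * h' * f) \<odot> (g \<odot> z)"
    using c by (simp add: mult_ac)
  finally show "zk \<in> fract M P y g"
    using z units_mult[OF units_mult[OF h(1) h'(1)] fu] by (auto simp: fraction_iff)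
qed

lemma fraction_eqI:
  assumes "(x, f) \<in> pairs M P" "(y, g) \<in> pairs M P"
    and "h \<in> units P" "h \<odot> (g \<odot> x) = h \<odot> (f \<odot> y)"
  shows "fract M P x f = fract M P y g"
  using fraction_subset[OF assms] fraction_subset[OF assms(2,1,3) assms(4)[symmetric]] by blast

lemma fraction_eqD:
  assumes "fract M P x f = fract M P y g" "(y, g) \<in> pairs M P"
  obtains h where "h \<in> units P" "h \<odot> (g \<odot> x) = h \<odot> (f \<odot> y)"
proof -
  have "(y, g) \<in> fract M P x f" using fraction_self[OF assms(2)] assms(1) by simp
  then show ?thesis using that unfolding fraction_iff by blast
qed

lemma fraction_cancel:
  assumes x: "d \<in> carrier G" "x \<in> grade M d" "f \<in> grade S d" "nonvanishing f P"
    and k: "k \<in> units P"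
  shows "fract M P (k \<odot> x) (k * f) = fract M P x f"
proof -
  obtain c where c: "c \<in> carrier G" "k \<in> grade S c" using unitsD(1)[OF k] by (rule homogeneousE)
  have "(k \<odot> x, k * f) \<in> pairs M P"
    by (rule fraction_pairsI[OF G.m_closed[OF c(1) x(1)] smult_grade[OF c(1) x(1) c(2) x(2)] cox_grade_mult[OF c(2) x(3)]])
      (use x(4) unitsD(2)[OF k] in \<open>rule nonvanishing_mult[rotated]\<close>)
  moreover have "(x, f) \<in> pairs M P" using x by (rule fraction_pairsI)
  moreover have "1 \<odot> (f \<odot> (k \<odot> x)) = 1 \<odot> ((k * f) \<odot> x)"
    using grade_carrier[OF x(1,2)] units_carrier[OF k] cox_grade_carrier[OF x(3)]
    by (simp add: smult_smult mult.commute)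
  ultimately show ?thesis by (intro fraction_eqI[OF _ _ units_one])
qed

lemma zero_one_pair: "(\<zero>, 1) \<in> pairs M P"
  by (rule fraction_pairsI[OF G.one_closed grade_zero[OF gM G.one_closed] cox_grade_one nonvanishing_one])

lemma fraction_zero:
  assumes "d \<in> carrier G" "f \<in> grade S d" "nonvanishing f P"
  shows "fract M P \<zero> f = fract M P \<zero> 1"
proof -
  have "(\<zero>, f) \<in> pairs M P"
    by (rule fraction_pairsI[OF assms(1) grade_zero[OF gM assms(1)] assms(2,3)])
  moreover note zero_one_pair
  moreover have "1 \<odot> (1 \<odot> \<zero>) = 1 \<odot> (f \<odot> \<zero>)"
    using cox_grade_carrier[OF assms(2)] by (simp add: one_smult)
  ultimately show ?thesis by (intro fraction_eqI[OF _ _ units_one])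
qed

lemma fraction_eq_zeroD:
  assumes x: "d \<in> carrier G" "x \<in> grade M d"
    and eq: "fract M P x f = fract M P \<zero> 1" and f: "f \<in> carrier S"
  obtains h where "h \<in> units P" "h \<odot> x = \<zero>"
proof -
  from fraction_eqD[OF eq zero_one_pair] obtain h where h: "h \<in> units P"
      "h \<odot> (1 \<odot> x) = h \<odot> (f \<odot> \<zero>)" by blast
  then show ?thesis using that grade_carrier[OF x] units_carrier[OF h(1)] f by (simp add: one_smult)
qed

lemma fraction_eq_zeroI:
  assumes x: "d \<in> carrier G" "x \<in> grade M d" "f \<in> grade S d" "nonvanishing f P"
    and h: "h \<in> units P" "h \<odot> x = \<zero>"
  shows "fract M P x f = fract M P \<zero> 1"
proof -
  have "(x, f) \<in> pairs M P" by (rule fraction_pairsI[OF x])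
  moreover note zero_one_pair
  moreover have "h \<odot> (1 \<odot> x) = h \<odot> (f \<odot> \<zero>)"
    using h units_carrier[OF h(1)] grade_carrier[OF x(1,2)] cox_grade_carrier[OF x(3)] by (simp add: one_smult)
  ultimately show ?thesis by (intro fraction_eqI[OF _ _ h(1)])
qed

lemma stalk_add_fraction:
  assumes x: "d \<in> carrier G" "x \<in> grade M d" "f \<in> grade S d" "nonvanishing f P"
    and y: "e \<in> carrier G" "y \<in> grade M e" "g \<in> grade S e" "nonvanishing g P"
  shows "sadd M P (fract M P x f) (fract M P y g) =
     fract M P (g \<odot> x \<oplus> f \<odot> y) (f * g)"
proof -
  have sumpair: "(g \<odot> x \<oplus> f \<odot> y, f * g) \<in> pairs M P"
    if "d \<in> carrier G" "x \<in> grade M d" "f \<in> grade S d" "nonvanishing f P"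
       "e \<in> carrier G" "y \<in> grade M e" "g \<in> grade S e" "nonvanishing g P" for d x f e y g
  proof (rule fraction_pairsI)
    show "d \<cdot> e \<in> carrier G" "f * g \<in> grade S (d \<cdot> e)" "nonvanishing (f * g) P"
      using that cox_grade_mult nonvanishing_mult by auto
    have "g \<odot> x \<in> grade M (d \<cdot> e)" "f \<odot> y \<in> grade M (d \<cdot> e)"
      using smult_grade[of e d g x] smult_grade[of d e f y] that by (simp_all add: G.m_comm)
    then show "g \<odot> x \<oplus> f \<odot> y \<in> grade M (d \<cdot> e)"
      using grade_add[OF gM] that by simp
  qed
  have eq: "fract M P (g' \<odot> x' \<oplus> f' \<odot> y') (f' * g') =
      fract M P (g \<odot> x \<oplus> f \<odot> y) (f * g)"
    if x': "(x', f') \<in> fract M P x f" and y': "(y', g') \<in> fract M P y g" for x' f' y' g'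
  proof -
    obtain h1 where h1: "h1 \<in> units P" "h1 \<odot> (f' \<odot> x) = h1 \<odot> (f \<odot> x')"
      using x' by (auto simp: fraction_iff)
    obtain h2 where h2: "h2 \<in> units P" "h2 \<odot> (g' \<odot> y) = h2 \<odot> (g \<odot> y')"
      using y' by (auto simp: fraction_iff)
    have p': "(x', f') \<in> pairs M P" "(y', g') \<in> pairs M P"
      using x' y' by (auto simp: fraction_iff)
    obtain d' where d': "d' \<in> carrier G" "x' \<in> grade M d'" "f' \<in> grade S d'" "nonvanishing f' P"
      using p'(1) by (rule pairsE)
    obtain e' where e': "e' \<in> carrier G" "y' \<in> grade M e'" "g' \<in> grade S e'" "nonvanishing g' P"
      using p'(2) by (rule pairsE)
    note [simp] = smult_smult cox_carrier_mult M.smult_r_distr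
    have c: "x \<in> carrier M" "y \<in> carrier M" "x' \<in> carrier M" "y' \<in> carrier M"
      "f \<in> carrier S" "g \<in> carrier S" "f' \<in> carrier S" "g' \<in> carrier S" "h1 \<in> carrier S" "h2 \<in> carrier S"
      by (rule grade_carrier[OF x(1,2)] grade_carrier[OF y(1,2)] grade_carrier[OF d'(1,2)] grade_carrier[OF e'(1,2)]
        cox_grade_carrier[OF x(3)] cox_grade_carrier[OF y(3)] cox_grade_carrier[OF d'(3)]
        cox_grade_carrier[OF e'(3)] units_carrier[OF h1(1)] units_carrier[OF h2(1)])+
    have 1: "(h1 * h2 * (f * g) * g') \<odot> x' = (h1 * h2 * (f' * g') * g) \<odot> x"
    proof -
      have "(h1 * h2 * (f * g) * g') \<odot> x' = (h2 * g * g') \<odot> (h1 \<odot> (f \<odot> x'))"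
        using c by (simp add: mult_ac)
      also have "\<dots> = (h2 * g * g') \<odot> (h1 \<odot> (f' \<odot> x))" by (simp only: h1(2))
      finally show ?thesis using c by (simp add: mult_ac)
    qed
    have 2: "(h1 * h2 * (f * g) * f') \<odot> y' = (h1 * h2 * (f' * g') * f) \<odot> y"
    proof -
      have "(h1 * h2 * (f * g) * f') \<odot> y' = (h1 * f * f') \<odot> (h2 \<odot> (g \<odot> y'))"
        using c by (simp add: mult_ac)
      also have "\<dots> = (h1 * f * f') \<odot> (h2 \<odot> (g' \<odot> y))" by (simp only: h2(2))
      finally show ?thesis using c by (simp add: mult_ac)
    qed
    have "(h1 * h2) \<odot> ((f * g) \<odot> (g' \<odot> x' \<oplus> f' \<odot> y')) =
          (h1 * h2) \<odot> ((f' * g') \<odot> (g \<odot> x \<oplus> f \<odot> y))"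
      using c 1 2 by (simp add: mult.assoc)
    then show ?thesis
      by (rule fraction_eqI[OF sumpair[OF d' e'] sumpair[OF x y] units_mult[OF h1(1) h2(1)]])
  qed
  have xf: "(x, f) \<in> fract M P x f" and yg: "(y, g) \<in> fract M P y g"
    by (intro fraction_self fraction_pairsI[OF x] fraction_pairsI[OF y])+
  show ?thesis unfolding stalk_add_def
    by (rule UN_pair_const[OF xf], rule UN_pair_const[OF yg], rule eq)
qed

lemma stalk_smult_fraction:
  assumes r: "d \<in> carrier G" "r \<in> grade S d" "f \<in> grade S d" "nonvanishing f P"
    and y: "e \<in> carrier G" "y \<in> grade M e" "g \<in> grade S e" "nonvanishing g P"
  shows "ssmult M P (fract S P r f) (fract M P y g) =
     fract M P (r \<odot> y) (f * g)"
proof -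
  have pair: "(r \<odot> y, f * g) \<in> pairs M P"
    if "d \<in> carrier G" "r \<in> grade S d" "f \<in> grade S d" "nonvanishing f P"
       "e \<in> carrier G" "y \<in> grade M e" "g \<in> grade S e" "nonvanishing g P" for d r f e y g
    by (rule fraction_pairsI[of "d \<cdot> e"])
      (use that cox_grade_mult nonvanishing_mult smult_grade in auto)
  have eq: "fract M P (r' \<odot> y') (f' * g') = fract M P (r \<odot> y) (f * g)"
    if r': "(r', f') \<in> fract S P r f" and y': "(y', g') \<in> fract M P y g" for r' f' y' g'
  proof -
    obtain h1 where h1: "h1 \<in> units P" "h1 * (f' * r) = h1 * (f * r')"
      using r' by (auto simp: fraction_def units_def)
    obtain h2 where h2: "h2 \<in> units P" "h2 \<odot> (g' \<odot> y) = h2 \<odot> (g \<odot> y')"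
      using y' by (auto simp: fraction_iff)
    obtain d' where d': "d' \<in> carrier G" "r' \<in> grade S d'" "f' \<in> grade S d'" "nonvanishing f' P"
      using r' by (auto simp: fraction_def fraction_pairs_def)
    have "(y', g') \<in> pairs M P"
      using y' by (auto simp: fraction_iff)
    then obtain e' where e': "e' \<in> carrier G" "y' \<in> grade M e'" "g' \<in> grade S e'" "nonvanishing g' P"
      by (rule pairsE)
    note [simp] = smult_smult cox_carrier_mult
    have c: "r \<in> carrier S" "y \<in> carrier M" "r' \<in> carrier S" "y' \<in> carrier M"
      "f \<in> carrier S" "g \<in> carrier S" "f' \<in> carrier S" "g' \<in> carrier S" "h1 \<in> carrier S" "h2 \<in> carrier S"
      by (rule grade_carrier[OF y(1,2)] grade_carrier[OF e'(1,2)] cox_grade_carrier[OF r(2)] cox_grade_carrier[OF d'(2)]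
        cox_grade_carrier[OF r(3)] cox_grade_carrier[OF y(3)] cox_grade_carrier[OF d'(3)]
        cox_grade_carrier[OF e'(3)] units_carrier[OF h1(1)] units_carrier[OF h2(1)])+
    have "(h1 * h2) \<odot> ((f * g) \<odot> (r' \<odot> y')) = (h1 * (f * r')) \<odot> (h2 \<odot> (g \<odot> y'))"
      using c by (simp add: mult_ac)
    also have "\<dots> = (h1 * (f' * r)) \<odot> (h2 \<odot> (g' \<odot> y))" by (simp only: h1(2) h2(2))
    also have "\<dots> = (h1 * h2) \<odot> ((f' * g') \<odot> (r \<odot> y))"
      using c by (simp add: mult_ac)
    finally show ?thesis
      by (rule fraction_eqI[OF pair[OF d' e'] pair[OF r y] units_mult[OF h1(1) h2(1)]])
  qed
  have rf: "(r, f) \<in> fract S P r f"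
    unfolding fraction_def using fraction_pairsI[OF r] homogeneous_one nonvanishing_one by auto
  have yg: "(y, g) \<in> fract M P y g"
    by (intro fraction_self fraction_pairsI[OF y])
  show ?thesis unfolding stalk_smult_def
    by (rule UN_pair_const[OF rf], rule UN_pair_const[OF yg], rule eq)
qed

end

context toric begin

lemma tilde_map_fraction:
  assumes A: "toric_module L \<Delta> A" and B: "toric_module L \<Delta> B"
    and \<phi>: "graded_hom G S A B \<phi>"
    and x: "d \<in> carrier G" "x \<in> grade A d" "f \<in> grade S d" "U \<subseteq> \<D> f"
  shows "tmap B \<phi> U (sec A U x f) = sec B U (\<phi> x) f"
proof -
  interpret A: toric_module L \<Delta> A by fact
  interpret B: toric_module L \<Delta> B by fact
  have \<phi>h: "module_hom S A B \<phi>" and \<phi>g: "\<And>e y. e \<in> carrier G \<Longrightarrow> y \<in> grade A e \<Longrightarrow> \<phi> y \<in> grade B e"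
    using \<phi> by (auto simp: graded_hom_def)
  have eq: "fract B P (\<phi> y) g = fract B P (\<phi> x) f"
    if P: "P \<in> U" and y: "(y, g) \<in> fract A P x f" for P y g
  proof -
    have xp: "(x, f) \<in> pairs A P"
      using x P by (intro fraction_pairsI[OF x(1-3)]) (auto simp: basic_open_def)
    have yp: "(y, g) \<in> pairs A P" using y by (simp add: A.fraction_iff)
    obtain h where h: "h \<in> units P" "h \<odot>\<^bsub>A\<^esub> (g \<odot>\<^bsub>A\<^esub> x) = h \<odot>\<^bsub>A\<^esub> (f \<odot>\<^bsub>A\<^esub> y)"
      using y by (auto simp: A.fraction_iff)
    obtain e where e: "e \<in> carrier G" "y \<in> grade A e" "g \<in> grade S e" "nonvanishing g P"
      using yp by (rule A.pairsE)
    have c: "x \<in> carrier A" "y \<in> carrier A" "f \<in> carrier S" "g \<in> carrier S"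
      "h \<in> carrier S"
      by (rule A.grade_carrier[OF x(1,2)] A.grade_carrier[OF e(1,2)] cox_grade_carrier[OF x(3)] cox_grade_carrier[OF e(3)]
        units_carrier[OF h(1)])+
    have "h \<odot>\<^bsub>B\<^esub> (g \<odot>\<^bsub>B\<^esub> \<phi> x) = \<phi> (h \<odot>\<^bsub>A\<^esub> (g \<odot>\<^bsub>A\<^esub> x))"
      using c by (simp add: module_hom_smult[OF \<phi>h])
    also have "\<dots> = h \<odot>\<^bsub>B\<^esub> (f \<odot>\<^bsub>B\<^esub> \<phi> y)"
      unfolding h(2) using c by (simp add: module_hom_smult[OF \<phi>h])
    finally have "h \<odot>\<^bsub>B\<^esub> (f \<odot>\<^bsub>B\<^esub> \<phi> y) = h \<odot>\<^bsub>B\<^esub> (g \<odot>\<^bsub>B\<^esub> \<phi> x)" by simp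
    moreover have "nonvanishing f P" using x(4) P by (auto simp: basic_open_def)
    then have "(\<phi> x, f) \<in> pairs B P"
      by (rule fraction_pairsI[OF x(1) \<phi>g[OF x(1,2)] x(3)])
    moreover have "(\<phi> y, g) \<in> pairs B P"
      by (rule fraction_pairsI[OF e(1) \<phi>g[OF e(1,2)] e(3,4)])
    ultimately show ?thesis by (metis B.fraction_eqI h(1))
  qed
  show ?thesis
    unfolding tilde_map_def sec_def
  proof (rule restrict_ext)
    fix P assume P: "P \<in> U"
    have "(x, f) \<in> fract A P x f"
      using x P by (intro A.fraction_self fraction_pairsI[OF x(1-3)]) (auto simp: basic_open_def)
    from UN_pair_const[OF this eq[OF P]]
    show "(\<Union>(x, g)\<in>(\<lambda>Q\<in>U. fract A Q x f) P. fract B P (\<phi> x) g) = fract B P (\<phi> x) f"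
      using P by simp
  qed
qed

end

context toric_module begin

text \<open>
  Both \<open>w x / f\<close> and \<open>v r x / g\<close> have degree \<open>0\<close>, and a scalar of degree \<open>0\<close> takes one to the
  other. The scalar is a section of the structure sheaf near the point, so every morphism of sheaves
  respects this passage.
\<close>

lemma stalk_smult_transport:
  assumes G: "e \<in> carrier G" "c \<in> carrier G" "a \<in> carrier G" "b \<in> carrier G"
    and x: "x \<in> grade M e" and w: "w \<in> grade S c" and f: "f \<in> grade S (c \<cdot> e)"
    and r: "r \<in> grade S a" and v: "v \<in> grade S b" and g: "g \<in> grade S (b \<cdot> (a \<cdot> e))"
    and nv: "nonvanishing w Q" "nonvanishing f Q" "nonvanishing g Q"
  shows "ssmult M Q (fract S Q (v * r * f) (w * g)) (fract M Q (w \<odot> x) f) =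
     fract M Q ((v * r) \<odot> x) g"
proof -
  have ce: "c \<cdot> e \<in> carrier G" and ba: "b \<cdot> a \<in> carrier G" using G by auto
  have D: "c \<cdot> (b \<cdot> (a \<cdot> e)) = (b \<cdot> a) \<cdot> (c \<cdot> e)" using G by (simp add: G.m_ac)
  have vr: "v * r \<in> grade S (b \<cdot> a)" by (rule cox_grade_mult[OF v r])
  have num: "v * r * f \<in> grade S ((b \<cdot> a) \<cdot> (c \<cdot> e))" by (rule cox_grade_mult[OF vr f])
  have den: "w * g \<in> grade S ((b \<cdot> a) \<cdot> (c \<cdot> e))" using cox_grade_mult[OF w g] by (simp only: D)
  have wx: "w \<odot> x \<in> grade M (c \<cdot> e)" by (rule smult_grade[OF G(2,1) w x])
  have "ssmult M Q (fract S Q (v * r * f) (w * g)) (fract M Q (w \<odot> x) f) =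
     fract M Q ((v * r * f) \<odot> (w \<odot> x)) (w * g * f)"
    by (rule stalk_smult_fraction[OF G.m_closed[OF ba ce] num den nonvanishing_mult[OF nv(1,3)] ce wx f nv(2)])
  also have "(v * r * f) \<odot> (w \<odot> x) = (w * f) \<odot> ((v * r) \<odot> x)"
    using grade_carrier[OF G(1) x] w f vr[THEN cox_grade_carrier]
    by (simp add: smult_smult cox_carrier_mult cox_grade_carrier mult_ac)
  also have "w * g * f = (w * f) * g" by (simp add: mult_ac)
  also have "fract M Q ((w * f) \<odot> ((v * r) \<odot> x)) ((w * f) * g) = fract M Q ((v * r) \<odot> x) g"
  proof (rule fraction_cancel)
    show "(v * r) \<odot> x \<in> grade M (b \<cdot> (a \<cdot> e))"
      using smult_grade[OF ba G(1) vr x] G by (simp add: G.m_assoc)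
    show "w * f \<in> units Q"
      using units_mult[OF unitsI[OF homogeneousI[OF G(2) w] nv(1)] unitsI[OF homogeneousI[OF ce f] nv(2)]] .
  qed (use G g nv in auto)
  finally show ?thesis .
qed

lemma stalk_add_same_denominator:
  assumes d: "d \<in> carrier G" and xy: "x \<in> grade M d" "y \<in> grade M d" and f: "f \<in> grade S d" "nonvanishing f P"
  shows "sadd M P (fract M P x f) (fract M P y f) = fract M P (x \<oplus> y) f"
proof -
  have "sadd M P (fract M P x f) (fract M P y f) =
      fract M P (f \<odot> x \<oplus> f \<odot> y) (f * f)"
    by (rule stalk_add_fraction[OF d xy(1) f d xy(2) f])
  also have "f \<odot> x \<oplus> f \<odot> y = f \<odot> (x \<oplus> y)"
    using grade_carrier[OF d] xy cox_grade_carrier[OF f(1)] by (simp add: M.smult_r_distr)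
  also have "fract M P (f \<odot> (x \<oplus> y)) (f * f) = fract M P (x \<oplus> y) f"
    by (rule fraction_cancel[OF d grade_add[OF gM d xy] f unitsI[OF homogeneousI[OF d f(1)] f(2)]])
  finally show ?thesis .
qed

lemma sec_cancel:
  assumes x: "d \<in> carrier G" "x \<in> grade M d" "f \<in> grade S d" and g: "g \<in> homog"
    and U: "U \<subseteq> \<D> (g * f)"
  shows "sec M U (g \<odot> x) (g * f) = sec M U x f"
  unfolding sec_def
proof (rule restrict_ext)
  fix Q assume "Q \<in> U"
  then have "nonvanishing f Q" "nonvanishing g Q" using U by (auto simp: basic_open_def nonvanishing_mult_iff)
  then show "fract M Q (g \<odot> x) (g * f) = fract M Q x f"
    by (intro fraction_cancel[OF x] unitsI[OF g])
qed

end

context toric begin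

text \<open>
  A local preimage of the fraction is itself a fraction near the point; clearing the denominators
  in the equation between the two fractions gives a preimage of a multiple of the numerator.
\<close>

lemma image_of_locally_in_image:
  assumes A: "toric_module L \<Delta> A" and B: "toric_module L \<Delta> B"
    and \<phi>: "graded_hom G S A B \<phi>"
    and x: "d \<in> carrier G" "x \<in> grade B d" "f \<in> grade S d"
    and U: "U \<subseteq> \<D> f" "P \<in> U"
    and loc: "locally_in_image L \<Delta> (\<T> A) (tmap B \<phi>) U (sec B U x f)"
  obtains h where "h \<in> units P" "h \<odot>\<^bsub>B\<^esub> x \<in> \<phi> ` carrier A"
proof -
  interpret A: toric_module L \<Delta> A by fact
  interpret B: toric_module L \<Delta> B by fact
  have \<phi>h: "module_hom S A B \<phi>" using \<phi> by (simp add: graded_hom_def)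
  obtain V t where V: "zopen V" "P \<in> V" "V \<subseteq> U" and t: "t \<in> carrier (\<T> A V)"
      "tmap B \<phi> V t = restrict (sec B U x f) V"
    using loc U(2) unfolding locally_in_image_def by blast
  obtain V' y g e where V': "zopen V'" "P \<in> V'" "V' \<subseteq> V" "e \<in> carrier G"
    "y \<in> grade A e" "g \<in> grade S e" "V' \<subseteq> \<D> g"
    "restrict t V' = sec A V' y g"
    using tilde_sectionE[OF t(1) V(2)] .
  have "t P = sec A V' y g P" using V'(2,8) by (metis restrict_apply')
  then have "tmap B \<phi> V t P = tmap B \<phi> V' (sec A V' y g) P"
    using V(2) V'(2) by (simp add: tilde_map_def)
  also have "\<dots> = fract B P (\<phi> y) g"
    using V'(2) by (simp add: tilde_map_fraction[OF A B \<phi> V'(4-7)] sec_apply)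
  finally have eq: "fract B P (\<phi> y) g = fract B P x f"
    using t(2) V(2) U(2) by (simp add: sec_apply)
  have fP: "nonvanishing f P" and gP: "nonvanishing g P" using U V' by (auto simp: basic_open_def)
  obtain h where h: "h \<in> units P" "h \<odot>\<^bsub>B\<^esub> (f \<odot>\<^bsub>B\<^esub> \<phi> y) = h \<odot>\<^bsub>B\<^esub> (g \<odot>\<^bsub>B\<^esub> x)"
    using B.fraction_eqD[OF eq fraction_pairsI[OF x fP]] by blast
  have c: "x \<in> carrier B" "y \<in> carrier A" "f \<in> carrier S" "g \<in> carrier S"
      "h \<in> carrier S"
    by (rule B.grade_carrier[OF x(1,2)] A.grade_carrier[OF V'(4,5)] cox_grade_carrier[OF x(3)] cox_grade_carrier[OF V'(6)]
        units_carrier[OF h(1)])+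
  have "(h * g) \<odot>\<^bsub>B\<^esub> x = \<phi> (h \<odot>\<^bsub>A\<^esub> (f \<odot>\<^bsub>A\<^esub> y))"
    using h(2) c by (simp add: module_hom_smult[OF \<phi>h] B.smult_smult)
  then have "(h * g) \<odot>\<^bsub>B\<^esub> x \<in> \<phi> ` carrier A" using c by simp
  moreover have "h * g \<in> units P"
    by (rule units_mult[OF h(1) unitsI[OF homogeneousI[OF V'(4,6)] gP]])
  ultimately show ?thesis using that by blast
qed

text \<open>
  The numerator \<open>x\<close> has an arbitrary degree. For a suitable choice of \<open>w\<close> and \<open>f\<close>, both nonzero at
  the point, \<open>w x / f\<close> has degree \<open>0\<close> and is a section near the point, to which the exactness of the
  sheaves applies.
\<close>

lemma exact_at_point:
  assumes fan: "smooth_projective_fan L \<Delta>" and P: "P \<in> X"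
    and A: "toric_module L \<Delta> A" and B: "toric_module L \<Delta> B" and C: "toric_module L \<Delta> C"
    and \<phi>: "graded_hom G S A B \<phi>"
    and \<psi>: "graded_hom G S B C \<psi>"
    and ex: "sheaf_exact L \<Delta> (\<T> A) (\<T> B) (\<T> C) (tmap B \<phi>) (tmap C \<psi>)"
    and x: "e \<in> carrier G" "x \<in> grade B e" "\<psi> x = \<zero>\<^bsub>C\<^esub>"
  shows "\<exists>w\<in>units P. w \<odot>\<^bsub>B\<^esub> x \<in> \<phi> ` carrier A"
proof -
  interpret A: toric_module L \<Delta> A by fact
  interpret B: toric_module L \<Delta> B by fact
  interpret C: toric_module L \<Delta> C by fact
  obtain w f c where wf: "c \<in> carrier G" "w \<in> grade S c" "nonvanishing w P"
     "f \<in> grade S (c \<cdot> e)" "nonvanishing f P"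
    using degree_ratio_of_units[OF fan P x(1)] .
  have ce: "c \<cdot> e \<in> carrier G" using wf(1) x(1) by (rule G.m_closed)
  have wx: "w \<odot>\<^bsub>B\<^esub> x \<in> grade B (c \<cdot> e)" by (rule B.smult_grade[OF wf(1) x(1) wf(2) x(2)])
  let ?U = "\<D> f"
  have U: "zopen ?U" "P \<in> ?U"
    using basic_open_openin[OF homogeneousI[OF ce wf(4)]] P wf(5) by (auto simp: basic_open_def)
  have sec: "sec B ?U (w \<odot>\<^bsub>B\<^esub> x) f \<in> carrier (\<T> B ?U)"
    by (rule sec_carrier[OF ce wx wf(4) U(1) order_refl])
  have \<psi>h: "module_hom S B C \<psi>" using \<psi> by (simp add: graded_hom_def)
  have "\<psi> (w \<odot>\<^bsub>B\<^esub> x) = \<zero>\<^bsub>C\<^esub>"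
    using x B.grade_carrier[OF x(1,2)] cox_grade_carrier[OF wf(2)] by (simp add: module_hom_smult[OF \<psi>h])
  then have "tmap C \<psi> ?U (sec B ?U (w \<odot>\<^bsub>B\<^esub> x) f) = sec C ?U \<zero>\<^bsub>C\<^esub> f"
    using tilde_map_fraction[OF B C \<psi> ce wx wf(4) order_refl] by simp
  also have "\<dots> = \<zero>\<^bsub>\<T> C ?U\<^esub>"
    unfolding sec_def tilde_def ring.simps
    by (rule restrict_ext) (rule C.fraction_zero[OF ce wf(4)], simp add: basic_open_def)
  finally have "locally_in_image L \<Delta> (\<T> A) (tmap B \<phi>) ?U (sec B ?U (w \<odot>\<^bsub>B\<^esub> x) f)"
    using ex U(1) sec unfolding sheaf_exact_def by blast
  then obtain h where h: "h \<in> units P" "h \<odot>\<^bsub>B\<^esub> (w \<odot>\<^bsub>B\<^esub> x) \<in> \<phi> ` carrier A"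
    using image_of_locally_in_image[OF A B \<phi> ce wx wf(4) order_refl U(2)] by blast
  have "(h * w) \<odot>\<^bsub>B\<^esub> x \<in> \<phi> ` carrier A"
    using h(2) B.smult_smult[OF units_carrier[OF h(1)] cox_grade_carrier[OF wf(2)] B.grade_carrier[OF x(1,2)]] by simp
  moreover have "h * w \<in> units P"
    by (rule units_mult[OF h(1) unitsI[OF homogeneousI[OF wf(1,2)] wf(3)]])
  ultimately show ?thesis by blast
qed

end

section \<open>The augmentation at a point\<close>

locale augmentation_at_point = toric L \<Delta> + F: toric_module L \<Delta> F + M: toric_module L \<Delta> M
  for L :: "'v::real_vector set" and \<Delta> and F :: "(('v, 'k::field) cox_poly, 'f, 'v pic) graded"
    and M :: "(('v, 'k) cox_poly, 'm, 'v pic) graded" +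
  fixes \<epsilon> :: "('v, 'k) pt set \<Rightarrow> ('v, 'k, 'f) section_fun \<Rightarrow> ('v, 'k, 'm) section_fun"
    and P :: "('v, 'k) pt"
  assumes fan: "smooth_projective_fan L \<Delta>" and P: "P \<in> X" and \<epsilon>: "sheaf_hom L \<Delta> (\<T> F) (\<T> M) \<epsilon>"
begin

lemma \<epsilon>_restrict:
  "zopen U \<Longrightarrow> zopen V \<Longrightarrow> V \<subseteq> U \<Longrightarrow> s \<in> carrier (\<T> F U) \<Longrightarrow>
    \<epsilon> V (restrict s V) = restrict (\<epsilon> U s) V"
  using \<epsilon> unfolding sheaf_hom_def by blast

lemma \<epsilon>_hom: "zopen U \<Longrightarrow> module_hom (structure_sheaf L \<Delta> U) (\<T> F U) (\<T> M U) (\<epsilon> U)"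
  using \<epsilon> unfolding sheaf_hom_def by blast

lemma \<epsilon>_fraction_restrict:
  assumes x: "d \<in> carrier G" "x \<in> grade F d" "f \<in> grade S d"
    and U: "zopen U" "zopen V" "V \<subseteq> U" "U \<subseteq> \<D> f"
  shows "\<epsilon> V (sec F V x f) = restrict (\<epsilon> U (sec F U x f)) V"
  using \<epsilon>_restrict[OF U(1-3) sec_carrier[OF x U(1,4)]] by (simp add: sec_restrict[OF U(3)])

lemma \<epsilon>_fraction_local:
  assumes x: "d \<in> carrier G" "x \<in> grade F d" "f \<in> grade S d"
    and U: "zopen U" "zopen V" "V \<subseteq> U" "U \<subseteq> \<D> f" "P \<in> V"
  shows "\<epsilon> V (sec F V x f) P = \<epsilon> U (sec F U x f) P"
  using \<epsilon>_fraction_restrict[OF x U(1-4)] U(5) by simp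

text \<open>
  Both fractions are defined on the neighbourhood where \<open>f\<close>, \<open>g\<close> and \<open>w\<close> are nonzero. There the
  second one is a multiple of the first by a section of the structure sheaf, over which \<open>\<epsilon>\<close> is
  linear.
\<close>

lemma \<epsilon>_transport:
  assumes G: "e \<in> carrier G" "c \<in> carrier G" "a \<in> carrier G" "b \<in> carrier G"
    and x: "x \<in> grade F e" and m: "m \<in> grade M e"
    and w: "w \<in> grade S c" and f: "f \<in> grade S (c \<cdot> e)"
    and r: "r \<in> grade S a" and v: "v \<in> grade S b" and g: "g \<in> grade S (b \<cdot> (a \<cdot> e))"
    and nv: "nonvanishing w P" "nonvanishing f P" "nonvanishing g P"
    and eq: "\<epsilon> (\<D> f) (sec F (\<D> f) (w \<odot>\<^bsub>F\<^esub> x) f) P = fract M P (w \<odot>\<^bsub>M\<^esub> m) f"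
  shows "\<epsilon> (\<D> g) (sec F (\<D> g) ((v * r) \<odot>\<^bsub>F\<^esub> x) g) P = fract M P ((v * r) \<odot>\<^bsub>M\<^esub> m) g"
proof -
  have ce: "c \<cdot> e \<in> carrier G" and bae: "b \<cdot> (a \<cdot> e) \<in> carrier G" and ba: "b \<cdot> a \<in> carrier G"
    using G by (auto intro: G.m_closed)
  define U where "U = \<D> (f * (g * w))"
  have hom: "f \<in> homog" "g \<in> homog" "w \<in> homog"
    by (rule homogeneousI[OF ce f] homogeneousI[OF bae g] homogeneousI[OF G(2) w])+
  have U: "zopen U" unfolding U_def by (intro basic_open_openin homogeneous_mult hom)
  have Df: "zopen (\<D> f)" and Dg: "zopen (\<D> g)" by (intro basic_open_openin hom)+
  have PU: "P \<in> U" using P nv by (simp add: U_def basic_open_def nonvanishing_mult)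
  have sub: "U \<subseteq> \<D> f" "U \<subseteq> \<D> g" "U \<subseteq> \<D> w" by (auto simp: U_def basic_open_mult)
  have wx: "w \<odot>\<^bsub>F\<^esub> x \<in> grade F (c \<cdot> e)" by (rule F.smult_grade[OF G(2,1) w x])
  have vr: "v * r \<in> grade S (b \<cdot> a)" by (rule cox_grade_mult[OF v r])
  have vrx: "(v * r) \<odot>\<^bsub>F\<^esub> x \<in> grade F (b \<cdot> (a \<cdot> e))"
    using F.smult_grade[OF ba G(1) vr x] G by (simp add: G.m_assoc)
  have deg: "c \<cdot> (b \<cdot> (a \<cdot> e)) = (b \<cdot> a) \<cdot> (c \<cdot> e)" using G by (simp add: G.m_ac)
  define \<rho> where "\<rho> = sec S U (v * r * f) (w * g)"
  have \<rho>: "\<rho> \<in> carrier (structure_sheaf L \<Delta> U)"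
  proof -
    have "w * g \<in> grade S ((b \<cdot> a) \<cdot> (c \<cdot> e))" using cox_grade_mult[OF w g] by (simp only: deg)
    moreover have "U \<subseteq> \<D> (w * g)" using sub by (auto simp: basic_open_mult)
    ultimately have "\<rho> \<in> carrier (\<T> S U)"
      unfolding \<rho>_def
      by (intro sec_carrier[OF G.m_closed[OF ba ce] cox_grade_mult[OF vr f] _ U])
    then show ?thesis by (simp add: structure_sheaf_def Let_def)
  qed
  have nvQ: "nonvanishing w Q" "nonvanishing f Q" "nonvanishing g Q" if "Q \<in> U" for Q
    using that sub by (auto simp: basic_open_def)
  have "smult (\<T> F U) \<rho> (sec F U (w \<odot>\<^bsub>F\<^esub> x) f) = sec F U ((v * r) \<odot>\<^bsub>F\<^esub> x) g"
    unfolding tilde_def module.simps sec_def \<rho>_def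
  proof (rule restrict_ext)
    fix Q assume Q: "Q \<in> U"
    then show "ssmult F Q ((\<lambda>Q\<in>U. fract S Q (v * r * f) (w * g)) Q)
        ((\<lambda>Q\<in>U. fract F Q (w \<odot>\<^bsub>F\<^esub> x) f) Q) = fract F Q ((v * r) \<odot>\<^bsub>F\<^esub> x) g"
      using F.stalk_smult_transport[OF G x w f r v g nvQ[OF Q]] by simp
  qed
  moreover have "sec F U (w \<odot>\<^bsub>F\<^esub> x) f \<in> carrier (\<T> F U)"
    by (rule sec_carrier[OF ce wx f U sub(1)])
  ultimately have "\<epsilon> U (sec F U ((v * r) \<odot>\<^bsub>F\<^esub> x) g) = smult (\<T> M U) \<rho> (\<epsilon> U (sec F U (w \<odot>\<^bsub>F\<^esub> x) f))"
    using module_hom_smult[OF \<epsilon>_hom[OF U] \<rho>] by metis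
  then have "\<epsilon> U (sec F U ((v * r) \<odot>\<^bsub>F\<^esub> x) g) P =
      ssmult M P (fract S P (v * r * f) (w * g)) (\<epsilon> U (sec F U (w \<odot>\<^bsub>F\<^esub> x) f) P)"
    using PU by (simp add: tilde_def \<rho>_def sec_def)
  also have "\<epsilon> U (sec F U (w \<odot>\<^bsub>F\<^esub> x) f) P = fract M P (w \<odot>\<^bsub>M\<^esub> m) f"
    using \<epsilon>_fraction_local[OF ce wx f Df U sub(1) order_refl PU] eq by simp
  also have "ssmult M P (fract S P (v * r * f) (w * g)) (fract M P (w \<odot>\<^bsub>M\<^esub> m) f) =
      fract M P ((v * r) \<odot>\<^bsub>M\<^esub> m) g"
    by (rule M.stalk_smult_transport[OF G m w f r v g nv])
  finally show ?thesis using \<epsilon>_fraction_local[OF bae vrx g Dg U sub(2) order_refl PU] by simp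
qed

text \<open>
  Formally, \<open>rel e x m\<close> means that the stalk of \<open>\<epsilon>\<close> maps \<open>x\<close> to \<open>m\<close>. Since stalks consist of
  fractions of degree \<open>0\<close>, both are multiplied by some \<open>w / f\<close> of degree opposite to \<open>e\<close>.
\<close>

definition rel :: "'v pic \<Rightarrow> 'f \<Rightarrow> 'm \<Rightarrow> bool" where
  "rel e x m \<longleftrightarrow> e \<in> carrier G \<and> x \<in> grade F e \<and> m \<in> grade M e \<and>
     (\<exists>c w f. c \<in> carrier G \<and> w \<in> grade S c \<and> f \<in> grade S (c \<cdot> e) \<and> nonvanishing w P \<and> nonvanishing f P \<and>
        \<epsilon> (\<D> f) (sec F (\<D> f) (w \<odot>\<^bsub>F\<^esub> x) f) P = fract M P (w \<odot>\<^bsub>M\<^esub> m) f)"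

lemma relE:
  assumes "rel e x m"
  obtains c w f where "e \<in> carrier G" "x \<in> grade F e" "m \<in> grade M e" "c \<in> carrier G" "w \<in> grade S c"
    "f \<in> grade S (c \<cdot> e)" "nonvanishing w P" "nonvanishing f P"
    "\<epsilon> (\<D> f) (sec F (\<D> f) (w \<odot>\<^bsub>F\<^esub> x) f) P = fract M P (w \<odot>\<^bsub>M\<^esub> m) f"
  using assms unfolding rel_def by blast

lemma relI:
  assumes "e \<in> carrier G" "x \<in> grade F e" "m \<in> grade M e" "c \<in> carrier G" "w \<in> grade S c"
    "f \<in> grade S (c \<cdot> e)" "nonvanishing w P" "nonvanishing f P"
    "\<epsilon> (\<D> f) (sec F (\<D> f) (w \<odot>\<^bsub>F\<^esub> x) f) P = fract M P (w \<odot>\<^bsub>M\<^esub> m) f"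
  shows "rel e x m"
  using assms unfolding rel_def by blast

lemma rel_smult:
  assumes a: "a \<in> carrier G" and r: "r \<in> grade S a" and rel: "rel e x m"
  shows "rel (a \<cdot> e) (r \<odot>\<^bsub>F\<^esub> x) (r \<odot>\<^bsub>M\<^esub> m)"
proof -
  obtain c w f where e: "e \<in> carrier G" and x: "x \<in> grade F e" and m: "m \<in> grade M e" and c: "c \<in> carrier G"
    and w: "w \<in> grade S c" and f: "f \<in> grade S (c \<cdot> e)" and nv: "nonvanishing w P" "nonvanishing f P"
    and eq: "\<epsilon> (\<D> f) (sec F (\<D> f) (w \<odot>\<^bsub>F\<^esub> x) f) P = fract M P (w \<odot>\<^bsub>M\<^esub> m) f"
    using relE[OF rel] by metis
  have ae: "a \<cdot> e \<in> carrier G" using a e by (rule G.m_closed)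
  obtain v g b where v: "b \<in> carrier G" "v \<in> grade S b" "nonvanishing v P"
     "g \<in> grade S (b \<cdot> (a \<cdot> e))" "nonvanishing g P"
    using degree_ratio_of_units[OF fan P ae] .
  have "\<epsilon> (\<D> g) (sec F (\<D> g) ((v * r) \<odot>\<^bsub>F\<^esub> x) g) P = fract M P ((v * r) \<odot>\<^bsub>M\<^esub> m) g"
    by (rule \<epsilon>_transport[OF e c a v(1) x m w f r v(2,4) nv v(5) eq])
  then have "\<epsilon> (\<D> g) (sec F (\<D> g) (v \<odot>\<^bsub>F\<^esub> (r \<odot>\<^bsub>F\<^esub> x)) g) P = fract M P (v \<odot>\<^bsub>M\<^esub> (r \<odot>\<^bsub>M\<^esub> m)) g"
    using cox_grade_carrier[OF v(2)] cox_grade_carrier[OF r] F.grade_carrier[OF e x] M.grade_carrier[OF e m]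
    by (simp add: F.smult_smult M.smult_smult)
  then show ?thesis
    by (rule relI[OF ae F.smult_grade[OF a e r x] M.smult_grade[OF a e r m] v(1,2,4,3,5)])
qed

text \<open>
  The choice of the multiplier in the definition is immaterial, so that two pairs can be brought to the
  same multiplier and added.
\<close>

lemma rel_any_fraction:
  assumes rel: "rel e x m" and b: "b \<in> carrier G" "v \<in> grade S b" and g: "g \<in> grade S (b \<cdot> e)" "nonvanishing g P"
  shows "\<epsilon> (\<D> g) (sec F (\<D> g) (v \<odot>\<^bsub>F\<^esub> x) g) P = fract M P (v \<odot>\<^bsub>M\<^esub> m) g"
proof -
  obtain c w f where e: "e \<in> carrier G" and x: "x \<in> grade F e" and m: "m \<in> grade M e" and c: "c \<in> carrier G"
    and w: "w \<in> grade S c" and f: "f \<in> grade S (c \<cdot> e)" and nv: "nonvanishing w P" "nonvanishing f P"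
    and eq: "\<epsilon> (\<D> f) (sec F (\<D> f) (w \<odot>\<^bsub>F\<^esub> x) f) P = fract M P (w \<odot>\<^bsub>M\<^esub> m) f"
    using relE[OF rel] by metis
  have g': "g \<in> grade S (b \<cdot> (\<one>\<^bsub>G\<^esub> \<cdot> e))" using g e by simp
  show ?thesis
    using \<epsilon>_transport[OF e c G.one_closed b(1) x m w f cox_grade_one b(2) g' nv g(2) eq] by simp
qed

lemma rel_add:
  assumes "rel e x m" "rel e y n"
  shows "rel e (x \<oplus>\<^bsub>F\<^esub> y) (m \<oplus>\<^bsub>M\<^esub> n)"
proof -
  obtain c w f where e: "e \<in> carrier G" and x: "x \<in> grade F e" and m: "m \<in> grade M e" and c: "c \<in> carrier G"
    and w: "w \<in> grade S c" and f: "f \<in> grade S (c \<cdot> e)" and nv: "nonvanishing w P" "nonvanishing f P"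
    and eq: "\<epsilon> (\<D> f) (sec F (\<D> f) (w \<odot>\<^bsub>F\<^esub> x) f) P = fract M P (w \<odot>\<^bsub>M\<^esub> m) f"
    using relE[OF assms(1)] by metis
  have y: "y \<in> grade F e" and n: "n \<in> grade M e" using assms(2) by (auto simp: rel_def)
  have eq2: "\<epsilon> (\<D> f) (sec F (\<D> f) (w \<odot>\<^bsub>F\<^esub> y) f) P = fract M P (w \<odot>\<^bsub>M\<^esub> n) f"
    by (rule rel_any_fraction[OF assms(2) c w f nv(2)])
  have ce: "c \<cdot> e \<in> carrier G" using c e by (rule G.m_closed)
  have U: "zopen (\<D> f)" by (rule basic_open_openin[OF homogeneousI[OF ce f]])
  have PU: "P \<in> \<D> f" using P nv by (simp add: basic_open_def)
  have wx: "w \<odot>\<^bsub>F\<^esub> x \<in> grade F (c \<cdot> e)" and wy: "w \<odot>\<^bsub>F\<^esub> y \<in> grade F (c \<cdot> e)"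
    and wm: "w \<odot>\<^bsub>M\<^esub> m \<in> grade M (c \<cdot> e)" and wn: "w \<odot>\<^bsub>M\<^esub> n \<in> grade M (c \<cdot> e)"
    by (rule F.smult_grade[OF c e w x] F.smult_grade[OF c e w y] M.smult_grade[OF c e w m] M.smult_grade[OF c e w n])+
  have "sec F (\<D> f) (w \<odot>\<^bsub>F\<^esub> x) f \<oplus>\<^bsub>\<T> F (\<D> f)\<^esub> sec F (\<D> f) (w \<odot>\<^bsub>F\<^esub> y) f = sec F (\<D> f) (w \<odot>\<^bsub>F\<^esub> x \<oplus>\<^bsub>F\<^esub> w \<odot>\<^bsub>F\<^esub> y) f"
    unfolding tilde_def ring.simps sec_def
  proof (rule restrict_ext)
    fix Q assume Q: "Q \<in> \<D> f"
    then have "nonvanishing f Q" by (simp add: basic_open_def)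
    then show "sadd F Q ((\<lambda>Q\<in>\<D> f. fract F Q (w \<odot>\<^bsub>F\<^esub> x) f) Q) ((\<lambda>Q\<in>\<D> f. fract F Q (w \<odot>\<^bsub>F\<^esub> y) f) Q)
        = fract F Q (w \<odot>\<^bsub>F\<^esub> x \<oplus>\<^bsub>F\<^esub> w \<odot>\<^bsub>F\<^esub> y) f"
      using F.stalk_add_same_denominator[OF ce wx wy f] Q by simp
  qed
  moreover have "sec F (\<D> f) (w \<odot>\<^bsub>F\<^esub> x) f \<in> carrier (\<T> F (\<D> f))" "sec F (\<D> f) (w \<odot>\<^bsub>F\<^esub> y) f \<in> carrier (\<T> F (\<D> f))"
    by (rule sec_carrier[OF ce wx f U order_refl] sec_carrier[OF ce wy f U order_refl])+
  ultimately have "\<epsilon> (\<D> f) (sec F (\<D> f) (w \<odot>\<^bsub>F\<^esub> x \<oplus>\<^bsub>F\<^esub> w \<odot>\<^bsub>F\<^esub> y) f) =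
      \<epsilon> (\<D> f) (sec F (\<D> f) (w \<odot>\<^bsub>F\<^esub> x) f) \<oplus>\<^bsub>\<T> M (\<D> f)\<^esub> \<epsilon> (\<D> f) (sec F (\<D> f) (w \<odot>\<^bsub>F\<^esub> y) f)"
    using module_hom_add[OF \<epsilon>_hom[OF U]] by metis
  then have "\<epsilon> (\<D> f) (sec F (\<D> f) (w \<odot>\<^bsub>F\<^esub> x \<oplus>\<^bsub>F\<^esub> w \<odot>\<^bsub>F\<^esub> y) f) P =
      sadd M P (fract M P (w \<odot>\<^bsub>M\<^esub> m) f) (fract M P (w \<odot>\<^bsub>M\<^esub> n) f)"
    using PU by (simp add: tilde_def eq eq2)
  also have "\<dots> = fract M P (w \<odot>\<^bsub>M\<^esub> m \<oplus>\<^bsub>M\<^esub> w \<odot>\<^bsub>M\<^esub> n) f"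
    by (rule M.stalk_add_same_denominator[OF ce wm wn f nv(2)])
  finally have "\<epsilon> (\<D> f) (sec F (\<D> f) (w \<odot>\<^bsub>F\<^esub> (x \<oplus>\<^bsub>F\<^esub> y)) f) P = fract M P (w \<odot>\<^bsub>M\<^esub> (m \<oplus>\<^bsub>M\<^esub> n)) f"
    using cox_grade_carrier[OF w] F.grade_carrier[OF e] M.grade_carrier[OF e] x y m n
    by (simp add: F.M.smult_r_distr M.M.smult_r_distr)
  then show ?thesis
    by (rule relI[OF e grade_add[OF F.gM e x y] grade_add[OF M.gM e m n] c w f nv])
qed

text \<open>
  Cross-multiplication: \<open>\<epsilon> (x / f) = y / g\<close> gives \<open>\<epsilon> (g x) = f y\<close>.
\<close>

lemma rel_of_stalk_equation:
  assumes U: "zopen U" "P \<in> U" "U \<subseteq> \<D> f"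
    and x: "d \<in> carrier G" "x \<in> grade F d" "f \<in> grade S d"
    and y: "e \<in> carrier G" "y \<in> grade M e" "g \<in> grade S e" "nonvanishing g P"
    and eq: "\<epsilon> U (sec F U x f) P = fract M P y g"
  shows "rel (e \<cdot> d) (g \<odot>\<^bsub>F\<^esub> x) (f \<odot>\<^bsub>M\<^esub> y)"
proof -
  have ed: "e \<cdot> d \<in> carrier G" using y(1) x(1) by (rule G.m_closed)
  have fP: "nonvanishing f P" using U by (auto simp: basic_open_def)
  have gx: "g \<odot>\<^bsub>F\<^esub> x \<in> grade F (e \<cdot> d)" by (rule F.smult_grade[OF y(1) x(1) y(3) x(2)])
  have fy: "f \<odot>\<^bsub>M\<^esub> y \<in> grade M (e \<cdot> d)"
    using M.smult_grade[OF x(1) y(1) x(3) y(2)] x(1) y(1) by (simp add: G.m_comm)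
  have gf: "g * f \<in> grade S (e \<cdot> d)" by (rule cox_grade_mult[OF y(3) x(3)])
  have gh: "g \<in> homog" "f \<in> homog" by (rule homogeneousI[OF y(1,3)] homogeneousI[OF x(1,3)])+
  have Dgf: "zopen (\<D> (g * f))" by (intro basic_open_openin homogeneous_mult gh)
  let ?V = "\<D> (g * f) \<inter> U"
  have V: "zopen ?V" "P \<in> ?V"
    using openin_Int[OF Dgf U(1)] U(2) P fP y(4) by (auto simp: basic_open_def nonvanishing_mult)
  have "\<epsilon> (\<D> (g * f)) (sec F (\<D> (g * f)) (g \<odot>\<^bsub>F\<^esub> x) (g * f)) P = \<epsilon> ?V (sec F ?V (g \<odot>\<^bsub>F\<^esub> x) (g * f)) P"
    by (rule \<epsilon>_fraction_local[OF ed gx gf Dgf V(1) Int_lower1 order_refl V(2), symmetric])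
  also have "sec F ?V (g \<odot>\<^bsub>F\<^esub> x) (g * f) = sec F ?V x f"
    by (rule F.sec_cancel[OF x gh(1) Int_lower1])
  also have "\<epsilon> ?V (sec F ?V x f) P = \<epsilon> U (sec F U x f) P"
    by (rule \<epsilon>_fraction_local[OF x U(1) V(1) Int_lower2 U(3) V(2)])
  also have "\<dots> = fract M P (f \<odot>\<^bsub>M\<^esub> y) (f * g)"
    unfolding eq by (rule M.fraction_cancel[OF y unitsI[OF gh(2) fP], symmetric])
  finally have "\<epsilon> (\<D> (g * f)) (sec F (\<D> (g * f)) (1 \<odot>\<^bsub>F\<^esub> (g \<odot>\<^bsub>F\<^esub> x)) (g * f)) P = fract M P (1 \<odot>\<^bsub>M\<^esub> (f \<odot>\<^bsub>M\<^esub> y)) (g * f)"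
    using F.grade_carrier[OF ed gx] M.grade_carrier[OF ed fy] by (simp add: F.one_smult M.one_smult mult.commute)
  moreover have "g * f \<in> grade S (\<one>\<^bsub>G\<^esub> \<cdot> (e \<cdot> d))" using gf ed by simp
  ultimately show ?thesis
    by (intro relI[OF ed gx fy G.one_closed cox_grade_one _ nonvanishing_one nonvanishing_mult[OF y(4) fP]])
qed

lemma rel_total_left:
  assumes e: "e \<in> carrier G" and x: "x \<in> grade F e"
  shows "\<exists>w\<in>units P. \<exists>m c. rel c (w \<odot>\<^bsub>F\<^esub> x) m"
proof -
  obtain w f c where wf: "c \<in> carrier G" "w \<in> grade S c" "nonvanishing w P" "f \<in> grade S (c \<cdot> e)" "nonvanishing f P"
    using degree_ratio_of_units[OF fan P e] .
  have ce: "c \<cdot> e \<in> carrier G" using wf(1) e by (rule G.m_closed)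
  have wx: "w \<odot>\<^bsub>F\<^esub> x \<in> grade F (c \<cdot> e)" by (rule F.smult_grade[OF wf(1) e wf(2) x])
  have U: "zopen (\<D> f)" by (rule basic_open_openin[OF homogeneousI[OF ce wf(4)]])
  have PU: "P \<in> \<D> f" using P wf by (simp add: basic_open_def)
  have "\<epsilon> (\<D> f) (sec F (\<D> f) (w \<odot>\<^bsub>F\<^esub> x) f) \<in> carrier (\<T> M (\<D> f))"
    by (rule module_hom_closed[OF \<epsilon>_hom[OF U] sec_carrier[OF ce wx wf(4) U order_refl]])
  from tilde_sectionE[OF this PU] obtain V y g d where V: "zopen V" "P \<in> V" "V \<subseteq> \<D> f" "d \<in> carrier G"
    "y \<in> grade M d" "g \<in> grade S d" "V \<subseteq> \<D> g"
    "restrict (\<epsilon> (\<D> f) (sec F (\<D> f) (w \<odot>\<^bsub>F\<^esub> x) f)) V = sec M V y g" .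
  have gP: "nonvanishing g P" using V by (auto simp: basic_open_def)
  have "\<epsilon> (\<D> f) (sec F (\<D> f) (w \<odot>\<^bsub>F\<^esub> x) f) P = fract M P y g"
    using V(2,8) by (metis sec_apply restrict_apply')
  then have "rel (d \<cdot> (c \<cdot> e)) (g \<odot>\<^bsub>F\<^esub> (w \<odot>\<^bsub>F\<^esub> x)) (f \<odot>\<^bsub>M\<^esub> y)"
    by (rule rel_of_stalk_equation[OF U PU order_refl ce wx wf(4) V(4-6) gP])
  then have "rel (d \<cdot> (c \<cdot> e)) ((g * w) \<odot>\<^bsub>F\<^esub> x) (f \<odot>\<^bsub>M\<^esub> y)"
    using cox_grade_carrier[OF V(6)] cox_grade_carrier[OF wf(2)] F.grade_carrier[OF e x] by (simp add: F.smult_smult)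
  moreover have "g * w \<in> units P"
    by (intro units_mult unitsI homogeneousI[OF V(4,6)] homogeneousI[OF wf(1,2)] gP wf(3))
  ultimately show ?thesis by blast
qed

text \<open>
  Surjectivity provides a local preimage of \<open>w m / f\<close>, which is again a fraction.
\<close>

lemma rel_total_right:
  assumes surj: "sheaf_surjective L \<Delta> (\<T> F) (\<T> M) \<epsilon>"
    and e: "e \<in> carrier G" and m: "m \<in> grade M e"
  shows "\<exists>w\<in>units P. \<exists>x c. rel c x (w \<odot>\<^bsub>M\<^esub> m)"
proof -
  obtain w f c where wf: "c \<in> carrier G" "w \<in> grade S c" "nonvanishing w P" "f \<in> grade S (c \<cdot> e)" "nonvanishing f P"
    using degree_ratio_of_units[OF fan P e] .
  have ce: "c \<cdot> e \<in> carrier G" using wf(1) e by (rule G.m_closed)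
  have wm: "w \<odot>\<^bsub>M\<^esub> m \<in> grade M (c \<cdot> e)" by (rule M.smult_grade[OF wf(1) e wf(2) m])
  have U: "zopen (\<D> f)" by (rule basic_open_openin[OF homogeneousI[OF ce wf(4)]])
  have PU: "P \<in> \<D> f" using P wf by (simp add: basic_open_def)
  have "locally_in_image L \<Delta> (\<T> F) \<epsilon> (\<D> f) (sec M (\<D> f) (w \<odot>\<^bsub>M\<^esub> m) f)"
    using surj U sec_carrier[OF ce wm wf(4) U order_refl] unfolding sheaf_surjective_def by blast
  then obtain V t where V: "zopen V" "P \<in> V" "V \<subseteq> \<D> f" and t: "t \<in> carrier (\<T> F V)"
      "\<epsilon> V t = restrict (sec M (\<D> f) (w \<odot>\<^bsub>M\<^esub> m) f) V"
    using PU unfolding locally_in_image_def by blast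
  obtain V' x g d where V': "zopen V'" "P \<in> V'" "V' \<subseteq> V" "d \<in> carrier G"
    "x \<in> grade F d" "g \<in> grade S d" "V' \<subseteq> \<D> g" "restrict t V' = sec F V' x g"
    using tilde_sectionE[OF t(1) V(2)] .
  have gP: "nonvanishing g P" using V' by (auto simp: basic_open_def)
  have "\<epsilon> V' (sec F V' x g) P = \<epsilon> V t P"
    using \<epsilon>_restrict[OF V(1) V'(1,3) t(1)] V'(2,8) by simp
  also have "\<dots> = fract M P (w \<odot>\<^bsub>M\<^esub> m) f"
    using V(2) PU by (simp add: t(2) sec_apply)
  finally have "rel ((c \<cdot> e) \<cdot> d) (f \<odot>\<^bsub>F\<^esub> x) (g \<odot>\<^bsub>M\<^esub> (w \<odot>\<^bsub>M\<^esub> m))"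
    by (rule rel_of_stalk_equation[OF V'(1,2,7,4-6) ce wm wf(4,5)])
  then have "rel ((c \<cdot> e) \<cdot> d) (f \<odot>\<^bsub>F\<^esub> x) ((g * w) \<odot>\<^bsub>M\<^esub> m)"
    using cox_grade_carrier[OF V'(6)] cox_grade_carrier[OF wf(2)] M.grade_carrier[OF e m] by (simp add: M.smult_smult)
  moreover have "g * w \<in> units P"
    by (intro units_mult unitsI homogeneousI[OF V'(4,6)] homogeneousI[OF wf(1,2)] gP wf(3))
  ultimately show ?thesis by blast
qed

text \<open>
  The fraction \<open>0 / f\<close> is the multiple of itself by the scalar \<open>0\<close>, so \<open>\<epsilon>\<close> maps it to zero.
\<close>

lemma rel_left_zero:
  assumes "rel e \<zero>\<^bsub>F\<^esub> m"
  shows "\<exists>w\<in>units P. w \<odot>\<^bsub>M\<^esub> m = \<zero>\<^bsub>M\<^esub>"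
proof -
  obtain c w f where e: "e \<in> carrier G" and x: "\<zero>\<^bsub>F\<^esub> \<in> grade F e" and m: "m \<in> grade M e" and c: "c \<in> carrier G"
    and w: "w \<in> grade S c" and f: "f \<in> grade S (c \<cdot> e)" and nv: "nonvanishing w P" "nonvanishing f P"
    and eq: "\<epsilon> (\<D> f) (sec F (\<D> f) (w \<odot>\<^bsub>F\<^esub> \<zero>\<^bsub>F\<^esub>) f) P = fract M P (w \<odot>\<^bsub>M\<^esub> m) f"
    using relE[OF assms] by metis
  have ce: "c \<cdot> e \<in> carrier G" using c e by (rule G.m_closed)
  have wm: "w \<odot>\<^bsub>M\<^esub> m \<in> grade M (c \<cdot> e)" by (rule M.smult_grade[OF c e w m])
  have wS: "w \<in> carrier S" by (rule cox_grade_carrier[OF w])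
  have f': "f \<in> grade S (c \<cdot> (\<one>\<^bsub>G\<^esub> \<cdot> e))" using f e by simp
  have "\<epsilon> (\<D> f) (sec F (\<D> f) ((w * 0) \<odot>\<^bsub>F\<^esub> \<zero>\<^bsub>F\<^esub>) f) P = fract M P ((w * 0) \<odot>\<^bsub>M\<^esub> m) f"
    by (rule \<epsilon>_transport[OF e c G.one_closed c x m w f cox_grade_zero w f' nv nv(2) eq])
  moreover have "(w * 0) \<odot>\<^bsub>F\<^esub> \<zero>\<^bsub>F\<^esub> = w \<odot>\<^bsub>F\<^esub> \<zero>\<^bsub>F\<^esub>" "(w * 0) \<odot>\<^bsub>M\<^esub> m = \<zero>\<^bsub>M\<^esub>"
    using F.M.smult_l_null[of "\<zero>\<^bsub>F\<^esub>"] M.M.smult_l_null[OF M.grade_carrier[OF e m]] F.M.smult_r_null[OF wS] by simp_all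
  ultimately have "fract M P (w \<odot>\<^bsub>M\<^esub> m) f = fract M P \<zero>\<^bsub>M\<^esub> f" using eq by simp
  also have "\<dots> = fract M P \<zero>\<^bsub>M\<^esub> 1" by (rule M.fraction_zero[OF ce f nv(2)])
  finally obtain h where h: "h \<in> units P" "h \<odot>\<^bsub>M\<^esub> (w \<odot>\<^bsub>M\<^esub> m) = \<zero>\<^bsub>M\<^esub>"
    using M.fraction_eq_zeroD[OF ce wm _ cox_grade_carrier[OF f]] by blast
  have "(h * w) \<odot>\<^bsub>M\<^esub> m = \<zero>\<^bsub>M\<^esub>"
    using h(2) M.smult_smult[OF units_carrier[OF h(1)] wS M.grade_carrier[OF e m]] by simp
  then show ?thesis using units_mult[OF h(1) unitsI[OF homogeneousI[OF c w] nv(1)]] by blast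
qed

text \<open>
  The hypothesis only concerns the stalk at \<open>P\<close>. The image of \<open>w x / f\<close> is a fraction \<open>y / g\<close> near
  \<open>P\<close> which is zero at \<open>P\<close>; the polynomial \<open>h\<close> that annihilates \<open>y\<close> is nonzero on a whole
  neighbourhood, where exactness of sheaves applies.
\<close>

lemma rel_right_zero:
  assumes A: "toric_module L \<Delta> A" and \<phi>: "graded_hom G S A F \<phi>"
    and ex: "sheaf_exact L \<Delta> (\<T> A) (\<T> F) (\<T> M) (tmap F \<phi>) \<epsilon>"
    and rel: "rel e x \<zero>\<^bsub>M\<^esub>"
  shows "\<exists>w\<in>units P. w \<odot>\<^bsub>F\<^esub> x \<in> \<phi> ` carrier A"
proof -
  obtain c w f where e: "e \<in> carrier G" and x: "x \<in> grade F e" and c: "c \<in> carrier G"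
    and w: "w \<in> grade S c" and f: "f \<in> grade S (c \<cdot> e)" and nv: "nonvanishing w P" "nonvanishing f P"
    and eq: "\<epsilon> (\<D> f) (sec F (\<D> f) (w \<odot>\<^bsub>F\<^esub> x) f) P = fract M P (w \<odot>\<^bsub>M\<^esub> \<zero>\<^bsub>M\<^esub>) f"
    using relE[OF rel] by metis
  have ce: "c \<cdot> e \<in> carrier G" using c e by (rule G.m_closed)
  have wx: "w \<odot>\<^bsub>F\<^esub> x \<in> grade F (c \<cdot> e)" by (rule F.smult_grade[OF c e w x])
  have wS: "w \<in> carrier S" by (rule cox_grade_carrier[OF w])
  have U: "zopen (\<D> f)" by (rule basic_open_openin[OF homogeneousI[OF ce f]])
  have PU: "P \<in> \<D> f" using P nv by (simp add: basic_open_def)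
  let ?s = "sec F (\<D> f) (w \<odot>\<^bsub>F\<^esub> x) f"
  have "\<epsilon> (\<D> f) ?s \<in> carrier (\<T> M (\<D> f))"
    by (rule module_hom_closed[OF \<epsilon>_hom[OF U] sec_carrier[OF ce wx f U order_refl]])
  from tilde_sectionE[OF this PU] obtain V y g d where V: "zopen V" "P \<in> V" "V \<subseteq> \<D> f" "d \<in> carrier G"
    "y \<in> grade M d" "g \<in> grade S d" "V \<subseteq> \<D> g" "restrict (\<epsilon> (\<D> f) ?s) V = sec M V y g" .
  have "fract M P y g = \<epsilon> (\<D> f) ?s P"
    using V(2,8) by (metis sec_apply restrict_apply')
  also have "\<dots> = fract M P \<zero>\<^bsub>M\<^esub> 1"
    using M.fraction_zero[OF ce f nv(2)] M.M.smult_r_null[OF wS] by (simp add: eq)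
  finally obtain h where h: "h \<in> units P" "h \<odot>\<^bsub>M\<^esub> y = \<zero>\<^bsub>M\<^esub>"
    using M.fraction_eq_zeroD[OF V(4,5) _ cox_grade_carrier[OF V(6)]] by blast
  let ?V = "V \<inter> \<D> h"
  have V2: "zopen ?V" "P \<in> ?V" "?V \<subseteq> \<D> f"
    using openin_Int[OF V(1) basic_open_openin[OF unitsD(1)[OF h(1)]]] V P unitsD(2)[OF h(1)]
    by (auto simp: basic_open_def)
  have "\<epsilon> ?V (sec F ?V (w \<odot>\<^bsub>F\<^esub> x) f) = restrict (\<epsilon> (\<D> f) ?s) ?V"
    by (rule \<epsilon>_fraction_restrict[OF ce wx f U V2(1,3) order_refl])
  also have "\<dots> = restrict (restrict (\<epsilon> (\<D> f) ?s) V) ?V" by (simp add: Int_absorb1)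
  also have "\<dots> = sec M ?V y g" by (simp add: V(8) sec_restrict)
  also have "\<dots> = \<zero>\<^bsub>\<T> M ?V\<^esub>"
    unfolding sec_def tilde_def ring.simps
  proof (rule restrict_ext)
    fix Q assume "Q \<in> ?V"
    then have "nonvanishing g Q" "h \<in> units Q"
      using V(7) unitsD(1)[OF h(1)] by (auto simp: basic_open_def intro: unitsI)
    then show "fract M Q y g = fract M Q \<zero>\<^bsub>M\<^esub> 1"
      by (rule M.fraction_eq_zeroI[OF V(4-6) _ _ h(2)])
  qed
  finally have "locally_in_image L \<Delta> (\<T> A) (tmap F \<phi>) ?V (sec F ?V (w \<odot>\<^bsub>F\<^esub> x) f)"
    using ex V2(1) sec_carrier[OF ce wx f V2(1,3)] unfolding sheaf_exact_def by blast
  then obtain h' where h': "h' \<in> units P" "h' \<odot>\<^bsub>F\<^esub> (w \<odot>\<^bsub>F\<^esub> x) \<in> \<phi> ` carrier A"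
    using image_of_locally_in_image[OF A F.toric_module_axioms \<phi> ce wx f V2(3,2)] by blast
  have "(h' * w) \<odot>\<^bsub>F\<^esub> x \<in> \<phi> ` carrier A"
    using h'(2) F.smult_smult[OF units_carrier[OF h'(1)] wS F.grade_carrier[OF e x]] by simp
  then show ?thesis using units_mult[OF h'(1) unitsI[OF homogeneousI[OF c w] nv(1)]] by blast
qed

lemma rel_image:
  assumes A: "toric_module L \<Delta> A" and \<phi>: "graded_hom G S A F \<phi>"
    and ex: "sheaf_exact L \<Delta> (\<T> A) (\<T> F) (\<T> M) (tmap F \<phi>) \<epsilon>"
    and e: "e \<in> carrier G" and y: "y \<in> grade A e"
  shows "rel e (\<phi> y) \<zero>\<^bsub>M\<^esub>"
proof -
  interpret A: toric_module L \<Delta> A by fact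
  have \<phi>h: "module_hom S A F \<phi>" and \<phi>y: "\<phi> y \<in> grade F e" using \<phi> e y by (auto simp: graded_hom_def)
  obtain w f c where wf: "c \<in> carrier G" "w \<in> grade S c" "nonvanishing w P" "f \<in> grade S (c \<cdot> e)" "nonvanishing f P"
    using degree_ratio_of_units[OF fan P e] .
  have ce: "c \<cdot> e \<in> carrier G" using wf(1) e by (rule G.m_closed)
  have wy: "w \<odot>\<^bsub>A\<^esub> y \<in> grade A (c \<cdot> e)" by (rule A.smult_grade[OF wf(1) e wf(2) y])
  have wx: "w \<odot>\<^bsub>F\<^esub> \<phi> y \<in> grade F (c \<cdot> e)" by (rule F.smult_grade[OF wf(1) e wf(2) \<phi>y])
  have wS: "w \<in> carrier S" by (rule cox_grade_carrier[OF wf(2)])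
  have U: "zopen (\<D> f)" by (rule basic_open_openin[OF homogeneousI[OF ce wf(4)]])
  have PU: "P \<in> \<D> f" using P wf by (simp add: basic_open_def)
  let ?s = "sec F (\<D> f) (w \<odot>\<^bsub>F\<^esub> \<phi> y) f"
  have "tmap F \<phi> (\<D> f) (sec A (\<D> f) (w \<odot>\<^bsub>A\<^esub> y) f) = ?s"
    using tilde_map_fraction[OF A F.toric_module_axioms \<phi> ce wy wf(4) order_refl]
      module_hom_smult[OF \<phi>h wS A.grade_carrier[OF e y]] by simp
  moreover have "restrict ?s (\<D> f) = ?s" by (rule sec_restrict[OF order_refl])
  ultimately have "locally_in_image L \<Delta> (\<T> A) (tmap F \<phi>) (\<D> f) ?s"
    unfolding locally_in_image_def
    using U sec_carrier[OF ce wy wf(4) U order_refl] by (metis order_refl)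
  then have "\<epsilon> (\<D> f) ?s = \<zero>\<^bsub>\<T> M (\<D> f)\<^esub>"
    using ex U sec_carrier[OF ce wx wf(4) U order_refl] unfolding sheaf_exact_def by blast
  then have "\<epsilon> (\<D> f) ?s P = fract M P \<zero>\<^bsub>M\<^esub> 1" using tilde_zero_apply[OF PU] by simp
  also have "\<dots> = fract M P (w \<odot>\<^bsub>M\<^esub> \<zero>\<^bsub>M\<^esub>) f"
    using M.fraction_zero[OF ce wf(4,5)] M.M.smult_r_null[OF wS] by simp
  finally show ?thesis
    by (rule relI[OF e \<phi>y grade_zero[OF M.gM e] wf(1,2,4,3,5)])
qed

sublocale homogeneous_relation G S F M rel
proof
  show "graded_module G S F" "graded_module G S M" by (rule F.gM M.gM)+
  show "rel e x m \<Longrightarrow> e \<in> carrier G \<and> x \<in> grade F e \<and> m \<in> grade M e" for e x m by (simp add: rel_def)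
  show "c \<in> carrier G \<Longrightarrow> grade S c \<subseteq> carrier S" for c using cox_grade_carrier by blast
  show "Q r" if "Q \<zero>\<^bsub>S\<^esub>" "\<And>c s t. c \<in> carrier G \<Longrightarrow> s \<in> grade S c \<Longrightarrow> t \<in> carrier S \<Longrightarrow> Q t \<Longrightarrow> Q (s \<oplus>\<^bsub>S\<^esub> t)"
      "r \<in> carrier S" for Q r
    by (rule cox_homogeneous_induct[of Q]) (use that in simp_all)
qed (rule rel_add rel_smult; assumption)+

end

section \<open>Vanishing of an associated sheaf\<close>

context toric begin

text \<open>
  An annihilating denominator makes all fractions at a point equal, so that each stalk is a single
  class.
\<close>

lemma sheaf_zero_if_annihilated:
  fixes E :: "(('v, 'k::field) cox_poly, 'm, 'v pic) graded"
  assumes zero: "\<zero>\<^bsub>E\<^esub> \<in> grade E \<one>\<^bsub>G\<^esub>"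
    and sub: "\<And>d. d \<in> carrier G \<Longrightarrow> grade E d \<subseteq> carrier E"
    and ann: "\<And>P. P \<in> X \<Longrightarrow> \<exists>h\<in>units P.
        \<forall>r\<in>carrier S. \<forall>x\<in>carrier E. h \<odot>\<^bsub>E\<^esub> (r \<odot>\<^bsub>E\<^esub> x) = \<zero>\<^bsub>E\<^esub>"
  shows "sheaf_zero L \<Delta> (\<T> E)"
proof -
  have all: "fract E P x f = pairs E P"
    if P: "P \<in> X" and xf: "(x, f) \<in> pairs E P" for P x f
  proof -
    obtain h where h: "h \<in> units P"
        "\<forall>r\<in>carrier S. \<forall>x\<in>carrier E. h \<odot>\<^bsub>E\<^esub> (r \<odot>\<^bsub>E\<^esub> x) = \<zero>\<^bsub>E\<^esub>"
      using ann[OF P] by blast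
    have c: "x \<in> carrier E" "f \<in> carrier S" if p: "(x, f) \<in> pairs E P" for x f
    proof -
      obtain d where "d \<in> carrier G" "x \<in> grade E d" "f \<in> grade S d"
        using p by (auto simp: fraction_pairs_def)
      then show "x \<in> carrier E" "f \<in> carrier S" using sub cox_grade_carrier by blast+
    qed
    show ?thesis
    proof (intro equalityI subsetI)
      fix p assume p: "p \<in> pairs E P"
      obtain y g where [simp]: "p = (y, g)" by (cases p)
      have "h \<odot>\<^bsub>E\<^esub> (g \<odot>\<^bsub>E\<^esub> x) = h \<odot>\<^bsub>E\<^esub> (f \<odot>\<^bsub>E\<^esub> y)"
        using h(2) c[OF xf] c[of y g] p by simp
      then show "p \<in> fract E P x f"
        using p unitsD[OF h(1)] by (auto simp: fraction_def)
    qed (auto simp: fraction_def)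
  qed
  have z1: "(\<zero>\<^bsub>E\<^esub>, 1) \<in> pairs E P" for P
    by (rule fraction_pairsI[OF G.one_closed zero cox_grade_one nonvanishing_one])
  show ?thesis
    unfolding sheaf_zero_def
  proof (intro allI impI equalityI subsetI)
    fix U s assume U: "openin (zariski L \<Delta> :: ('v, 'k) pt topology) U" and s: "s \<in> carrier (\<T> E U)"
    have "s P = fract E P \<zero>\<^bsub>E\<^esub> 1" if P: "P \<in> U" for P
    proof -
      have PX: "P \<in> X" using zariski_open_subset[OF U] P by auto
      obtain V x f where "P \<in> V" "\<forall>Q\<in>V. (x, f) \<in> pairs E Q \<and> s Q = fract E Q x f"
        using s P unfolding tilde_carrier_iff by meson
      then show ?thesis using all[OF PX] z1 by simp
    qed
    moreover have "s \<in> extensional U" using s unfolding tilde_carrier_iff by blast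
    ultimately have "s = \<zero>\<^bsub>\<T> E U\<^esub>"
      by (intro extensionalityI[of s U]) (auto simp: tilde_def)
    then show "s \<in> {\<zero>\<^bsub>\<T> E U\<^esub>}" by simp
  next
    fix U s assume U: "openin (zariski L \<Delta> :: ('v, 'k) pt topology) U" and s: "s \<in> {\<zero>\<^bsub>\<T> E U\<^esub>}"
    have "U \<subseteq> \<D> 1" using zariski_open_subset[OF U] nonvanishing_one by (auto simp: basic_open_def)
    then have "sec E U \<zero>\<^bsub>E\<^esub> 1 \<in> carrier (\<T> E U)"
      by (rule sec_carrier[OF G.one_closed zero cox_grade_one U])
    then show "s \<in> carrier (\<T> E U)" using s by (simp add: tilde_def sec_def)
  qed
qed

end

section \<open>Annihilated subquotients\<close>

text \<open>
  The hypotheses on scalars make their action on cosets of \<open>I\<close> well defined; the last one says that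
  \<open>h\<close> acts as zero on the subquotient.
\<close>

locale subquotient_annihilation =
  fixes R :: "('a, 'a, 'g) graded" and C :: "('a, 'm, 'g) graded" and K I :: "'m set" and h :: 'a
  assumes C: "abelian_group C"
    and sm_closed: "\<And>r x. r \<in> carrier R \<Longrightarrow> x \<in> carrier C \<Longrightarrow> r \<odot>\<^bsub>C\<^esub> x \<in> carrier C"
    and sm_add: "\<And>r x y. r \<in> carrier R \<Longrightarrow> x \<in> carrier C \<Longrightarrow> y \<in> carrier C \<Longrightarrow>
        r \<odot>\<^bsub>C\<^esub> (x \<oplus>\<^bsub>C\<^esub> y) = r \<odot>\<^bsub>C\<^esub> x \<oplus>\<^bsub>C\<^esub> r \<odot>\<^bsub>C\<^esub> y"
    and K: "K \<subseteq> carrier C" and K_sm: "\<And>r x. r \<in> carrier R \<Longrightarrow> x \<in> K \<Longrightarrow> r \<odot>\<^bsub>C\<^esub> x \<in> K"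
    and I: "subgroup I (add_monoid C)" and I_sm: "\<And>r x. r \<in> carrier R \<Longrightarrow> x \<in> I \<Longrightarrow> r \<odot>\<^bsub>C\<^esub> x \<in> I"
    and h: "h \<in> carrier R" and ann: "\<And>x. x \<in> K \<Longrightarrow> h \<odot>\<^bsub>C\<^esub> x \<in> I"
begin

sublocale C: abelian_group C by (rule C)

lemma I_carrier: "x \<in> I \<Longrightarrow> x \<in> carrier C"
  using subgroup.subset[OF I] by auto

lemma coset_join: "x \<in> I \<Longrightarrow> I +>\<^bsub>C\<^esub> x = I"
  using C.add.coset_join2[OF _ I] I_carrier by (simp add: a_r_coset_def)

lemma coset_mem: "y \<in> I +>\<^bsub>C\<^esub> x \<Longrightarrow> \<exists>i\<in>I. y = i \<oplus>\<^bsub>C\<^esub> x"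
  by (auto simp: a_r_coset_def r_coset_def)

lemma coset_self: "x \<in> carrier C \<Longrightarrow> x \<in> I +>\<^bsub>C\<^esub> x"
  using C.add.rcos_self[OF _ I] by (simp add: a_r_coset_def)

lemma coset_add: "i \<in> I \<Longrightarrow> x \<in> carrier C \<Longrightarrow> I +>\<^bsub>C\<^esub> (i \<oplus>\<^bsub>C\<^esub> x) = I +>\<^bsub>C\<^esub> x"
  using C.add.repr_independence[OF _ _ I, of "i \<oplus>\<^bsub>C\<^esub> x" x] by (auto simp: a_r_coset_def r_coset_def)

lemma subquotient_smult:
  assumes r: "r \<in> carrier R" and x: "x \<in> K"
  shows "r \<odot>\<^bsub>subquotient C K I\<^esub> (I +>\<^bsub>C\<^esub> x) = I +>\<^bsub>C\<^esub> (r \<odot>\<^bsub>C\<^esub> x)"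
proof -
  have xC: "x \<in> carrier C" using x K by auto
  have "I +>\<^bsub>C\<^esub> (r \<odot>\<^bsub>C\<^esub> y) = I +>\<^bsub>C\<^esub> (r \<odot>\<^bsub>C\<^esub> x)" if y: "y \<in> I +>\<^bsub>C\<^esub> x" for y
  proof -
    obtain i where i: "i \<in> I" "y = i \<oplus>\<^bsub>C\<^esub> x" using coset_mem[OF y] by blast
    then show ?thesis
      using coset_add[OF I_sm[OF r i(1)] sm_closed[OF r xC]] sm_add[OF r I_carrier[OF i(1)] xC] by simp
  qed
  then have "(\<Union>y\<in>I +>\<^bsub>C\<^esub> x. I +>\<^bsub>C\<^esub> (r \<odot>\<^bsub>C\<^esub> y)) = I +>\<^bsub>C\<^esub> (r \<odot>\<^bsub>C\<^esub> x)"
    using coset_self[OF xC] by blast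
  then show ?thesis by (simp add: subquotient_def)
qed

lemma subquotient_sm_closed:
  "r \<in> carrier R \<Longrightarrow> X \<in> carrier (subquotient C K I) \<Longrightarrow> r \<odot>\<^bsub>subquotient C K I\<^esub> X \<in> carrier (subquotient C K I)"
  using subquotient_smult K_sm by (auto simp: subquotient_def)

lemma subquotient_annihilated:
  assumes "X \<in> carrier (subquotient C K I)"
  shows "h \<odot>\<^bsub>subquotient C K I\<^esub> X = \<zero>\<^bsub>subquotient C K I\<^esub>"
proof -
  obtain x where x: "x \<in> K" "X = I +>\<^bsub>C\<^esub> x" using assms by (auto simp: subquotient_def)
  show ?thesis unfolding x(2) subquotient_smult[OF h x(1)] coset_join[OF ann[OF x(1)]]
    by (simp add: subquotient_def)
qed

lemma subquotient_zero_grade: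
  assumes "\<zero>\<^bsub>C\<^esub> \<in> K" "\<zero>\<^bsub>C\<^esub> \<in> grade C d"
  shows "\<zero>\<^bsub>subquotient C K I\<^esub> \<in> grade (subquotient C K I) d"
proof -
  have "\<zero>\<^bsub>C\<^esub> \<in> I" using subgroup.one_closed[OF I] by simp
  then have "I = I +>\<^bsub>C\<^esub> \<zero>\<^bsub>C\<^esub>" using coset_join by simp
  then show ?thesis using assms by (auto simp: subquotient_def)
qed

end

lemma subquotient_grade_subset: "grade (subquotient C K I) d \<subseteq> carrier (subquotient C K I)"
  by (auto simp: subquotient_def)

section \<open>Modules of homomorphisms\<close>

lemma hom_module_mem: "k \<in> carrier (hom_module G R M N) \<longleftrightarrow> k \<in> extensional (carrier M) \<and> module_hom R M N k"
  by (simp add: hom_module_def)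

lemma restrict_hom_mem:
  assumes "Module.module R M" "module_hom R M N k"
  shows "restrict k (carrier M) \<in> carrier (hom_module G R M N)"
proof -
  interpret M: Module.module R M by fact
  show ?thesis using assms(2) unfolding hom_module_mem module_hom_def by (auto simp: Pi_iff)
qed

lemma module_hom_sum_fun:
  assumes "Module.module R N" "module_hom R M N f" "module_hom R M N g"
  shows "module_hom R M N (\<lambda>x. f x \<oplus>\<^bsub>N\<^esub> g x)"
proof -
  interpret N: Module.module R N by fact
  have f: "f x \<in> carrier N" "g x \<in> carrier N" if "x \<in> carrier M" for x
    using that assms module_hom_closed by metis+
  show ?thesis
    using assms(2,3) f unfolding module_hom_def
    by (auto simp: Pi_iff N.smult_r_distr N.a_ac)
qed

lemma module_hom_zero_fun: "Module.module R N \<Longrightarrow> module_hom R M N (\<lambda>x. \<zero>\<^bsub>N\<^esub>)"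
proof -
  assume "Module.module R N"
  then interpret N: Module.module R N .
  show ?thesis by (auto simp: module_hom_def)
qed

lemma hom_module_abelian_group:
  assumes M: "Module.module R M" and N: "Module.module R N"
  shows "abelian_group (hom_module G R M N)"
proof -
  interpret M: Module.module R M by fact
  interpret N: Module.module R N by fact
  let ?H = "hom_module G R M N"
  have add: "f \<oplus>\<^bsub>?H\<^esub> g = (\<lambda>x\<in>carrier M. f x \<oplus>\<^bsub>N\<^esub> g x)" for f g by (simp add: hom_module_def)
  have zero: "\<zero>\<^bsub>?H\<^esub> = (\<lambda>x\<in>carrier M. \<zero>\<^bsub>N\<^esub>)" by (simp add: hom_module_def)
  have ext: "f \<in> carrier ?H \<Longrightarrow> f \<in> extensional (carrier M)" and hom: "f \<in> carrier ?H \<Longrightarrow> module_hom R M N f" for f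
    by (simp_all add: hom_module_mem)
  have cl: "f \<in> carrier ?H \<Longrightarrow> x \<in> carrier M \<Longrightarrow> f x \<in> carrier N" for f x
    using module_hom_closed[OF hom] .
  show ?thesis
  proof (rule abelian_groupI)
    show "f \<oplus>\<^bsub>?H\<^esub> g \<in> carrier ?H" if "f \<in> carrier ?H" "g \<in> carrier ?H" for f g
      unfolding add by (rule restrict_hom_mem[OF M module_hom_sum_fun[OF N hom[OF that(1)] hom[OF that(2)]]])
    show "\<zero>\<^bsub>?H\<^esub> \<in> carrier ?H" unfolding zero by (rule restrict_hom_mem[OF M module_hom_zero_fun[OF N]])
    show "(f \<oplus>\<^bsub>?H\<^esub> g) \<oplus>\<^bsub>?H\<^esub> k = f \<oplus>\<^bsub>?H\<^esub> (g \<oplus>\<^bsub>?H\<^esub> k)"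
      if "f \<in> carrier ?H" "g \<in> carrier ?H" "k \<in> carrier ?H" for f g k
      unfolding add by (rule restrict_ext) (simp add: N.a_assoc cl that)
    show "f \<oplus>\<^bsub>?H\<^esub> g = g \<oplus>\<^bsub>?H\<^esub> f" if "f \<in> carrier ?H" "g \<in> carrier ?H" for f g
      unfolding add by (rule restrict_ext) (simp add: N.a_comm cl that)
    show "\<zero>\<^bsub>?H\<^esub> \<oplus>\<^bsub>?H\<^esub> f = f" if "f \<in> carrier ?H" for f
      by (rule extensionalityI[of _ "carrier M"]) (use ext[OF that] cl[OF that] in \<open>auto simp: add zero\<close>)
    show "\<exists>g\<in>carrier ?H. g \<oplus>\<^bsub>?H\<^esub> f = \<zero>\<^bsub>?H\<^esub>" if f: "f \<in> carrier ?H" for f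
    proof
      show "(\<lambda>x\<in>carrier M. \<zero>\<^bsub>N\<^esub> \<ominus>\<^bsub>N\<^esub> f x) \<in> carrier ?H"
        by (rule restrict_hom_mem[OF M module_hom_diff_fun[OF N module_hom_zero_fun[OF N] hom[OF f]]])
      show "(\<lambda>x\<in>carrier M. \<zero>\<^bsub>N\<^esub> \<ominus>\<^bsub>N\<^esub> f x) \<oplus>\<^bsub>?H\<^esub> f = \<zero>\<^bsub>?H\<^esub>"
        unfolding add zero by (rule restrict_ext) (simp add: N.minus_eq cl[OF f] N.l_neg)
    qed
  qed
qed

text \<open>
  For a cocycle \<open>x\<close> the contraction gives \<open>h x = x s' b + x b s'' = (x s') b\<close>, which is the
  coboundary of \<open>x s'\<close>.
\<close>

lemma Ext_annihilated:
  fixes P :: "nat \<Rightarrow> ('a, 'p, 'g) graded" and N :: "('a, 'n, 'g) graded" and G :: "'g monoid"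
  assumes P: "\<And>j. Module.module R (P j)" and N: "Module.module R N"
    and b: "\<And>j. module_hom R (P (Suc j)) (P j) (b j)"
    and h: "h \<in> carrier R" and s': "module_hom R (P j) (P (Suc j)) s'"
    and s'': "module_hom R (P (Suc j)) (P (Suc (Suc j))) s''"
    and eq: "\<And>x. x \<in> carrier (P (Suc j)) \<Longrightarrow> h \<odot>\<^bsub>P (Suc j)\<^esub> x = s' (b j x) \<oplus>\<^bsub>P (Suc j)\<^esub> b (Suc j) (s'' x)"
  defines "C \<equiv> hom_module G R (P (Suc j)) N"
    and "K \<equiv> {k \<in> carrier (hom_module G R (P (Suc j)) N). restrict (k \<circ> b (Suc j)) (carrier (P (Suc (Suc j)))) =
       \<zero>\<^bsub>hom_module G R (P (Suc (Suc j))) N\<^esub>}"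
    and "I \<equiv> (\<lambda>k. restrict (k \<circ> b j) (carrier (P (Suc j)))) ` carrier (hom_module G R (P j) N)"
  shows "subquotient_annihilation R C K I h"
proof -
  interpret N: Module.module R N by fact
  have ab: "abelian_group (hom_module G R (P j) N)" for j by (rule hom_module_abelian_group[OF P N])
  have add: "f \<oplus>\<^bsub>hom_module G R (P j) N\<^esub> g = (\<lambda>x\<in>carrier (P j). f x \<oplus>\<^bsub>N\<^esub> g x)" for f g j by (simp add: hom_module_def)
  have zero: "\<zero>\<^bsub>hom_module G R (P j) N\<^esub> = (\<lambda>x\<in>carrier (P j). \<zero>\<^bsub>N\<^esub>)" for j by (simp add: hom_module_def)
  have sm: "r \<odot>\<^bsub>hom_module G R (P j) N\<^esub> f = (\<lambda>x\<in>carrier (P j). r \<odot>\<^bsub>N\<^esub> f x)" for r f j by (simp add: hom_module_def)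
  have hom: "f \<in> carrier (hom_module G R (P j) N) \<Longrightarrow> module_hom R (P j) N f" for f j by (simp add: hom_module_mem)
  have cl: "f \<in> carrier (hom_module G R (P j) N) \<Longrightarrow> x \<in> carrier (P j) \<Longrightarrow> f x \<in> carrier N" for f x j
    using module_hom_closed[OF hom] .
  note bc = module_hom_closed[OF b]
  have sm_cl: "r \<odot>\<^bsub>hom_module G R (P j) N\<^esub> f \<in> carrier (hom_module G R (P j) N)"
    if "r \<in> carrier R" "f \<in> carrier (hom_module G R (P j) N)" for r f j
    unfolding sm by (rule restrict_hom_mem[OF P module_hom_smult_fun[OF N hom[OF that(2)] that(1)]])
  have \<delta>cl: "restrict (k \<circ> b j) (carrier (P (Suc j))) \<in> carrier (hom_module G R (P (Suc j)) N)"
    if "k \<in> carrier (hom_module G R (P j) N)" for k j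
    using restrict_hom_mem[OF P module_hom_comp[OF b hom[OF that]]] by (simp add: comp_def)
  show ?thesis
  proof (rule subquotient_annihilation.intro)
    show "abelian_group C" unfolding C_def by (rule ab)
    show "r \<odot>\<^bsub>C\<^esub> x \<in> carrier C" if "r \<in> carrier R" "x \<in> carrier C" for r x
      using sm_cl that by (simp add: C_def)
    show "r \<odot>\<^bsub>C\<^esub> (x \<oplus>\<^bsub>C\<^esub> y) = r \<odot>\<^bsub>C\<^esub> x \<oplus>\<^bsub>C\<^esub> r \<odot>\<^bsub>C\<^esub> y"
      if "r \<in> carrier R" "x \<in> carrier C" "y \<in> carrier C" for r x y
      using that unfolding C_def sm add by (intro restrict_ext) (simp add: cl N.smult_r_distr)
    show "K \<subseteq> carrier C" by (auto simp: K_def C_def)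
    show "r \<odot>\<^bsub>C\<^esub> x \<in> K" if r: "r \<in> carrier R" and x: "x \<in> K" for r x
    proof -
      have "x (b (Suc j) y) = \<zero>\<^bsub>N\<^esub>" if "y \<in> carrier (P (Suc (Suc j)))" for y
        using x that unfolding K_def zero by (auto simp: fun_eq_iff restrict_def split: if_splits)
      then have "restrict ((r \<odot>\<^bsub>C\<^esub> x) \<circ> b (Suc j)) (carrier (P (Suc (Suc j)))) = \<zero>\<^bsub>hom_module G R (P (Suc (Suc j))) N\<^esub>"
        unfolding C_def sm zero using r bc by (intro restrict_ext) simp
      then show ?thesis using sm_cl[OF r, of x "Suc j"] x by (simp add: K_def C_def)
    qed
    show "subgroup I (add_monoid C)"
    proof -
      have "group_hom (add_monoid (hom_module G R (P j) N)) (add_monoid C)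
          (\<lambda>k. restrict (k \<circ> b j) (carrier (P (Suc j))))"
      proof (rule group_hom.intro)
        show "group (add_monoid (hom_module G R (P j) N))" using ab by (rule abelian_group.a_group)
        show "group (add_monoid C)" unfolding C_def using ab by (rule abelian_group.a_group)
        show "group_hom_axioms (add_monoid (hom_module G R (P j) N)) (add_monoid C)
          (\<lambda>k. restrict (k \<circ> b j) (carrier (P (Suc j))))"
        proof (unfold group_hom_axioms_def, rule homI)
          fix k assume "k \<in> carrier (add_monoid (hom_module G R (P j) N))"
          then show "restrict (k \<circ> b j) (carrier (P (Suc j))) \<in> carrier (add_monoid C)"
            using \<delta>cl by (simp add: C_def)
        next
          fix k k'
          show "restrict ((k \<otimes>\<^bsub>add_monoid (hom_module G R (P j) N)\<^esub> k') \<circ> b j) (carrier (P (Suc j))) =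
             restrict (k \<circ> b j) (carrier (P (Suc j))) \<otimes>\<^bsub>add_monoid C\<^esub> restrict (k' \<circ> b j) (carrier (P (Suc j)))"
            unfolding C_def by (simp add: add) (rule restrict_ext, simp add: bc)
        qed
      qed
      from group_hom.img_is_subgroup[OF this] show ?thesis by (simp add: I_def)
    qed
    show "r \<odot>\<^bsub>C\<^esub> x \<in> I" if r: "r \<in> carrier R" and x: "x \<in> I" for r x
    proof -
      obtain k where k: "k \<in> carrier (hom_module G R (P j) N)" "x = restrict (k \<circ> b j) (carrier (P (Suc j)))"
        using x by (auto simp: I_def)
      have "r \<odot>\<^bsub>C\<^esub> x = restrict ((r \<odot>\<^bsub>hom_module G R (P j) N\<^esub> k) \<circ> b j) (carrier (P (Suc j)))"
        unfolding C_def sm k(2) by (rule restrict_ext) (simp add: bc)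
      then show ?thesis using sm_cl[OF r k(1)] by (auto simp: I_def)
    qed
    show "h \<in> carrier R" by (rule h)
    show "h \<odot>\<^bsub>C\<^esub> x \<in> I" if x: "x \<in> K" for x
    proof -
      have xC: "x \<in> carrier (hom_module G R (P (Suc j)) N)" using x by (simp add: K_def)
      note xh = hom[OF xC]
      have x0: "x (b (Suc j) y) = \<zero>\<^bsub>N\<^esub>" if "y \<in> carrier (P (Suc (Suc j)))" for y
        using x that unfolding K_def zero by (auto simp: fun_eq_iff restrict_def split: if_splits)
      let ?k = "\<lambda>y\<in>carrier (P j). x (s' y)"
      have k: "?k \<in> carrier (hom_module G R (P j) N)" by (rule restrict_hom_mem[OF P module_hom_comp[OF s' xh]])
      have "h \<odot>\<^bsub>C\<^esub> x = restrict (?k \<circ> b j) (carrier (P (Suc j)))"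
        unfolding C_def sm
      proof (rule restrict_ext)
        fix y assume y: "y \<in> carrier (P (Suc j))"
        note c = bc[OF y] module_hom_closed[OF s' bc[OF y]] module_hom_closed[OF s'' y]
        have "h \<odot>\<^bsub>N\<^esub> x y = x (s' (b j y) \<oplus>\<^bsub>P (Suc j)\<^esub> b (Suc j) (s'' y))"
          using module_hom_smult[OF xh h y] eq[OF y] by simp
        also have "\<dots> = x (s' (b j y))"
          using c bc[OF c(3)] module_hom_closed[OF xh] by (simp add: module_hom_add[OF xh] x0)
        finally show "h \<odot>\<^bsub>N\<^esub> x y = (?k \<circ> b j) y" using c by simp
      qed
      then show ?thesis using k unfolding I_def by blast
    qed
  qed
qed

section \<open>Tensor products\<close>

definition frag_map :: "('m \<Rightarrow> 'p) \<Rightarrow> ('m \<times> 'n \<Rightarrow>\<^sub>0 int) \<Rightarrow> ('p \<times> 'n \<Rightarrow>\<^sub>0 int)" where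
  "frag_map f = frag_extend (\<lambda>(x, y). frag_of (f x, y))"

lemma frag_map_of: "frag_map f (frag_of (x, y)) = frag_of (f x, y)"
  by (simp add: frag_map_def)

lemma frag_map_add: "frag_map f (c + c') = frag_map f c + frag_map f c'"
  and frag_map_diff: "frag_map f (c - c') = frag_map f c - frag_map f c'"
  and frag_map_minus: "frag_map f (- c) = - frag_map f c"
  and frag_map_0: "frag_map f 0 = 0"
  by (simp_all add: frag_map_def frag_extend_add frag_extend_diff frag_extend_minus)

lemma frag_map_keys:
  assumes "Poly_Mapping.keys c \<subseteq> A \<times> B" "\<And>x. x \<in> A \<Longrightarrow> f x \<in> A'"
  shows "Poly_Mapping.keys (frag_map f c) \<subseteq> A' \<times> B"
proof -
  have "Poly_Mapping.keys (frag_map f c) \<subseteq> (\<Union>p\<in>Poly_Mapping.keys c. Poly_Mapping.keys ((\<lambda>(x, y). frag_of (f x, y)) p))"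
    unfolding frag_map_def by (rule keys_frag_extend)
  then show ?thesis using assms by fastforce
qed

lemma frag_map_comp: "frag_map g (frag_map f c) = frag_map (\<lambda>x. g (f x)) c"
proof (rule free_Abelian_group_induct[of c UNIV])
  show "frag_map g (frag_map f (frag_of a)) = frag_map (\<lambda>x. g (f x)) (frag_of a)" for a
    by (cases a) (simp add: frag_map_of)
qed (simp_all add: frag_map_0 frag_map_diff)

lemma frag_map_cong:
  assumes "Poly_Mapping.keys c \<subseteq> A \<times> B" "\<And>x. x \<in> A \<Longrightarrow> f x = g x"
  shows "frag_map f c = frag_map g c"
  unfolding frag_map_def by (rule frag_extend_eq) (use assms in auto)

lemma tensor_relations_subgroup:
  assumes M: "Module.module R M" and N: "Module.module R N"
  shows "subgroup (tensor_relations R M N) (free_Abelian_group (carrier M \<times> carrier N))"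
proof -
  interpret M: Module.module R M by fact
  interpret N: Module.module R N by fact
  show ?thesis
    unfolding tensor_relations_def
    by (rule group.generate_is_subgroup[OF group_free_Abelian_group]) (auto dest!: subsetD[OF keys_diff])
qed

locale tensor_setting =
  fixes R :: "('a, 'a, 'g) graded" and M :: "('a, 'm, 'g) graded" and N :: "('a, 'n, 'g) graded" and G :: "'g monoid"
  assumes M: "Module.module R M" and N: "Module.module R N"
begin

sublocale M: Module.module R M by (rule M)
sublocale N: Module.module R N by (rule N)

abbreviation "A \<equiv> free_Abelian_group (carrier M \<times> carrier N)"
abbreviation "T \<equiv> tensor_relations R M N"
abbreviation "co \<equiv> tensor_coset R M N"
abbreviation "MN \<equiv> tensor_module G R M N"

lemma T_subgroup: "subgroup T A" by (rule tensor_relations_subgroup[OF M N])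

lemma T_keys: "c \<in> T \<Longrightarrow> Poly_Mapping.keys c \<subseteq> carrier M \<times> carrier N"
  using subsetD[OF subgroup.subset[OF T_subgroup]] by simp

lemma T_diff: "c \<in> T \<Longrightarrow> c' \<in> T \<Longrightarrow> c - c' \<in> T"
  using subgroup.m_closed[OF T_subgroup, of c "- c'"] subgroup.m_inv_closed[OF T_subgroup, of c'] T_keys by simp

lemma T_zero: "0 \<in> T" using subgroup.one_closed[OF T_subgroup] by simp

lemma T_add_left: "x \<in> carrier M \<Longrightarrow> x' \<in> carrier M \<Longrightarrow> y \<in> carrier N \<Longrightarrow>
    frag_of (x \<oplus>\<^bsub>M\<^esub> x', y) - frag_of (x, y) - frag_of (x', y) \<in> T"
  unfolding tensor_relations_def by (rule generate.incl) blast

lemma T_add_right: "x \<in> carrier M \<Longrightarrow> y \<in> carrier N \<Longrightarrow> y' \<in> carrier N \<Longrightarrow>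
    frag_of (x, y \<oplus>\<^bsub>N\<^esub> y') - frag_of (x, y) - frag_of (x, y') \<in> T"
  unfolding tensor_relations_def by (rule generate.incl) blast

lemma T_balanced: "r \<in> carrier R \<Longrightarrow> x \<in> carrier M \<Longrightarrow> y \<in> carrier N \<Longrightarrow>
    frag_of (r \<odot>\<^bsub>M\<^esub> x, y) - frag_of (x, r \<odot>\<^bsub>N\<^esub> y) \<in> T"
  unfolding tensor_relations_def by (rule generate.incl) blast

lemma co_eq_iff: "Poly_Mapping.keys c \<subseteq> carrier M \<times> carrier N \<Longrightarrow> Poly_Mapping.keys c' \<subseteq> carrier M \<times> carrier N \<Longrightarrow>
    co c = co c' \<longleftrightarrow> c - c' \<in> T"
  unfolding tensor_coset_def by (rule frag_coset_eq_iff[OF T_subgroup])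

lemma co_add: "Poly_Mapping.keys c \<subseteq> carrier M \<times> carrier N \<Longrightarrow> Poly_Mapping.keys c' \<subseteq> carrier M \<times> carrier N \<Longrightarrow>
    co c \<oplus>\<^bsub>MN\<^esub> co c' = co (c + c')"
  unfolding tensor_coset_def by (simp add: tensor_module_def frag_coset_mult[OF T_subgroup])

lemma co_mem:
  assumes "c' \<in> co c" and c: "Poly_Mapping.keys c \<subseteq> carrier M \<times> carrier N"
  shows "Poly_Mapping.keys c' \<subseteq> carrier M \<times> carrier N \<and> c' - c \<in> T"
proof -
  obtain t where t: "t \<in> T" "c' = t + c" using assms(1) by (auto simp: tensor_coset_def r_coset_def)
  show ?thesis using keys_subset_add[OF T_keys[OF t(1)] c] t by simp
qed

lemma co_self: "Poly_Mapping.keys c \<subseteq> carrier M \<times> carrier N \<Longrightarrow> c \<in> co c"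
  using T_zero by (auto simp: tensor_coset_def r_coset_def intro!: bexI[of _ 0])

lemma zero_co: "\<zero>\<^bsub>MN\<^esub> = co 0"
  using group.coset_mult_one[OF group_free_Abelian_group subgroup.subset[OF T_subgroup]]
  by (simp add: tensor_module_def tensor_coset_def)

lemma carrier_MN: "carrier MN = co ` {c. Poly_Mapping.keys c \<subseteq> carrier M \<times> carrier N}"
proof -
  have "carrier A = {c. Poly_Mapping.keys c \<subseteq> carrier M \<times> carrier N}" by auto
  then show ?thesis by (simp add: tensor_module_def)
qed

lemma carrier_MN_E:
  assumes "X \<in> carrier MN"
  obtains c where "Poly_Mapping.keys c \<subseteq> carrier M \<times> carrier N" "X = co c"
  using assms unfolding carrier_MN by blast

lemma co_carrier: "Poly_Mapping.keys c \<subseteq> carrier M \<times> carrier N \<Longrightarrow> co c \<in> carrier MN"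
  unfolding carrier_MN by blast

lemma MN_abelian_group: "abelian_group MN"
proof (rule abelian_groupI)
  show "\<zero>\<^bsub>MN\<^esub> \<in> carrier MN" unfolding zero_co by (rule co_carrier) simp
next
  fix X assume "X \<in> carrier MN"
  then obtain c where c: "Poly_Mapping.keys c \<subseteq> carrier M \<times> carrier N" "X = co c" by (rule carrier_MN_E)
  show "\<zero>\<^bsub>MN\<^esub> \<oplus>\<^bsub>MN\<^esub> X = X" unfolding c(2) zero_co using c(1) by (simp add: co_add)
  have "co (- c) \<oplus>\<^bsub>MN\<^esub> co c = co 0" using c(1) by (simp add: co_add)
  then show "\<exists>Y\<in>carrier MN. Y \<oplus>\<^bsub>MN\<^esub> X = \<zero>\<^bsub>MN\<^esub>"
    unfolding c(2) zero_co using co_carrier[of "- c"] c(1) by auto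
  fix Y assume "Y \<in> carrier MN"
  then obtain c' where c': "Poly_Mapping.keys c' \<subseteq> carrier M \<times> carrier N" "Y = co c'" by (rule carrier_MN_E)
  show "X \<oplus>\<^bsub>MN\<^esub> Y \<in> carrier MN" unfolding c(2) c'(2) co_add[OF c(1) c'(1)]
    by (rule co_carrier[OF keys_subset_add[OF c(1) c'(1)]])
  show "X \<oplus>\<^bsub>MN\<^esub> Y = Y \<oplus>\<^bsub>MN\<^esub> X"
    unfolding c(2) c'(2) co_add[OF c(1) c'(1)] co_add[OF c'(1) c(1)] by (simp add: add.commute)
  fix Z assume "Z \<in> carrier MN"
  then obtain c'' where c'': "Poly_Mapping.keys c'' \<subseteq> carrier M \<times> carrier N" "Z = co c''" by (rule carrier_MN_E)
  show "(X \<oplus>\<^bsub>MN\<^esub> Y) \<oplus>\<^bsub>MN\<^esub> Z = X \<oplus>\<^bsub>MN\<^esub> (Y \<oplus>\<^bsub>MN\<^esub> Z)"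
    unfolding c(2) c'(2) c''(2) co_add[OF c(1) c'(1)] co_add[OF c'(1) c''(1)]
      co_add[OF keys_subset_add[OF c(1) c'(1)] c''(1)] co_add[OF c(1) keys_subset_add[OF c'(1) c''(1)]]
    by (simp add: add.assoc)
qed

end

locale tensor_hom = src: tensor_setting R M N G + tgt: tensor_setting R M' N G
  for R :: "('a, 'a, 'g) graded" and M :: "('a, 'm, 'g) graded" and N :: "('a, 'n, 'g) graded" and G :: "'g monoid"
    and M' :: "('a, 'p, 'g) graded" +
  fixes f :: "'m \<Rightarrow> 'p"
  assumes f: "module_hom R M M' f"
begin

lemma frag_map_closed: "Poly_Mapping.keys c \<subseteq> carrier M \<times> carrier N \<Longrightarrow> Poly_Mapping.keys (frag_map f c) \<subseteq> carrier M' \<times> carrier N"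
  by (rule frag_map_keys[OF _ module_hom_closed[OF f]])

text \<open>
  It is enough to look at the three kinds of generators of the relations, because \<open>frag_map f\<close> is
  additive.
\<close>

lemma frag_map_relations: assumes "c \<in> src.T" shows "frag_map f c \<in> tgt.T"
proof -
  let ?gen = "{frag_of (x \<oplus>\<^bsub>M\<^esub> x', y) - frag_of (x, y) - frag_of (x', y) | x x' y.
         x \<in> carrier M \<and> x' \<in> carrier M \<and> y \<in> carrier N} \<union>
      {frag_of (x, y \<oplus>\<^bsub>N\<^esub> y') - frag_of (x, y) - frag_of (x, y') | x y y'.
         x \<in> carrier M \<and> y \<in> carrier N \<and> y' \<in> carrier N} \<union>
      {frag_of (r \<odot>\<^bsub>M\<^esub> x, y) - frag_of (x, r \<odot>\<^bsub>N\<^esub> y) | r x y.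
         r \<in> carrier R \<and> x \<in> carrier M \<and> y \<in> carrier N}"
  note [simp] = frag_map_diff frag_map_of
  note cl = module_hom_closed[OF f]
  have gen: "frag_map f c \<in> tgt.T" if "c \<in> ?gen" for c
    using that
  proof (elim UnE CollectE exE conjE)
    fix x x' y assume "c = frag_of (x \<oplus>\<^bsub>M\<^esub> x', y) - frag_of (x, y) - frag_of (x', y)"
      "x \<in> carrier M" "x' \<in> carrier M" "y \<in> carrier N"
    then show ?thesis using tgt.T_add_left[of "f x" "f x'" y] cl by (simp add: module_hom_add[OF f])
  next
    fix x y y' assume "c = frag_of (x, y \<oplus>\<^bsub>N\<^esub> y') - frag_of (x, y) - frag_of (x, y')"
      "x \<in> carrier M" "y \<in> carrier N" "y' \<in> carrier N"
    then show ?thesis using tgt.T_add_right[of "f x" y y'] cl by simp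
  next
    fix r x y assume "c = frag_of (r \<odot>\<^bsub>M\<^esub> x, y) - frag_of (x, r \<odot>\<^bsub>N\<^esub> y)"
      "r \<in> carrier R" "x \<in> carrier M" "y \<in> carrier N"
    then show ?thesis using tgt.T_balanced[of r "f x" y] cl by (simp add: module_hom_smult[OF f])
  qed
  show ?thesis
    using assms unfolding tensor_relations_def[of R M N]
  proof (induction c rule: generate.induct)
    case one
    then show ?case using tgt.T_zero by (simp add: frag_map_0)
  next
    case (incl c)
    then show ?case by (rule gen)
  next
    case (inv c)
    have "c \<in> src.T" unfolding tensor_relations_def using inv by (rule generate.incl)
    then show ?case
      using tgt.T_diff[OF tgt.T_zero gen[OF inv]] src.T_keys[of c] by (simp add: frag_map_minus)
  next
    case (eng c c')
    then show ?case using subgroup.m_closed[OF tgt.T_subgroup] by (simp add: frag_map_add)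
  qed
qed

abbreviation "tm \<equiv> tensor_map R M' N f"

lemma tm_coset:
  assumes c: "Poly_Mapping.keys c \<subseteq> carrier M \<times> carrier N"
  shows "tm (src.co c) = tgt.co (frag_map f c)"
proof -
  have "tgt.co (frag_map f c') = tgt.co (frag_map f c)" if "c' \<in> src.co c" for c'
    using src.co_mem[OF that c] frag_map_relations[of "c' - c"]
    by (subst tgt.co_eq_iff) (auto simp: frag_map_closed[OF c] frag_map_closed frag_map_diff)
  then have "(\<Union>c'\<in>src.co c. tgt.co (frag_map f c')) = tgt.co (frag_map f c)"
    using src.co_self[OF c] by blast
  then show ?thesis by (simp add: tensor_map_def frag_map_def)
qed

lemma tm_closed: "X \<in> carrier src.MN \<Longrightarrow> tm X \<in> carrier tgt.MN"
  using frag_map_closed tm_coset unfolding src.carrier_MN tgt.carrier_MN by auto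

lemma tm_add:
  assumes "X \<in> carrier src.MN" "Y \<in> carrier src.MN"
  shows "tm (X \<oplus>\<^bsub>src.MN\<^esub> Y) = tm X \<oplus>\<^bsub>tgt.MN\<^esub> tm Y"
proof -
  obtain c where c: "Poly_Mapping.keys c \<subseteq> carrier M \<times> carrier N" "X = src.co c" using assms(1) unfolding src.carrier_MN by auto
  obtain c' where c': "Poly_Mapping.keys c' \<subseteq> carrier M \<times> carrier N" "Y = src.co c'" using assms(2) unfolding src.carrier_MN by auto
  show ?thesis
    unfolding c(2) c'(2) src.co_add[OF c(1) c'(1)] tm_coset[OF c(1)] tm_coset[OF c'(1)]
      tm_coset[OF keys_subset_add[OF c(1) c'(1)]] frag_map_add tgt.co_add[OF frag_map_closed[OF c(1)] frag_map_closed[OF c'(1)]] ..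
qed

lemma tm_zero: "tm \<zero>\<^bsub>src.MN\<^esub> = \<zero>\<^bsub>tgt.MN\<^esub>"
  using tm_coset[of 0] by (simp add: src.zero_co tgt.zero_co frag_map_0)

end

lemma tensor_map_comp:
  assumes "tensor_hom R M N M' f" "tensor_hom R M' N M'' g" "X \<in> carrier (tensor_module G R M N)"
  shows "tensor_map R M'' N g (tensor_map R M' N f X) = tensor_map R M'' N (\<lambda>x. g (f x)) X"
proof -
  interpret f: tensor_hom R M N G M' f by fact
  interpret g: tensor_hom R M' N G M'' g by fact
  interpret gf: tensor_hom R M N G M'' "\<lambda>x. g (f x)"
    by (intro tensor_hom.intro f.src.tensor_setting_axioms g.tgt.tensor_setting_axioms tensor_hom_axioms.intro
      module_hom_comp[OF f.f g.f])
  obtain c where c: "Poly_Mapping.keys c \<subseteq> carrier M \<times> carrier N" "X = f.src.co c"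
    using assms(3) unfolding f.src.carrier_MN by auto
  show ?thesis
    unfolding c(2) by (simp add: f.tm_coset[OF c(1)] g.tm_coset[OF f.frag_map_closed[OF c(1)]] gf.tm_coset[OF c(1)] frag_map_comp)
qed

lemma tensor_map_cong:
  assumes "tensor_hom R M N M' f" "tensor_hom R M N M' g" "X \<in> carrier (tensor_module G R M N)"
    and eq: "\<And>x. x \<in> carrier M \<Longrightarrow> f x = g x"
  shows "tensor_map R M' N f X = tensor_map R M' N g X"
proof -
  interpret f: tensor_hom R M N G M' f by fact
  interpret g: tensor_hom R M N G M' g by fact
  obtain c where c: "Poly_Mapping.keys c \<subseteq> carrier M \<times> carrier N" "X = f.src.co c"
    using assms(3) unfolding f.src.carrier_MN by auto
  show ?thesis
    unfolding c(2) by (simp add: f.tm_coset[OF c(1)] g.tm_coset[OF c(1)] frag_map_cong[OF c(1) eq])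
qed

text \<open>
  The two sides differ by an additive map which sends each generator \<open>(x, y)\<close> to a relation.
\<close>

lemma tensor_map_sum:
  assumes "tensor_hom R M N M' f" "tensor_hom R M N M' g" "X \<in> carrier (tensor_module G R M N)"
  shows "tensor_map R M' N (\<lambda>x. f x \<oplus>\<^bsub>M'\<^esub> g x) X = tensor_map R M' N f X \<oplus>\<^bsub>tensor_module G R M' N\<^esub> tensor_map R M' N g X"
proof -
  interpret f: tensor_hom R M N G M' f by fact
  interpret g: tensor_hom R M N G M' g by fact
  interpret fg: tensor_hom R M N G M' "\<lambda>x. f x \<oplus>\<^bsub>M'\<^esub> g x"
    by (intro tensor_hom.intro f.src.tensor_setting_axioms f.tgt.tensor_setting_axioms tensor_hom_axioms.intro
      module_hom_sum_fun[OF f.tgt.M f.f g.f])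
  obtain c where c: "Poly_Mapping.keys c \<subseteq> carrier M \<times> carrier N" "X = f.src.co c"
    using assms(3) unfolding f.src.carrier_MN by auto
  have "frag_map (\<lambda>x. f x \<oplus>\<^bsub>M'\<^esub> g x) c - (frag_map f c + frag_map g c) \<in> f.tgt.T"
  proof (rule free_Abelian_group_induct[OF c(1)])
    show "frag_map (\<lambda>x. f x \<oplus>\<^bsub>M'\<^esub> g x) 0 - (frag_map f 0 + frag_map g 0) \<in> f.tgt.T"
      using f.tgt.T_zero by (simp add: frag_map_0)
  next
    fix c c'
    assume *: "frag_map (\<lambda>x. f x \<oplus>\<^bsub>M'\<^esub> g x) c - (frag_map f c + frag_map g c) \<in> f.tgt.T"
      "frag_map (\<lambda>x. f x \<oplus>\<^bsub>M'\<^esub> g x) c' - (frag_map f c' + frag_map g c') \<in> f.tgt.T"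
    have "frag_map (\<lambda>x. f x \<oplus>\<^bsub>M'\<^esub> g x) (c - c') - (frag_map f (c - c') + frag_map g (c - c')) =
       (frag_map (\<lambda>x. f x \<oplus>\<^bsub>M'\<^esub> g x) c - (frag_map f c + frag_map g c)) -
       (frag_map (\<lambda>x. f x \<oplus>\<^bsub>M'\<^esub> g x) c' - (frag_map f c' + frag_map g c'))"
      by (simp add: frag_map_diff)
    then show "frag_map (\<lambda>x. f x \<oplus>\<^bsub>M'\<^esub> g x) (c - c') - (frag_map f (c - c') + frag_map g (c - c')) \<in> f.tgt.T"
      using f.tgt.T_diff[OF *] by simp
  next
    fix a assume "a \<in> carrier M \<times> carrier N"
    then obtain x y where "a = (x, y)" "x \<in> carrier M" "y \<in> carrier N" by auto
    then show "frag_map (\<lambda>x. f x \<oplus>\<^bsub>M'\<^esub> g x) (frag_of a) - (frag_map f (frag_of a) + frag_map g (frag_of a)) \<in> f.tgt.T"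
      using f.tgt.T_add_left[of "f x" "g x" y] module_hom_closed[OF f.f] module_hom_closed[OF g.f]
      by (simp add: frag_map_of diff_diff_eq)
  qed
  then show ?thesis
    unfolding c(2)
    by (simp add: f.tm_coset[OF c(1)] g.tm_coset[OF c(1)] fg.tm_coset[OF c(1)] f.tgt.co_add f.frag_map_closed[OF c(1)] g.frag_map_closed[OF c(1)]
      f.tgt.co_eq_iff fg.frag_map_closed[OF c(1)] keys_subset_add)
qed

text \<open>
  Functoriality then yields the additivity of scalar multiplication and its commutation with maps.
\<close>

lemma tensor_smult: "smult (tensor_module G R M N) r = tensor_map R M N (\<lambda>x. r \<odot>\<^bsub>M\<^esub> x)"
  by (simp add: tensor_module_def tensor_map_def fun_eq_iff)

text \<open>
  For a cycle \<open>z\<close> the contraction gives \<open>h z = s' (b z) + b (s'' z) = b (s'' z)\<close>, all maps being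
  tensored with \<open>N\<close>.
\<close>

lemma Tor_annihilated:
  fixes P :: "nat \<Rightarrow> ('a, 'p, 'g) graded" and N :: "('a, 'n, 'g) graded" and G :: "'g monoid"
  assumes P: "\<And>j. Module.module R (P j)" and N: "Module.module R N"
    and b: "\<And>j. module_hom R (P (Suc j)) (P j) (b j)"
    and h: "h \<in> carrier R" and s': "module_hom R (P j) (P (Suc j)) s'"
    and s'': "module_hom R (P (Suc j)) (P (Suc (Suc j))) s''"
    and eq: "\<And>x. x \<in> carrier (P (Suc j)) \<Longrightarrow> h \<odot>\<^bsub>P (Suc j)\<^esub> x = s' (b j x) \<oplus>\<^bsub>P (Suc j)\<^esub> b (Suc j) (s'' x)"
  defines "C \<equiv> tensor_module G R (P (Suc j)) N"
    and "K \<equiv> {z \<in> carrier (tensor_module G R (P (Suc j)) N). tensor_map R (P j) N (b j) z = \<zero>\<^bsub>tensor_module G R (P j) N\<^esub>}"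
    and "I \<equiv> tensor_map R (P (Suc j)) N (b (Suc j)) ` carrier (tensor_module G R (P (Suc (Suc j))) N)"
  shows "subquotient_annihilation R C K I h"
proof -
  have th: "tensor_hom R (P i) N (P k) f" if "module_hom R (P i) (P k) f" for i k f
    by (intro tensor_hom.intro tensor_setting.intro P N tensor_hom_axioms.intro that)
  have smh: "module_hom R (P i) (P i) (\<lambda>x. r \<odot>\<^bsub>P i\<^esub> x)" if "r \<in> carrier R" for r i
    by (rule module_hom_smult_fun[OF P module_hom_id that])
  have ab: "abelian_group (tensor_module G R (P i) N)" for i
    by (rule tensor_setting.MN_abelian_group) (intro tensor_setting.intro P N)
  note tm_closed = tensor_hom.tm_closed[OF th] and tm_add = tensor_hom.tm_add[OF th] and tm_zero = tensor_hom.tm_zero[OF th]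
  note comp = tensor_map_comp[OF th th] and cong = tensor_map_cong[OF th th]
  have comm: "tensor_map R (P k) N f (r \<odot>\<^bsub>tensor_module G R (P i) N\<^esub> X) = r \<odot>\<^bsub>tensor_module G R (P k) N\<^esub> tensor_map R (P k) N f X"
    if f: "module_hom R (P i) (P k) f" and r: "r \<in> carrier R" and X: "X \<in> carrier (tensor_module G R (P i) N)" for i k f r X
    unfolding tensor_smult comp[OF smh[OF r] f X] comp[OF f smh[OF r] X]
    by (rule cong[OF module_hom_comp[OF smh[OF r] f] module_hom_comp[OF f smh[OF r]] X])
      (simp add: module_hom_smult[OF f r])
  show ?thesis
  proof (rule subquotient_annihilation.intro)
    show "abelian_group C" unfolding C_def by (rule ab)
    show sc: "r \<odot>\<^bsub>C\<^esub> x \<in> carrier C" if "r \<in> carrier R" "x \<in> carrier C" for r x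
      using tm_closed[OF smh[OF that(1)]] that(2) by (simp add: C_def tensor_smult)
    show "r \<odot>\<^bsub>C\<^esub> (x \<oplus>\<^bsub>C\<^esub> y) = r \<odot>\<^bsub>C\<^esub> x \<oplus>\<^bsub>C\<^esub> r \<odot>\<^bsub>C\<^esub> y"
      if "r \<in> carrier R" "x \<in> carrier C" "y \<in> carrier C" for r x y
      using tm_add[OF smh[OF that(1)]] that(2,3) by (simp add: C_def tensor_smult)
    show "K \<subseteq> carrier C" by (auto simp: K_def C_def)
    show "r \<odot>\<^bsub>C\<^esub> x \<in> K" if r: "r \<in> carrier R" and x: "x \<in> K" for r x
    proof -
      have "x \<in> carrier (tensor_module G R (P (Suc j)) N)" "tensor_map R (P j) N (b j) x = \<zero>\<^bsub>tensor_module G R (P j) N\<^esub>"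
        using x by (auto simp: K_def)
      then have "tensor_map R (P j) N (b j) (r \<odot>\<^bsub>C\<^esub> x) = \<zero>\<^bsub>tensor_module G R (P j) N\<^esub>"
        using comm[OF b r] tm_zero[OF smh[OF r]] by (simp add: C_def tensor_smult)
      then show ?thesis using sc[OF r] x by (simp add: K_def C_def)
    qed
    show "subgroup I (add_monoid C)"
    proof -
      have "group_hom (add_monoid (tensor_module G R (P (Suc (Suc j))) N)) (add_monoid C) (tensor_map R (P (Suc j)) N (b (Suc j)))"
        unfolding C_def
        by (intro group_hom.intro group_hom_axioms.intro abelian_group.a_group ab homI)
          (simp_all add: tm_closed[OF b] tm_add[OF b])
      from group_hom.img_is_subgroup[OF this] show ?thesis by (simp add: I_def)
    qed
    show "r \<odot>\<^bsub>C\<^esub> x \<in> I" if r: "r \<in> carrier R" and x: "x \<in> I" for r x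
    proof -
      obtain k where k: "k \<in> carrier (tensor_module G R (P (Suc (Suc j))) N)" "x = tensor_map R (P (Suc j)) N (b (Suc j)) k"
        using x by (auto simp: I_def)
      have "r \<odot>\<^bsub>C\<^esub> x = tensor_map R (P (Suc j)) N (b (Suc j)) (r \<odot>\<^bsub>tensor_module G R (P (Suc (Suc j))) N\<^esub> k)"
        unfolding C_def k(2) comm[OF b r k(1)] ..
      moreover have "r \<odot>\<^bsub>tensor_module G R (P (Suc (Suc j))) N\<^esub> k \<in> carrier (tensor_module G R (P (Suc (Suc j))) N)"
        using tm_closed[OF smh[OF r] k(1)] by (simp add: tensor_smult)
      ultimately show ?thesis by (simp add: I_def)
    qed
    show "h \<in> carrier R" by (rule h)
    show "h \<odot>\<^bsub>C\<^esub> x \<in> I" if x: "x \<in> K" for x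
    proof -
      have xC: "x \<in> carrier (tensor_module G R (P (Suc j)) N)" and x0: "tensor_map R (P j) N (b j) x = \<zero>\<^bsub>tensor_module G R (P j) N\<^esub>"
        using x by (auto simp: K_def)
      note h1 = module_hom_comp[OF b s'] and h2 = module_hom_comp[OF s'' b]
      interpret C: abelian_group "tensor_module G R (P (Suc j)) N" by (rule ab)
      have "h \<odot>\<^bsub>C\<^esub> x = tensor_map R (P (Suc j)) N (\<lambda>x. s' (b j x) \<oplus>\<^bsub>P (Suc j)\<^esub> b (Suc j) (s'' x)) x"
        unfolding C_def tensor_smult
        by (rule cong[OF smh[OF h] module_hom_sum_fun[OF P h1 h2] xC eq])
      also have "\<dots> = tensor_map R (P (Suc j)) N (\<lambda>x. s' (b j x)) x \<oplus>\<^bsub>tensor_module G R (P (Suc j)) N\<^esub>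
          tensor_map R (P (Suc j)) N (\<lambda>x. b (Suc j) (s'' x)) x"
        by (rule tensor_map_sum[OF th[OF h1] th[OF h2] xC])
      also have "tensor_map R (P (Suc j)) N (\<lambda>x. s' (b j x)) x = \<zero>\<^bsub>tensor_module G R (P (Suc j)) N\<^esub>"
        using comp[OF b s' xC] x0 tm_zero[OF s'] by simp
      also have "tensor_map R (P (Suc j)) N (\<lambda>x. b (Suc j) (s'' x)) x =
          tensor_map R (P (Suc j)) N (b (Suc j)) (tensor_map R (P (Suc (Suc j))) N s'' x)"
        using comp[OF s'' b xC] by simp
      finally show ?thesis
        using tm_closed[OF b tm_closed[OF s'' xC]] tm_closed[OF s'' xC] by (simp add: I_def)
    qed
  qed
qed

section \<open>Vanishing beyond the length of a virtual resolution\<close>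

lemma fg_graded_freeE:
  assumes "fg_graded_free G R F"
  obtains B where "free_basis R F B" "B \<subseteq> (\<Union>d\<in>carrier G. grade F d)"
proof -
  obtain B where B: "finite B" "B \<subseteq> (\<Union>d\<in>carrier G. grade F d)"
      "\<forall>x\<in>carrier F. \<exists>!c. c \<in> B \<rightarrow>\<^sub>E carrier R \<and> x = finsum F (\<lambda>b. c b \<odot>\<^bsub>F\<^esub> b) B"
    and F: "graded_module G R F"
    using assms unfolding fg_graded_free_def by blast
  have "B \<subseteq> carrier F" using B(2) grade_subset[OF F] by blast
  then show ?thesis using that[of B] B by (auto simp: free_basis_def)
qed

context toric begin

text \<open>
  At a point the virtual resolution is exact up to the denominators of the point, also at \<open>F 0\<close> if the
  augmentation is read as a relation.
\<close>

lemma local_contraction: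
  fixes M :: "(('v, 'k::field) cox_poly, 'm, 'v pic) graded"
    and P :: "nat \<Rightarrow> (('v, 'k) cox_poly, 'p, 'v pic) graded"
    and F :: "nat \<Rightarrow> (('v, 'k) cox_poly, 'f, 'v pic) graded"
  assumes fan: "smooth_projective_fan L \<Delta>" and M: "graded_module G S M"
    and vr: "virtual_resolution L \<Delta> M F d" and res: "graded_free_resolution G S M P b \<eta>"
    and triv: "carrier (F (Suc i)) = {\<zero>\<^bsub>F (Suc i)\<^esub>}" and Q: "Q \<in> X"
  obtains h s' s'' where "h \<in> units Q" "module_hom S (P i) (P (Suc i)) s'"
    "module_hom S (P (Suc i)) (P (Suc (Suc i))) s''"
    "\<And>x. x \<in> carrier (P (Suc i)) \<Longrightarrow>
       h \<odot>\<^bsub>P (Suc i)\<^esub> x = s' (b i x) \<oplus>\<^bsub>P (Suc i)\<^esub> b (Suc i) (s'' x)"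
proof -
  have Pfree: "fg_graded_free G S (P j)" and Pb: "graded_hom G S (P (Suc j)) (P j) (b j)"
    and \<eta>: "graded_hom G S (P 0) M \<eta>" and \<eta>s: "\<eta> ` carrier (P 0) = carrier M"
    and ex0: "b 0 ` carrier (P 1) = {x \<in> carrier (P 0). \<eta> x = \<zero>\<^bsub>M\<^esub>}"
    and exP: "b (Suc j) ` carrier (P (Suc (Suc j))) = {x \<in> carrier (P (Suc j)). b j x = \<zero>\<^bsub>P j\<^esub>}" for j
    using res unfolding graded_free_resolution_def fg_graded_free_complex_def by auto
  have Ffree: "fg_graded_free G S (F j)" and Fd: "graded_hom G S (F (Suc j)) (F j) (d j)"
    and dd: "\<And>x. x \<in> carrier (F (Suc (Suc j))) \<Longrightarrow> d j (d (Suc j) x) = \<zero>\<^bsub>F j\<^esub>"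
    and exF: "sheaf_exact L \<Delta> (\<T> (F (Suc (Suc j)))) (\<T> (F (Suc j))) (\<T> (F j))
            (tmap (F (Suc j)) (d (Suc j))) (tmap (F j) (d j))" for j
    using vr unfolding virtual_resolution_def fg_graded_free_complex_def by auto
  obtain \<epsilon> where \<epsilon>: "sheaf_hom L \<Delta> (\<T> (F 0)) (\<T> M) \<epsilon>"
      "sheaf_surjective L \<Delta> (\<T> (F 0)) (\<T> M) \<epsilon>"
      "sheaf_exact L \<Delta> (\<T> (F 1)) (\<T> (F 0)) (\<T> M) (tmap (F 0) (d 0)) \<epsilon>"
    using vr unfolding virtual_resolution_def by blast
  have gP: "graded_module G S (P j)" and gF: "graded_module G S (F j)" for j
    using Pfree[of j] Ffree[of j] by (auto simp: fg_graded_free_def)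
  have mP: "Module.module S (P j)" and mF: "Module.module S (F j)" for j
    using gP gF graded_module_module by blast+
  have hP: "module_hom S (P (Suc j)) (P j) (b j)" and hF: "module_hom S (F (Suc j)) (F j) (d j)" for j
    using Pb Fd by (auto simp: graded_hom_def)
  have tF: "toric_module L \<Delta> (F j)" for j using gF by (rule toric_module.intro)
  have tM: "toric_module L \<Delta> M" using M by (rule toric_module.intro)
  have W: "mult_subset S (units Q)"
    by (rule units_mult_subset[OF Module.module.axioms(1)[OF mP]])
  interpret W: mult_subset S "units Q" by (rule W)
  interpret aug: augmentation_at_point L \<Delta> "F 0" M \<epsilon> Q
    by (intro augmentation_at_point.intro tF tM augmentation_at_point_axioms.intro fan Q \<epsilon>(1))
  obtain B0 where B0: "free_basis S (P 0) B0" "B0 \<subseteq> (\<Union>e\<in>carrier G. grade (P 0) e)"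
    using fg_graded_freeE[OF Pfree] .
  obtain C0 where C0: "free_basis S (F 0) C0" "C0 \<subseteq> (\<Union>e\<in>carrier G. grade (F 0) e)"
    using fg_graded_freeE[OF Ffree] .
  obtain C1 where C1: "free_basis S (F 1) C1"
    using fg_graded_freeE[OF Ffree] by blast
  have b0: "module_hom S (P 1) (P 0) (b 0)" and d0: "graded_hom G S (F 1) (F 0) (d 0)"
    using hP[of 0] Fd[of 0] by simp_all
  have "\<exists>h \<alpha> \<beta> s. mult_subset.comparison S (units Q) (P 0) (P 1) (F 0) (F 1) (b 0) (d 0) h \<alpha> \<beta> s"
  proof (rule aug.comparison_from_relation[OF W gF gP gP B0(1) C0(1) C1 B0(2) C0(2) b0 d0 \<eta> \<eta>s ex0])
    show "\<exists>w\<in>units Q. \<exists>m c. aug.rel c (w \<odot>\<^bsub>F 0\<^esub> x) m" if "e \<in> carrier G" "x \<in> grade (F 0) e" for e x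
      using that by (rule aug.rel_total_left)
    show "\<exists>w\<in>units Q. \<exists>x c. aug.rel c x (w \<odot>\<^bsub>M\<^esub> m)" if "e \<in> carrier G" "m \<in> grade M e" for e m
      by (rule aug.rel_total_right[OF \<epsilon>(2) that])
    show "\<exists>w\<in>units Q. w \<odot>\<^bsub>F 0\<^esub> x \<in> d 0 ` carrier (F 1)" if "aug.rel e x \<zero>\<^bsub>M\<^esub>" for e x
      by (rule aug.rel_right_zero[OF tF d0 \<epsilon>(3) that])
    show "\<exists>w\<in>units Q. w \<odot>\<^bsub>M\<^esub> m = \<zero>\<^bsub>M\<^esub>" if "aug.rel e \<zero>\<^bsub>F 0\<^esub> m" for e m
      using that by (rule aug.rel_left_zero)
    show "aug.rel e (d 0 y) \<zero>\<^bsub>M\<^esub>" if "e \<in> carrier G" "y \<in> grade (F 1) e" for e y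
      by (rule aug.rel_image[OF tF d0 \<epsilon>(3) that])
  qed
  then obtain h \<alpha> \<beta> s where cmp: "W.comparison (P 0) (P 1) (F 0) (F 1) (b 0) (d 0) h \<alpha> \<beta> s" by blast
  have exW: "\<exists>w\<in>units Q. w \<odot>\<^bsub>F (Suc j)\<^esub> x \<in> d (Suc j) ` carrier (F (Suc (Suc j)))"
    if x: "x \<in> carrier (F (Suc j))" "d j x = \<zero>\<^bsub>F j\<^esub>" for j x
  proof (rule exact_up_to_W_from_homogeneous[OF W gF gF gF hF Fd _ x])
    show "\<exists>w\<in>units Q. w \<odot>\<^bsub>F (Suc j)\<^esub> y \<in> d (Suc j) ` carrier (F (Suc (Suc j)))"
      if "e \<in> carrier G" "y \<in> grade (F (Suc j)) e" "d j y = \<zero>\<^bsub>F j\<^esub>" for e y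
      by (rule exact_at_point[OF fan Q tF tF tF Fd Fd exF that])
  qed
  have basP: "\<exists>B. free_basis S (P j) B" and basF: "\<exists>B. free_basis S (F j) B" for j
    using fg_graded_freeE[OF Pfree] fg_graded_freeE[OF Ffree] by metis+
  show ?thesis
    by (rule W.homotopy_beyond_length[OF mP mF basP basF hP hF exP dd exW cmp triv]) (blast intro: that)+
qed

end

text \<open>
  The point with all homogeneous coordinates equal to one.
\<close>

lemma toric_points_nonempty:
  assumes "is_fan L \<Delta>"
  obtains Q where "Q \<in> (toric_points L \<Delta> :: ('v::real_vector, 'k::field) pt set)"
proof -
  obtain \<sigma> where \<sigma>: "\<sigma> \<in> \<Delta>" using assms by (auto simp: is_fan_def)
  define a :: "'v set \<Rightarrow> 'k" where "a = (\<lambda>\<rho>\<in>rays \<Delta>. 1)"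
  have "(\<Prod>\<rho>\<in>{\<rho>\<in>rays \<Delta>. \<not> \<rho> face_of \<sigma>}. a \<rho>) \<noteq> 0"
    by (simp add: prod.neutral a_def)
  then have "a \<notin> irrelevant_locus \<Delta>" using \<sigma> unfolding irrelevant_locus_def by blast
  moreover have "a \<in> rays \<Delta> \<rightarrow>\<^sub>E UNIV" by (simp add: a_def)
  ultimately have "(\<lambda>t. \<lambda>\<rho>\<in>rays \<Delta>. t \<rho> * a \<rho>) ` cox_group L \<Delta> \<in> toric_points L \<Delta>"
    unfolding toric_points_def by blast
  then show ?thesis by (rule that)
qed

lemma hom_zero_grade:
  assumes M: "graded_module G R M" and N: "graded_module G R N" and G: "group G" and e: "e \<in> carrier G"
  shows "\<zero>\<^bsub>hom_module G R M N\<^esub> \<in> grade (hom_module G R M N) e"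
proof -
  interpret G: group G by fact
  interpret M: Module.module R M using M by (rule graded_module_module)
  interpret N: Module.module R N using N by (rule graded_module_module)
  have "module_hom R M N (\<lambda>x\<in>carrier M. \<zero>\<^bsub>N\<^esub>)"
    using restrict_hom_mem[OF M.module_axioms module_hom_zero_fun[OF N.module_axioms]] by (simp add: hom_module_mem)
  moreover have "(\<lambda>x\<in>carrier M. \<zero>\<^bsub>N\<^esub>) ` grade M c \<subseteq> grade N (c \<otimes>\<^bsub>G\<^esub> e)" if "c \<in> carrier G" for c
    using grade_subset[OF M that] grade_zero[OF N G.m_closed[OF that e]] by auto
  ultimately show ?thesis by (simp add: hom_module_def)
qed

lemma tensor_zero_grade:
  assumes M: "Module.module R M" and N: "Module.module R N"
  shows "\<zero>\<^bsub>tensor_module G R M N\<^esub> \<in> grade (tensor_module G R M N) e"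
proof -
  interpret tensor_setting R M N G using M N by (rule tensor_setting.intro)
  have "0 \<in> generate A {frag_of (x, y) | x y. \<exists>a\<in>carrier G. \<exists>b\<in>carrier G. a \<otimes>\<^bsub>G\<^esub> b = e \<and> x \<in> grade M a \<and> y \<in> grade N b}"
    using generate.one[of A] by simp
  then show ?thesis unfolding zero_co by (simp add: tensor_module_def)
qed

theorem mainTheorem9:
  fixes L :: "'v::real_vector set"
    and \<Delta> :: "'v set set"
    and S :: "(('v, 'k::alg_closed_field) cox_poly, ('v, 'k) cox_poly, 'v pic) graded"
    and M :: "(('v, 'k) cox_poly, 'm, 'v pic) graded"
    and N :: "(('v, 'k) cox_poly, 'n, 'v pic) graded"
    and F :: "nat \<Rightarrow> (('v, 'k) cox_poly, 'f, 'v pic) graded"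
    and d :: "nat \<Rightarrow> 'f \<Rightarrow> 'f"
    and P :: "nat \<Rightarrow> (('v, 'k) cox_poly, 'p, 'v pic) graded"
    and b :: "nat \<Rightarrow> 'p \<Rightarrow> 'p"
    and \<eta> :: "'p \<Rightarrow> 'm"
    and l i :: nat
  assumes "smooth_projective_fan L \<Delta>"
    and "S = cox_ring L \<Delta>"
    and "fg_graded_module (Pic L \<Delta>) S M"
    and "virtual_resolution L \<Delta> M F d" and "complex_length_le F l"
    and "fg_graded_module (Pic L \<Delta>) S N"
    and "graded_free_resolution (Pic L \<Delta>) S M P b \<eta>"
    and "i > l"
  shows "sheaf_zero L \<Delta> (tilde L \<Delta> (Ext_module (Pic L \<Delta>) S P b N i)) \<and>
         sheaf_zero L \<Delta> (tilde L \<Delta> (Tor_module (Pic L \<Delta>) S P b N i))"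
proof -
  obtain j where i: "i = Suc j" using \<open>i > l\<close> by (cases i) auto
  have triv: "carrier (F (Suc j)) = {\<zero>\<^bsub>F (Suc j)\<^esub>}"
    using assms(5,8) i by (simp add: complex_length_le_def)
  have M: "graded_module (Pic L \<Delta>) S M" and N: "graded_module (Pic L \<Delta>) S N"
    using assms(3,6) by (auto simp: fg_graded_module_def)
  have gP: "graded_module (Pic L \<Delta>) S (P k)" and hP: "module_hom S (P (Suc k)) (P k) (b k)" for k
    using assms(7) by (auto simp: graded_free_resolution_def fg_graded_free_complex_def fg_graded_free_def graded_hom_def)
  note mP = graded_module_module[OF gP] and mN = graded_module_module[OF N]
  have G: "group (Pic L \<Delta>)" by (rule comm_group.axioms(2)[OF toric.Pic_comm_group])
  let ?EC = "hom_module (Pic L \<Delta>) S (P (Suc j)) N"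
  let ?EK = "{k \<in> carrier ?EC. restrict (k \<circ> b (Suc j)) (carrier (P (Suc (Suc j)))) =
       \<zero>\<^bsub>hom_module (Pic L \<Delta>) S (P (Suc (Suc j))) N\<^esub>}"
  let ?EI = "(\<lambda>k. restrict (k \<circ> b j) (carrier (P (Suc j)))) ` carrier (hom_module (Pic L \<Delta>) S (P j) N)"
  let ?TC = "tensor_module (Pic L \<Delta>) S (P (Suc j)) N"
  let ?TK = "{z \<in> carrier ?TC. tensor_map S (P j) N (b j) z = \<zero>\<^bsub>tensor_module (Pic L \<Delta>) S (P j) N\<^esub>}"
  let ?TI = "tensor_map S (P (Suc j)) N (b (Suc j)) ` carrier (tensor_module (Pic L \<Delta>) S (P (Suc (Suc j))) N)"
  have Ext: "Ext_module (Pic L \<Delta>) S P b N i = subquotient ?EC ?EK ?EI"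
    by (simp add: Ext_module_def Let_def i)
  have Tor: "Tor_module (Pic L \<Delta>) S P b N i = subquotient ?TC ?TK ?TI"
    by (simp add: Tor_module_def Let_def i)
  have loc: "\<exists>h\<in>toric.units L \<Delta> Q. subquotient_annihilation S ?EC ?EK ?EI h \<and> subquotient_annihilation S ?TC ?TK ?TI h"
    if Q: "Q \<in> toric_points L \<Delta>" for Q
  proof -
    obtain h s' s'' where h: "h \<in> toric.units L \<Delta> Q" "module_hom S (P j) (P (Suc j)) s'"
        "module_hom S (P (Suc j)) (P (Suc (Suc j))) s''"
        "\<And>x. x \<in> carrier (P (Suc j)) \<Longrightarrow> h \<odot>\<^bsub>P (Suc j)\<^esub> x = s' (b j x) \<oplus>\<^bsub>P (Suc j)\<^esub> b (Suc j) (s'' x)"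
      using toric.local_contraction[OF assms(1) _ assms(4) _ triv Q] M assms(7) unfolding assms(2) by blast
    have hS: "h \<in> carrier S" unfolding assms(2) by (rule toric.units_carrier[OF h(1)])
    show ?thesis
      using Ext_annihilated[OF mP mN hP hS h(2-4)] Tor_annihilated[OF mP mN hP hS h(2-4)] h(1) by blast
  qed
  have zero_Ext: "\<zero>\<^bsub>?EC\<^esub> \<in> ?EK"
  proof -
    have "\<zero>\<^bsub>?EC\<^esub> \<in> carrier ?EC"
      by (rule abelian_monoid.zero_closed[OF abelian_group.axioms(1)[OF hom_module_abelian_group[OF mP mN]]])
    moreover have "restrict (\<zero>\<^bsub>?EC\<^esub> \<circ> b (Suc j)) (carrier (P (Suc (Suc j)))) = \<zero>\<^bsub>hom_module (Pic L \<Delta>) S (P (Suc (Suc j))) N\<^esub>"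
      unfolding hom_module_def ring.simps by (rule restrict_ext) (simp add: module_hom_closed[OF hP])
    ultimately show ?thesis by simp
  qed
  have zero_Tor: "\<zero>\<^bsub>?TC\<^esub> \<in> ?TK"
  proof -
    interpret tensor_hom S "P (Suc j)" N "Pic L \<Delta>" "P j" "b j"
      by (intro tensor_hom.intro tensor_setting.intro mP mN tensor_hom_axioms.intro hP)
    show ?thesis
      using tm_zero abelian_monoid.zero_closed[OF abelian_group.axioms(1)[OF src.MN_abelian_group]] by simp
  qed
  have vanish: "sheaf_zero L \<Delta> (tilde L \<Delta> (subquotient C K I))"
    if ann: "\<And>Q. Q \<in> toric_points L \<Delta> \<Longrightarrow> \<exists>h\<in>toric.units L \<Delta> Q. subquotient_annihilation S C K I h"
      and zero: "\<zero>\<^bsub>C\<^esub> \<in> K" "\<zero>\<^bsub>C\<^esub> \<in> grade C \<one>\<^bsub>Pic L \<Delta>\<^esub>"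
    for C :: "(('v, 'k) cox_poly, 'c, 'v pic) graded" and K I
  proof (rule toric.sheaf_zero_if_annihilated[OF _ subquotient_grade_subset])
    obtain Q where "Q \<in> (toric_points L \<Delta> :: ('v, 'k) pt set)"
      using toric_points_nonempty assms(1) unfolding smooth_projective_fan_def by blast
    then obtain h where h: "subquotient_annihilation S C K I h" using ann by blast
    show "\<zero>\<^bsub>subquotient C K I\<^esub> \<in> grade (subquotient C K I) \<one>\<^bsub>Pic L \<Delta>\<^esub>"
      by (rule subquotient_annihilation.subquotient_zero_grade[OF h zero])
  next
    fix Q assume "Q \<in> (toric_points L \<Delta> :: ('v, 'k) pt set)"
    then obtain h where hQ: "h \<in> toric.units L \<Delta> Q" and "subquotient_annihilation S C K I h" using ann by blast
    then interpret subquotient_annihilation S C K I h by simp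
    show "\<exists>h\<in>toric.units L \<Delta> Q. \<forall>r\<in>carrier (cox_ring L \<Delta>). \<forall>x\<in>carrier (subquotient C K I).
        h \<odot>\<^bsub>subquotient C K I\<^esub> (r \<odot>\<^bsub>subquotient C K I\<^esub> x) = \<zero>\<^bsub>subquotient C K I\<^esub>"
    proof (intro bexI[OF _ hQ] ballI)
      fix r :: "('v, 'k) cox_poly" and x
      assume r: "r \<in> carrier (cox_ring L \<Delta>)" and x: "x \<in> carrier (subquotient C K I)"
      have "r \<in> carrier S" using r by (simp only: assms(2))
      then show "h \<odot>\<^bsub>subquotient C K I\<^esub> (r \<odot>\<^bsub>subquotient C K I\<^esub> x) = \<zero>\<^bsub>subquotient C K I\<^esub>"
        by (rule subquotient_annihilated[OF subquotient_sm_closed[OF _ x]])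
    qed
  qed
  have zgE: "\<zero>\<^bsub>?EC\<^esub> \<in> grade ?EC \<one>\<^bsub>Pic L \<Delta>\<^esub>" by (rule hom_zero_grade[OF gP N G group.is_monoid[OF G, THEN monoid.one_closed]])
  have zgT: "\<zero>\<^bsub>?TC\<^esub> \<in> grade ?TC \<one>\<^bsub>Pic L \<Delta>\<^esub>" by (rule tensor_zero_grade[OF mP mN])
  have "sheaf_zero L \<Delta> (tilde L \<Delta> (subquotient ?EC ?EK ?EI))"
    by (rule vanish[OF _ zero_Ext zgE]) (use loc in blast)
  moreover have "sheaf_zero L \<Delta> (tilde L \<Delta> (subquotient ?TC ?TK ?TI))"
    by (rule vanish[OF _ zero_Tor zgT]) (use loc in blast)
  ultimately show ?thesis unfolding Ext Tor ..
qed

end
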